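(* There exists a feasible online policy $\bm\pi_{\mathrm{non}\text{-}\mathrm{deg}}$, which uses as inputs only $T$, $m$, and the constants $\bar r,\bar a,\bar b,\underline b,\lambda_{\min},\lambda,\mu,\delta_B$ of the distribution (defined in the context), such that for every non-degenerate distribution $\mathcal{P}$, $$\mathrm{Regret}_{\mathcal{P}}(\bm\pi_{\mathrm{non}\text{-}\mathrm{deg}})=\mathcal{O}(\log^2T),$$ where the constant in $\mathcal{O}(\cdot)$ does not depend on $T$.
   Context: Online linear programming with replenishment. There are $m$ resources and a horizon $T$. Tuples $(r_t,\bm{a}_t,\bm{b}_t)\in\mathbb{R}\times\mathbb{R}^m\times\mathbb{R}^m_{\geq 0}$, $t=1,\dots,T$, are drawn i.i.d. from an unknown distribution $\mathcal{P}$. Inventory starts at $0$. In period $t$ each resource $j$ is first replenished by $b_{jt}$; then the order $(r_t,\bm{a}_t)$ is revealed and the decision maker chooses $x_t\in\{0,1\}$ (possibly at random) based only on $(r_k,\bm{a}_k,\bm{b}_k,x_k)_{k<t}$ and $(r_t,\bm{a}_t,\bm{b}_t)$. A policy is feasible if for every realization $\sum_{k\le t}a_{jk}x_k\le\sum_{k\le t}b_{jk}$ for all $j,t$. $R^*$ is the maximum of $\sum_t r_tx_t$ over $\bm x\in\{0,1\}^T$ subject to these prefix constraints, and $\mathrm{Regret}_{\mathcal{P}}(\bm{\pi})=\mathbb{E}[R^*-\sum_t r_tx_t]$. Bounded distribution: constants $\bar r,\bar a,\bar b>0$ with $|r|<\bar r$, $\|\bm a\|_2<\bar a$, $\|\bm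 b\|_\infty<\bar b$ a.s., and $\underline b>0$ with $\mathbb{E}[b_j]>\underline b$ for all $j$. Let $\bm B=\mathbb{E}[\bm b]$. For $\bm B'\in\mathbb{R}^m_{\ge0}$ and $\bm p\in\mathbb{R}^m_{\ge0}$ let $f(\bm p;\bm B')=\langle\bm p,\bm B'\rangle+\mathbb{E}_{(r,\bm a,\bm b)\sim\mathcal P}[r-\langle\bm a,\bm p\rangle]^+$. Let $\Omega_b=\times_{j=1}^m(\underline b,\bar b)$ and $\Omega_p=\{\bm p\in\mathbb{R}^m_{\ge0}:\sum_jp_j\le\bar r/\underline b\}$. $\mathcal P$ is non-degenerate if it is bounded and: (1) $\mathbb{E}[\bm a\bm a^\top]$ is positive definite with minimum eigenvalue $\lambda_{\min}>0$; (2) there are $\lambda,\mu>0$ such that for all $\bm p'\in\Omega_p$, $\bm B'\in\Omega_b$ and every $\bm p^*\in\arg\min_{\bm p\ge0}f(\bm p;\bm B')$, with $(\tilde r,\tilde{\bm a},\tilde{\bm b})\sim\mathcal P$: $\lambda|\langle\tilde{\bm a},\bm p'\rangle-\langle\tilde{\bm a},\bm p^*\rangle|\le|\Pr(\tilde r>\langle\tilde{\bm a},\bm p'\rangle\mid\tilde{\bm a})-\Pr(\tilde r>\langle\tilde{\bm a},\bm p^*\rangle\mid\tilde{\bm a})|\le\mu|\langle\tilde{\bm a},\bm p'\rangle-\langle\tilde{\bm a},\bm p^*\rangle|$; (3) for all $\bm B'\in\Omega_b$, every $\bm p^*\in\arg\min_{\bm p\ge0}f(\bm p;\bm B')$ and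 every $j$: $p^*_j=0\iff B'_j>\mathbb{E}[a_j\mathbb{I}(r>\langle\bm a,\bm p^*\rangle)]$ and $p^*_j>0\iff B'_j=\mathbb{E}[a_j\mathbb{I}(r>\langle\bm a,\bm p^*\rangle)]$. For non-degenerate $\mathcal P$ and $\bm B'\in\Omega_b$ the minimizer of $f(\cdot;\bm B')$ over $\bm p\ge0$ is unique; call it $\bm p^*(\bm B')$ and let $I_B(\bm B')=\{j:p^*_j(\bm B')>0\}$. $\delta_B>0$ denotes a constant such that $\times_j(B_j-\delta_B,B_j+\delta_B)\subset\Omega_b$ and $I_B(\bm B')=I_B(\bm B)$ for all $\bm B'$ in this box (such a constant exists). *)

theory Defs
  imports "HOL-Probability.Probability"
begin

text \<open>An order is a triple (r, a, b) in R x R^m x R^m; resources indexed by the finite type 'm.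
  Periods are indexed 0..T-1 (period t here is period t+1 of the paper).\<close>
type_synonym 'm obs = "real \<times> (real ^ 'm) \<times> (real ^ 'm)"
type_synonym 'm hist = "('m obs \<times> bool) list"

text \<open>A (randomized) online decision rule: given the horizon T, the current period t, the
  history of past tuples and decisions, the current tuple, and a fresh independent
  Uniform[0,1] random number u_t (the policy's internal randomization), output x_t.\<close>
type_synonym 'm decision_rule = "nat \<Rightarrow> nat \<Rightarrow> 'm hist \<Rightarrow> 'm obs \<Rightarrow> real \<Rightarrow> bool"

fun run :: "'m decision_rule \<Rightarrow> nat \<Rightarrow> (nat \<Rightarrow> 'm obs) \<Rightarrow> (nat \<Rightarrow> real) \<Rightarrow> nat \<Rightarrow> 'm hist" where
  "run pol T w u 0 = []"
| "run pol T w u (Suc t) =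
     (let h = run pol T w u t in h @ [(w t, pol T t h (w t) (u t))])"

definition dec :: "'m decision_rule \<Rightarrow> nat \<Rightarrow> (nat \<Rightarrow> 'm obs) \<Rightarrow> (nat \<Rightarrow> real) \<Rightarrow> nat \<Rightarrow> bool" where
  "dec pol T w u t = pol T t (run pol T w u t) (w t) (u t)"

definition prefix_feasible :: "nat \<Rightarrow> (nat \<Rightarrow> ('m::finite) obs) \<Rightarrow> (nat \<Rightarrow> bool) \<Rightarrow> bool" where
  "prefix_feasible T w x \<longleftrightarrow>
     (\<forall>t<T. \<forall>j. (\<Sum>k\<le>t. fst (snd (w k)) $ j * of_bool (x k)) \<le> (\<Sum>k\<le>t. snd (snd (w k)) $ j))"

definition opt_reward :: "nat \<Rightarrow> (nat \<Rightarrow> ('m::finite) obs) \<Rightarrow> real" where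
  "opt_reward T w = Max ((\<lambda>x. \<Sum>t<T. fst (w t) * of_bool (x t)) `
       {x. prefix_feasible T w x \<and> (\<forall>t\<ge>T. \<not> x t)})"

text \<open>Feasibility of a policy for every realization (with nonnegative replenishments,
  which holds almost surely for every admissible distribution).\<close>
definition policy_feasible :: "('m::finite) decision_rule \<Rightarrow> bool" where
  "policy_feasible pol \<longleftrightarrow>
     (\<forall>T w u. (\<forall>t<T. \<forall>j. 0 \<le> snd (snd (w t)) $ j) \<longrightarrow> prefix_feasible T w (dec pol T w u))"

definition regret_fun :: "('m::finite) decision_rule \<Rightarrow> nat \<Rightarrow> (nat \<Rightarrow> 'm obs) \<times> (nat \<Rightarrow> real) \<Rightarrow> real" where
  "regret_fun pol T wu =
     opt_reward T (fst wu) - (\<Sum>t<T. fst (fst wu t) * of_bool (dec pol T (fst wu) (snd wu) t))"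

definition sample_space :: "('m::finite) obs measure \<Rightarrow> nat \<Rightarrow> ((nat \<Rightarrow> 'm obs) \<times> (nat \<Rightarrow> real)) measure" where
  "sample_space P T =
     (PiM {..<T} (\<lambda>_. P)) \<Otimes>\<^sub>M (PiM {..<T} (\<lambda>_. uniform_measure lborel {0..1::real}))"

definition Regret :: "('m::finite) obs measure \<Rightarrow> 'm decision_rule \<Rightarrow> nat \<Rightarrow> real" where
  "Regret P pol T = integral\<^sup>L (sample_space P T) (regret_fun pol T)"

definition bounded_dist :: "('m::finite) obs measure \<Rightarrow> real \<Rightarrow> real \<Rightarrow> real \<Rightarrow> real \<Rightarrow> bool" where
  "bounded_dist P rb ab bb bl \<longleftrightarrow>
     prob_space P \<and> sets P = sets borel \<and> rb > 0 \<and> ab > 0 \<and> bb > 0 \<and> bl > 0 \<and>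
     (AE \<omega> in P. \<bar>fst \<omega>\<bar> < rb \<and> norm (fst (snd \<omega>)) < ab \<and>
                 (\<forall>j. 0 \<le> snd (snd \<omega>) $ j \<and> snd (snd \<omega>) $ j < bb)) \<and>
     (\<forall>j. (\<integral>\<omega>. snd (snd \<omega>) $ j \<partial>P) > bl)"

definition mean_b :: "('m::finite) obs measure \<Rightarrow> real ^ 'm" where
  "mean_b P = (\<chi> j. \<integral>\<omega>. snd (snd \<omega>) $ j \<partial>P)"

definition fdual :: "('m::finite) obs measure \<Rightarrow> real ^ 'm \<Rightarrow> real ^ 'm \<Rightarrow> real" where
  "fdual P p B' = p \<bullet> B' + (\<integral>\<omega>. max 0 (fst \<omega> - fst (snd \<omega>) \<bullet> p) \<partial>P)"

definition nonneg_vec :: "real ^ ('m::finite) \<Rightarrow> bool" where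
  "nonneg_vec p \<longleftrightarrow> (\<forall>j. 0 \<le> p $ j)"

definition argmin_set :: "('m::finite) obs measure \<Rightarrow> real ^ 'm \<Rightarrow> (real ^ 'm) set" where
  "argmin_set P B' = {p. nonneg_vec p \<and> (\<forall>q. nonneg_vec q \<longrightarrow> fdual P p B' \<le> fdual P q B')}"

definition Omega_b :: "real \<Rightarrow> real \<Rightarrow> (real ^ ('m::finite)) set" where
  "Omega_b bl bb = {B'. \<forall>j. bl < B' $ j \<and> B' $ j < bb}"

definition Omega_p :: "real \<Rightarrow> real \<Rightarrow> (real ^ ('m::finite)) set" where
  "Omega_p rb bl = {p. nonneg_vec p \<and> (\<Sum>j\<in>UNIV. p $ j) \<le> rb / bl}"

definition second_moment :: "('m::finite) obs measure \<Rightarrow> real ^ 'm ^ 'm" where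
  "second_moment P = (\<chi> i j. \<integral>\<omega>. fst (snd \<omega>) $ i * fst (snd \<omega>) $ j \<partial>P)"

definition pos_def :: "real ^ ('m::finite) ^ 'm \<Rightarrow> bool" where
  "pos_def M \<longleftrightarrow> (\<forall>v. v \<noteq> 0 \<longrightarrow> v \<bullet> (M *v v) > 0)"

definition is_eigenvalue :: "real ^ ('m::finite) ^ 'm \<Rightarrow> real \<Rightarrow> bool" where
  "is_eigenvalue M l \<longleftrightarrow> (\<exists>v. v \<noteq> 0 \<and> M *v v = l *\<^sub>R v)"

definition is_min_eigenvalue :: "real ^ ('m::finite) ^ 'm \<Rightarrow> real \<Rightarrow> bool" where
  "is_min_eigenvalue M l \<longleftrightarrow> is_eigenvalue M l \<and> (\<forall>l'. is_eigenvalue M l' \<longrightarrow> l \<le> l')"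

definition accept_prob :: "('m::finite) obs measure \<Rightarrow> real ^ 'm \<Rightarrow> 'm obs \<Rightarrow> real" where
  "accept_prob P p = real_cond_exp P (vimage_algebra (space P) (\<lambda>\<omega>. fst (snd \<omega>)) borel)
                       (\<lambda>\<omega>. of_bool (fst \<omega> > fst (snd \<omega>) \<bullet> p))"

definition nondegenerate ::
  "('m::finite) obs measure \<Rightarrow> real \<Rightarrow> real \<Rightarrow> real \<Rightarrow> real \<Rightarrow> real \<Rightarrow> real \<Rightarrow> real \<Rightarrow> bool" where
  "nondegenerate P rb ab bb bl lmin lam mu \<longleftrightarrow>
     bounded_dist P rb ab bb bl \<and>
     pos_def (second_moment P) \<and> is_min_eigenvalue (second_moment P) lmin \<and> lmin > 0 \<and>
     lam > 0 \<and> mu > 0 \<and>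
     (\<forall>p' \<in> Omega_p rb bl. \<forall>B' \<in> Omega_b bl bb. \<forall>ps \<in> argmin_set P B'.
        AE \<omega> in P.
          lam * \<bar>fst (snd \<omega>) \<bullet> p' - fst (snd \<omega>) \<bullet> ps\<bar>
            \<le> \<bar>accept_prob P p' \<omega> - accept_prob P ps \<omega>\<bar> \<and>
          \<bar>accept_prob P p' \<omega> - accept_prob P ps \<omega>\<bar>
            \<le> mu * \<bar>fst (snd \<omega>) \<bullet> p' - fst (snd \<omega>) \<bullet> ps\<bar>) \<and>
     (\<forall>B' \<in> Omega_b bl bb. \<forall>ps \<in> argmin_set P B'. \<forall>j.
        (ps $ j = 0 \<longleftrightarrow> B' $ j > (\<integral>\<omega>. fst (snd \<omega>) $ j * of_bool (fst \<omega> > fst (snd \<omega>) \<bullet> ps) \<partial>P)) \<and>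
        (ps $ j > 0 \<longleftrightarrow> B' $ j = (\<integral>\<omega>. fst (snd \<omega>) $ j * of_bool (fst \<omega> > fst (snd \<omega>) \<bullet> ps) \<partial>P)))"

definition pstar :: "('m::finite) obs measure \<Rightarrow> real ^ 'm \<Rightarrow> real ^ 'm" where
  "pstar P B' = (THE p. p \<in> argmin_set P B')"

definition active_set :: "('m::finite) obs measure \<Rightarrow> real ^ 'm \<Rightarrow> 'm set" where
  "active_set P B' = {j. pstar P B' $ j > 0}"

definition valid_deltaB :: "('m::finite) obs measure \<Rightarrow> real \<Rightarrow> real \<Rightarrow> real \<Rightarrow> bool" where
  "valid_deltaB P bl bb dB \<longleftrightarrow> dB > 0 \<and>
     (\<forall>B'. (\<forall>j. \<bar>B' $ j - mean_b P $ j\<bar> < dB) \<longrightarrow>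
        B' \<in> Omega_b bl bb \<and> active_set P B' = active_set P (mean_b P))"

end

theory Submission
  imports Defs "HOL-Real_Asymp.Real_Asymp"
begin

text \<open>The policy accepts an order iff its reward exceeds its cost at the current price vector and the
  inventory suffices. By weak duality with the optimal dual price \<open>p*\<close>, its regret is at most the sum of
  the losses from pricing errors, of order \<open>|p_t - p*|^2\<close> in expectation, the rewards lost to stock-outs,
  and the \<open>p*\<close>-value of the final inventory.

  The price is a proportional-integral controller with gain of order \<open>1/n\<close>, \<open>n = min t (T - t)\<close>, which
  steers the inventory along the target \<open>sqrt (n log T)\<close>. In the first half of the horizon its base value
  is the running average of the past prices, which makes it stochastic gradient descent on the dual
  objective with step size of order \<open>1/t\<close>; in the second half the base value is frozen. Strong monotonicity of
  the dual gradient gives exponential moments of \<open>n |p_t - p*|^2\<close>, so with high probability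
  \<open>|p_t - p*|^2\<close> is of order \<open>log T / n\<close>, and these sum to \<open>log^2 T\<close>. On that event the inventory follows
  its target up to a smaller multiple of \<open>sqrt (n log T)\<close>. To absorb the transients, the policy
  rejects everything during the first and the last \<open>log^2 T\<close> periods; the buffer built up in the beginning
  then excludes stock-outs.\<close>

section \<open>The price space\<close>

text \<open>Leftover stock of a scarce resource is worth its price and counts as regret, so the
  stock must end within a power of \<open>ln T\<close>, while consumption at a fixed price
  fluctuates like \<open>sqrt T\<close>. Accurate prices alone do not achieve this. The controller
  is therefore built so that clock times (price minus base value), divided by \<open>gain\<close>,
  is the running sum of net use and target steps as long as no face of the price space interferes. A
  bound on the price error then becomes a bound on the inventory, tight where the clock is small, at
  both ends. The target steps disturb the prices in turn, so the concentration radius contains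
  \<open>scale^2\<close>. The circle closes because the resulting deviation is divided by
  \<open>gain\<close>; the squared norm of a target step grows with the number of resources, and so
  does \<open>rate\<close>. Prices follow the demand of the pure threshold rule, not the actual
  decisions. Hence the probabilistic part knows no stock-outs, and the inventory is analysed path by
  path. The distance of the optimal price from the faces of the price space is unknown to the
  policy; it only affects how large \<open>T\<close> must be.\<close>

lemma Omega_p_nonempty: "0 \<le> rb / bl \<Longrightarrow> 0 \<in> Omega_p rb bl"
  by (simp add: Omega_p_def nonneg_vec_def)

lemma convex_Omega_p: "convex (Omega_p rb bl)"
proof (rule convexI)
  fix x y :: "real^'m" and u v :: real
  assume x: "x \<in> Omega_p rb bl" and y: "y \<in> Omega_p rb bl" and uv: "0 \<le> u" "0 \<le> v" "u + v = 1"
  have "(\<Sum>j\<in>UNIV. (u *\<^sub>R x + v *\<^sub>R y) $ j) = u * (\<Sum>j\<in>UNIV. x $ j) + v * (\<Sum>j\<in>UNIV. y $ j)"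
    by (simp add: sum.distrib sum_distrib_left)
  also have "\<dots> \<le> u * (rb / bl) + v * (rb / bl)"
    using x y uv by (intro add_mono mult_left_mono) (auto simp: Omega_p_def)
  also have "\<dots> = rb / bl" using uv by (metis distrib_right mult_1)
  finally show "u *\<^sub>R x + v *\<^sub>R y \<in> Omega_p rb bl"
    using x y uv by (auto simp: Omega_p_def nonneg_vec_def)
qed

lemma closed_Omega_p: "closed (Omega_p rb bl)"
proof -
  have "Omega_p rb bl = {p. (\<forall>j. 0 \<le> p $ j)} \<inter> {p. (\<Sum>j\<in>UNIV. p $ j) \<le> rb / bl}"
    by (auto simp: Omega_p_def nonneg_vec_def)
  also have "{p::real^'m. (\<forall>j. 0 \<le> p $ j)} = (\<Inter>j. {p. 0 \<le> p $ j})" by auto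
  also have "closed ((\<Inter>j. {p::real^'m. 0 \<le> p $ j}) \<inter> {p. (\<Sum>j\<in>UNIV. p $ j) \<le> rb / bl})"
    by (intro closed_Int closed_INT ballI closed_Collect_le continuous_intros)
  finally show ?thesis .
qed

lemma norm_le_sum_nonneg: "nonneg_vec p \<Longrightarrow> norm p \<le> (\<Sum>j\<in>UNIV. p $ j)"
  using norm_le_l1_cart[of p] by (simp add: nonneg_vec_def)

lemma norm_Omega_p: "p \<in> Omega_p rb bl \<Longrightarrow> norm p \<le> rb / bl"
  using norm_le_sum_nonneg[of p] by (simp add: Omega_p_def)

lemma compact_Omega_p: "compact (Omega_p rb bl)"
  by (metis (no_types, lifting) boundedI closed_Omega_p compact_eq_bounded_closed norm_Omega_p)

text \<open>Where the budget is slack, the projection acts like taking positive parts. This follows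
  by testing its variational inequality with moves along one axis. In \<open>control_step\<close> it
  says that the projection can only raise a price, and leaves positive ones alone.\<close>

lemma closest_point_Omega_p_slack:
  fixes q :: "real^'m"
  assumes R: "0 \<le> rb / bl" and slack: "(\<Sum>j\<in>UNIV. closest_point (Omega_p rb bl) q $ j) < rb / bl"
  shows "q $ j \<le> closest_point (Omega_p rb bl) q $ j"
    and "0 < closest_point (Omega_p rb bl) q $ j \<Longrightarrow> q $ j = closest_point (Omega_p rb bl) q $ j"
proof -
  define p where "p = closest_point (Omega_p rb bl) q"
  have pin: "p \<in> Omega_p rb bl"
    unfolding p_def using Omega_p_nonempty[OF R] by (intro closest_point_in_set closed_Omega_p) auto
  have dot: "(q - p) \<bullet> (y - p) \<le> 0" if "y \<in> Omega_p rb bl" for y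
    unfolding p_def by (rule closest_point_dot[OF convex_Omega_p closed_Omega_p that])
  have sum_axis: "(\<Sum>i\<in>UNIV. axis j e $ i) = (e::real)" for e
    by (simp add: axis_def)
  show le: "q $ j \<le> p $ j"
  proof (rule ccontr)
    assume "\<not> q $ j \<le> p $ j"
    define e where "e = rb / bl - (\<Sum>j\<in>UNIV. p $ j)"
    have e: "e > 0" using slack by (simp add: e_def p_def)
    have "p + axis j e \<in> Omega_p rb bl"
      using pin e by (auto simp: Omega_p_def nonneg_vec_def sum.distrib sum_axis)
        (auto simp: e_def axis_def)
    from dot[OF this] have "(q $ j - p $ j) * e \<le> 0" by (simp add: inner_axis)
    thus False using e \<open>\<not> q $ j \<le> p $ j\<close> by (simp add: mult_le_0_iff)
  qed
  assume "0 < p $ j"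
  have "p + axis j (- (p $ j)) \<in> Omega_p rb bl"
    using pin \<open>0 < p $ j\<close> by (auto simp: Omega_p_def nonneg_vec_def sum.distrib sum_axis)
      (auto simp: axis_def)
  from dot[OF this] have "(q $ j - p $ j) * p $ j \<ge> 0" by (simp add: inner_axis)
  hence "q $ j \<ge> p $ j" using \<open>0 < p $ j\<close> by (simp add: zero_le_mult_iff)
  thus "q $ j = p $ j" using le by simp
qed

section \<open>The policy\<close>

text \<open>Used with \<open>h = T div 2\<close>, so that it is symmetric and returns to 0 at
  \<open>2 * h\<close>. For odd \<open>T\<close> one period is left over at the end; it is rejected
  together with the tail.\<close>

definition clock :: "nat \<Rightarrow> nat \<Rightarrow> nat" where
  "clock h t = min t (2 * h - t)"

text \<open>An increment of the inventory target \<open>2 * \<kappa> * sqrt (ln T * n)\<close>, with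
  \<open>n\<close> the clock. Added to the net use, it raises prices until consumption lags behind
  replenishment by this amount; it turns negative in the second half, where the stock is released
  again.\<close>

definition target_step :: "real \<Rightarrow> nat \<Rightarrow> nat \<Rightarrow> real" where
  "target_step \<kappa> T t =
     2 * \<kappa> * sqrt (ln T) * (sqrt (clock (T div 2) (Suc t)) - sqrt (clock (T div 2) t))"

text \<open>Two things at once: minus a stochastic gradient of \<open>fdual\<close> at
  \<open>p\<close>, and the stock consumed by the threshold rule if nothing is ever short. Because
  of this double role the price path records the inventory.\<close>

definition net_use :: "real^'m \<Rightarrow> ('m::finite) obs \<Rightarrow> real^'m" where
  "net_use p \<omega> = of_bool (fst (snd \<omega>) \<bullet> p < fst \<omega>) *\<^sub>R fst (snd \<omega>) - snd (snd \<omega>)"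

text \<open>The push away from \<open>m\<close> in the second half keeps the clock times
  \<open>p - m\<close> a running sum when the clock drops by one and \<open>m\<close> is frozen. In
  the first half the motion of the average \<open>m\<close> has the same effect. Once the clock
  reaches 0, division by zero yields 0 and the price stands still.\<close>

definition next_price where
  "next_price rb bl c \<kappa> T t p m \<omega> =
     closest_point (Omega_p rb bl)
       (p + (if t < T div 2 then 0 else 1 / clock (T div 2) (Suc t)) *\<^sub>R (p - m)
          + (c / clock (T div 2) (Suc t)) *\<^sub>R (net_use p \<omega> + vec (target_step \<kappa> T t)))"

definition next_avg :: "nat \<Rightarrow> nat \<Rightarrow> real^'m \<Rightarrow> real^'m \<Rightarrow> real^'m" where
  "next_avg T t p m = (if t < T div 2 then m + (1 / real (Suc t)) *\<^sub>R (p - m) else m)"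

primrec state :: "real \<Rightarrow> real \<Rightarrow> real \<Rightarrow> real \<Rightarrow> nat \<Rightarrow> (nat \<Rightarrow> ('m::finite) obs) \<Rightarrow> nat
    \<Rightarrow> (real^'m) \<times> (real^'m)" where
  "state rb bl c \<kappa> T w 0 = (0, 0)"
| "state rb bl c \<kappa> T w (Suc t) =
     (next_price rb bl c \<kappa> T t (fst (state rb bl c \<kappa> T w t)) (snd (state rb bl c \<kappa> T w t)) (w t),
      next_avg T t (fst (state rb bl c \<kappa> T w t)) (snd (state rb bl c \<kappa> T w t)))"

definition warmup :: "nat \<Rightarrow> nat" where
  "warmup T = nat \<lceil>(ln (real T))\<^sup>2\<rceil>"

text \<open>The price is recomputed from the past orders only and does not see the past decisions.
  Prices are thus updated in rejecting periods as well, and the stock check has no influence on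
  them.\<close>

definition policy :: "real \<Rightarrow> real \<Rightarrow> real \<Rightarrow> real \<Rightarrow> ('m::finite) decision_rule" where
  "policy rb bl c \<kappa> T t H \<omega> u \<longleftrightarrow>
     warmup T \<le> t \<and> t < 2 * (T div 2) - warmup T \<and>
     fst (snd \<omega>) \<bullet> fst (state rb bl c \<kappa> T (\<lambda>k. fst (H ! k)) t) < fst \<omega> \<and>
     (\<forall>j. fst (snd \<omega>) $ j \<le> snd (snd \<omega>) $ j +
        (\<Sum>k<t. snd (snd (fst (H ! k))) $ j - fst (snd (fst (H ! k))) $ j * of_bool (snd (H ! k))))"

lemma state_cong:
  "(\<And>k. k < t \<Longrightarrow> w k = w' k) \<Longrightarrow> state rb bl c \<kappa> T w t = state rb bl c \<kappa> T w' t"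
  by (induction t) auto

lemma length_run: "length (run pol T w u t) = t"
  by (induction t) (auto simp: Let_def)

lemma nth_run: "k < t \<Longrightarrow> run pol T w u t ! k = (w k, dec pol T w u k)"
  by (induction t) (auto simp: Let_def nth_append length_run less_Suc_eq dec_def)

lemma dec_policy:
  "dec (policy rb bl c \<kappa>) T w u t \<longleftrightarrow>
     warmup T \<le> t \<and> t < 2 * (T div 2) - warmup T \<and>
     fst (snd (w t)) \<bullet> fst (state rb bl c \<kappa> T w t) < fst (w t) \<and>
     (\<forall>j. fst (snd (w t)) $ j \<le> snd (snd (w t)) $ j +
        (\<Sum>k<t. snd (snd (w k)) $ j - fst (snd (w k)) $ j * of_bool (dec (policy rb bl c \<kappa>) T w u k)))"
proof -
  have "state rb bl c \<kappa> T (\<lambda>k. fst (run (policy rb bl c \<kappa>) T w u t ! k)) t = state rb bl c \<kappa> T w t"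
    by (rule state_cong) (simp add: nth_run)
  thus ?thesis
    unfolding dec_def[of _ T w u t] policy_def by (simp add: nth_run)
qed

lemma dec_policy_indep: "dec (policy rb bl c \<kappa>) T w u t = dec (policy rb bl c \<kappa>) T w u' t"
proof (induction t rule: less_induct)
  case (less t)
  thus ?case by (subst (1 2) dec_policy) simp
qed

lemma policy_feasible: "policy_feasible (policy rb bl c \<kappa>)"
  unfolding policy_feasible_def prefix_feasible_def
proof (intro allI impI)
  fix T t j u and w :: "nat \<Rightarrow> 'a obs"
  assume b: "\<forall>t<T. \<forall>j. 0 \<le> snd (snd (w t)) $ j" and "t < T"
  let ?x = "dec (policy rb bl c \<kappa>) T w u"
  from \<open>t < T\<close> show "(\<Sum>k\<le>t. fst (snd (w k)) $ j * of_bool (?x k)) \<le> (\<Sum>k\<le>t. snd (snd (w k)) $ j)"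
  proof (induction t)
    case 0
    thus ?case using b dec_policy[of rb bl c \<kappa> T w u 0] by (auto simp: of_bool_def)
  next
    case (Suc t)
    show ?case
    proof (cases "?x (Suc t)")
      case True
      thus ?thesis
        using dec_policy[of rb bl c \<kappa> T w u "Suc t"]
        by (auto simp: sum_subtractf lessThan_Suc_atMost algebra_simps dest!: spec[of _ j])
    next
      case False
      thus ?thesis using Suc b by (simp add: add_increasing2)
    qed
  qed
qed

section \<open>Consequences of non-degeneracy\<close>

text \<open>Rayleigh: a minimizer of the quadratic form on the unit sphere is an eigenvector,
  because the first-order term of every perturbation must vanish. The minimum is therefore at least
  the smallest eigenvalue.\<close>

lemma matrix_min_eigenvalue_bound:
  fixes M :: "real^'n^'n"
  assumes sym: "\<And>i j. M $ i $ j = M $ j $ i" and min: "is_min_eigenvalue M l"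
  shows "l * (norm v)\<^sup>2 \<le> v \<bullet> (M *v v)"
proof -
  let ?q = "\<lambda>v. v \<bullet> (M *v v)"
  have swap: "x \<bullet> (M *v y) = y \<bullet> (M *v x)" for x y
  proof -
    have "x \<bullet> (M *v y) = (\<Sum>i\<in>UNIV. \<Sum>j\<in>UNIV. x $ i * M $ i $ j * y $ j)"
      by (simp add: inner_vec_def matrix_vector_mult_def sum_distrib_left mult.assoc)
    also have "\<dots> = (\<Sum>j\<in>UNIV. \<Sum>i\<in>UNIV. x $ i * M $ i $ j * y $ j)" by (rule sum.swap)
    also have "\<dots> = (\<Sum>j\<in>UNIV. \<Sum>i\<in>UNIV. y $ j * M $ j $ i * x $ i)"
      by (intro sum.cong refl) (simp add: sym mult_ac)
    also have "\<dots> = y \<bullet> (M *v x)"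
      by (simp add: inner_vec_def matrix_vector_mult_def sum_distrib_left mult.assoc)
    finally show ?thesis .
  qed
  have "\<exists>x\<in>sphere 0 1. \<forall>y\<in>sphere 0 1. ?q x \<le> ?q y"
  proof (rule continuous_attains_inf)
    show "sphere (0::real^'n) 1 \<noteq> {}" by simp
    show "continuous_on (sphere 0 1) ?q"
      by (intro continuous_intros linear_continuous_on matrix_vector_mul_bounded_linear)
  qed simp
  then obtain x where x: "norm x = 1" and least: "\<And>y. norm y = 1 \<Longrightarrow> ?q x \<le> ?q y" by auto
  define \<rho> where "\<rho> = ?q x"
  have hom: "\<rho> * (norm y)\<^sup>2 \<le> ?q y" for y
  proof (cases "y = 0")
    case False
    have "\<rho> \<le> ?q ((1 / norm y) *\<^sub>R y)" unfolding \<rho>_def using False by (intro least) simp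
    also have "\<dots> = ?q y / (norm y)\<^sup>2"
      by (simp add: matrix_vector_mult_scaleR power2_eq_square)
    finally show ?thesis using False by (simp add: field_simps)
  qed simp
  have "M *v x = \<rho> *\<^sub>R x"
  proof -
    have orth: "z \<bullet> (M *v x - \<rho> *\<^sub>R x) = 0" for z
    proof -
      define b where "b = z \<bullet> (M *v x - \<rho> *\<^sub>R x)"
      define a where "a = ?q z - \<rho> * (norm z)\<^sup>2"
      have ineq: "0 \<le> 2 * e * b + e\<^sup>2 * a" for e
      proof -
        have "0 \<le> ?q (x + e *\<^sub>R z) - \<rho> * (norm (x + e *\<^sub>R z))\<^sup>2" using hom by simp
        also have "\<dots> = 2 * e * b + e\<^sup>2 * a"
          unfolding a_def b_def power2_norm_eq_inner
          using x swap[of x z] 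
          by (simp add: \<rho>_def norm_eq_1 inner_simps matrix_vector_right_distrib matrix_vector_mult_scaleR
            algebra_simps power2_eq_square inner_commute)
        finally show ?thesis .
      qed
      show "b = 0"
      proof (rule ccontr)
        assume "b \<noteq> 0"
        \<comment> \<open>Minimizes the quadratic in \<open>e\<close> after \<open>a\<close> has
          been enlarged to the positive number \<open>\<bar>a\<bar> + 1\<close>.\<close>
        define e where "e = - b / (\<bar>a\<bar> + 1)"
        have "2 * e * b + e\<^sup>2 * a \<le> 2 * e * b + e\<^sup>2 * (\<bar>a\<bar> + 1)"
          by (intro add_left_mono mult_left_mono) auto
        also have "\<dots> = - b\<^sup>2 / (\<bar>a\<bar> + 1)"
          by (simp add: e_def power2_eq_square divide_simps)
        also have "\<dots> < 0" using \<open>b \<noteq> 0\<close> by (simp add: divide_neg_pos)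
        finally show False using ineq[of e] by simp
      qed
    qed
    from orth[of "M *v x - \<rho> *\<^sub>R x"] show ?thesis by simp
  qed
  hence "is_eigenvalue M \<rho>" unfolding is_eigenvalue_def using x by (intro exI[of _ x]) auto
  hence "l \<le> \<rho>" using min by (auto simp: is_min_eigenvalue_def)
  thus ?thesis using hom[of v] by (meson mult_right_mono order_trans zero_le_power2)
qed

section \<open>Bounded orders and the optimal dual price\<close>

locale bounded_orders = prob_space P for P :: "('m::finite) obs measure" +
  fixes rb ab bb bl :: real
  assumes sets_P [measurable_cong]: "sets P = sets borel"
    and rb_pos: "0 < rb" and ab_pos: "0 < ab" and bb_pos: "0 < bb" and bl_pos: "0 < bl"
    and bounded: "AE \<omega> in P. \<bar>fst \<omega>\<bar> < rb \<and> norm (fst (snd \<omega>)) < ab \<and>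
                 (\<forall>j. 0 \<le> snd (snd \<omega>) $ j \<and> snd (snd \<omega>) $ j < bb)"
    and mean_gt: "\<And>j. bl < (\<integral>\<omega>. snd (snd \<omega>) $ j \<partial>P)"
begin

lemma space_P: "space P = UNIV"
  using sets_eq_imp_space_eq[OF sets_P] by simp

lemma measurable_cont: "continuous_on UNIV (f :: 'm obs \<Rightarrow> 'b::topological_space) \<Longrightarrow> f \<in> P \<rightarrow>\<^sub>M borel"
  using borel_measurable_continuous_onI measurable_cong_sets[OF sets_P refl] by blast

lemma measurable_proj [measurable]:
  "fst \<in> P \<rightarrow>\<^sub>M borel"
  "(\<lambda>\<omega>. fst (snd \<omega>)) \<in> P \<rightarrow>\<^sub>M borel"
  "(\<lambda>\<omega>. snd (snd \<omega>)) \<in> P \<rightarrow>\<^sub>M borel"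
  "(\<lambda>\<omega>. fst (snd \<omega>) $ j) \<in> P \<rightarrow>\<^sub>M borel"
  "(\<lambda>\<omega>. snd (snd \<omega>) $ j) \<in> P \<rightarrow>\<^sub>M borel"
  by (intro measurable_cont continuous_intros)+

lemma ab_le: "AE \<omega> in P. \<bar>fst (snd \<omega>) \<bullet> p\<bar> \<le> ab * norm p"
  using bounded
proof eventually_elim
  case (elim \<omega>)
  have "\<bar>fst (snd \<omega>) \<bullet> p\<bar> \<le> norm (fst (snd \<omega>)) * norm p" by (rule Cauchy_Schwarz_ineq2)
  also have "\<dots> \<le> ab * norm p" using elim by (intro mult_right_mono) auto
  finally show ?case .
qed

lemma integrable_bdd:
  "f \<in> borel_measurable P \<Longrightarrow> AE \<omega> in P. \<bar>f \<omega>\<bar> \<le> C \<Longrightarrow> integrable P (f :: _ \<Rightarrow> real)"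
  by (rule integrable_const_bound[where B = C]) auto

lemma integrable_b: "integrable P (\<lambda>\<omega>. snd (snd \<omega>) $ j)"
proof (rule integrable_bdd[where C = bb])
  show "AE \<omega> in P. \<bar>snd (snd \<omega>) $ j\<bar> \<le> bb"
    using bounded by eventually_elim (auto intro: less_imp_le)
qed measurable

lemma integrable_use: "integrable P (\<lambda>\<omega>. fst (snd \<omega>) $ j * of_bool (fst (snd \<omega>) \<bullet> p < fst \<omega>))"
proof (rule integrable_bdd[where C = ab])
  show "AE \<omega> in P. \<bar>fst (snd \<omega>) $ j * of_bool (fst (snd \<omega>) \<bullet> p < fst \<omega>)\<bar> \<le> ab"
    using bounded
  proof eventually_elim
    case (elim \<omega>)
    have "\<bar>fst (snd \<omega>) $ j\<bar> \<le> ab" using component_le_norm_cart[of "fst (snd \<omega>)" j] elim by linarith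
    thus ?case using ab_pos by (auto simp: of_bool_def)
  qed
qed measurable

lemma integrable_surplus: "integrable P (\<lambda>\<omega>. max 0 (fst \<omega> - fst (snd \<omega>) \<bullet> p))"
proof (rule integrable_bdd[where C = "rb + ab * norm p"])
  show "AE \<omega> in P. \<bar>max 0 (fst \<omega> - fst (snd \<omega>) \<bullet> p)\<bar> \<le> rb + ab * norm p"
    using bounded ab_le[of p] by eventually_elim auto
qed measurable

lemma mean_b_in: "mean_b P \<in> Omega_b bl bb"
proof -
  have "(\<integral>\<omega>. snd (snd \<omega>) $ j \<partial>P) < (\<integral>\<omega>. bb \<partial>P)" for j
  proof (intro integral_less_AE_space integrable_b)
    show "AE \<omega> in P. snd (snd \<omega>) $ j < bb" using bounded by eventually_elim auto
  qed (auto simp: emeasure_space_1)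
  thus ?thesis using mean_gt by (simp add: Omega_b_def mean_b_def prob_space)
qed

lemma fdual_Lipschitz: "\<bar>fdual P p B - fdual P q B\<bar> \<le> (norm B + ab) * norm (p - q)"
proof -
  let ?s = "\<lambda>p \<omega>. max 0 (fst \<omega> - fst (snd \<omega>) \<bullet> p) :: real"
  have "\<bar>(\<integral>\<omega>. ?s p \<omega> \<partial>P) - (\<integral>\<omega>. ?s q \<omega> \<partial>P)\<bar> = \<bar>\<integral>\<omega>. ?s p \<omega> - ?s q \<omega> \<partial>P\<bar>"
    by (simp add: Bochner_Integration.integral_diff integrable_surplus)
  also have "\<dots> \<le> (\<integral>\<omega>. \<bar>?s p \<omega> - ?s q \<omega>\<bar> \<partial>P)" by simp
  also have "\<dots> \<le> (\<integral>\<omega>. ab * norm (p - q) \<partial>P)"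
  proof (rule integral_mono_AE)
    show "AE \<omega> in P. \<bar>?s p \<omega> - ?s q \<omega>\<bar> \<le> ab * norm (p - q)"
      using ab_le[of "p - q"] by eventually_elim (auto simp: inner_diff_right max_def)
  qed (auto intro!: integrable_surplus)
  finally have 1: "\<bar>(\<integral>\<omega>. ?s p \<omega> \<partial>P) - (\<integral>\<omega>. ?s q \<omega> \<partial>P)\<bar> \<le> ab * norm (p - q)"
    by (simp add: prob_space)
  have "\<bar>p \<bullet> B - q \<bullet> B\<bar> \<le> norm B * norm (p - q)"
    using Cauchy_Schwarz_ineq2[of "p - q" B] by (simp add: inner_diff_left mult.commute)
  with 1 show ?thesis unfolding fdual_def by (simp add: distrib_right)
qed

lemma R_pos: "0 < rb / bl" using rb_pos bl_pos by simp

lemma budget_le_fdual: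
  assumes "nonneg_vec p"
  shows "bl * (\<Sum>j\<in>UNIV. p $ j) \<le> fdual P p (mean_b P)"
proof -
  have "bl * (\<Sum>j\<in>UNIV. p $ j) \<le> (\<Sum>j\<in>UNIV. p $ j * mean_b P $ j)"
    unfolding sum_distrib_left
  proof (rule sum_mono)
    fix j
    have "0 \<le> p $ j" "bl \<le> mean_b P $ j"
      using assms mean_b_in by (auto simp: nonneg_vec_def Omega_b_def intro: less_imp_le)
    thus "bl * p $ j \<le> p $ j * mean_b P $ j" by (metis mult.commute mult_left_mono)
  qed
  also have "\<dots> \<le> fdual P p (mean_b P)" by (simp add: fdual_def inner_vec_def)
  finally show ?thesis .
qed

lemma fdual_0: "fdual P 0 B < rb"
proof -
  have "fdual P 0 B = (\<integral>\<omega>. max 0 (fst \<omega> - fst (snd \<omega>) \<bullet> 0) \<partial>P)" by (simp add: fdual_def)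
  also have "\<dots> < (\<integral>\<omega>. rb \<partial>P)"
  proof (intro integral_less_AE_space integrable_surplus)
    show "AE \<omega> in P. max 0 (fst \<omega> - fst (snd \<omega>) \<bullet> 0) < rb"
      using bounded by eventually_elim (use rb_pos in auto)
  qed (auto simp: emeasure_space_1)
  finally show ?thesis by (simp add: prob_space)
qed

text \<open>Compactness gives a minimizer in \<open>Omega_p\<close>; outside, the replenishment term
  alone is at least \<open>rb\<close>, while the value at 0 is below \<open>rb\<close>. The same
  strict gap keeps the minimizer off the budget face, so that near it projections act as in
  \<open>closest_point_Omega_p_slack\<close>.\<close>

lemma dual_minimizer_exists:
  obtains p where "p \<in> argmin_set P (mean_b P)" "p \<in> Omega_p rb bl" "(\<Sum>j\<in>UNIV. p $ j) < rb / bl"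
proof -
  let ?f = "\<lambda>p. fdual P p (mean_b P)"
  have "continuous_on (Omega_p rb bl) ?f"
  proof (rule continuous_on_subset[OF _ subset_UNIV])
    have "(norm (mean_b P) + ab)-lipschitz_on UNIV ?f"
      using fdual_Lipschitz[of _ "mean_b P"] ab_pos by (intro lipschitz_onI) (auto simp: dist_norm)
    thus "continuous_on UNIV ?f" by (rule lipschitz_on_continuous_on)
  qed
  moreover have O: "0 \<in> Omega_p rb bl" using R_pos by (intro Omega_p_nonempty) simp
  ultimately obtain p where p: "p \<in> Omega_p rb bl" and le: "\<And>q. q \<in> Omega_p rb bl \<Longrightarrow> ?f p \<le> ?f q"
    using continuous_attains_inf[OF compact_Omega_p, of rb bl ?f] by auto
  have lt: "?f p < rb" using le[OF O] fdual_0[of "mean_b P"] by simp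
  have "?f p \<le> ?f q" if q: "nonneg_vec q" for q
  proof (cases "q \<in> Omega_p rb bl")
    case False
    hence "rb \<le> bl * (\<Sum>j\<in>UNIV. q $ j)" using q bl_pos by (simp add: Omega_p_def field_simps)
    thus ?thesis using budget_le_fdual[OF q] lt by simp
  qed (rule le)
  hence "p \<in> argmin_set P (mean_b P)" using p by (simp add: argmin_set_def Omega_p_def)
  moreover have "(\<Sum>j\<in>UNIV. p $ j) < rb / bl"
    using budget_le_fdual[of p] lt p bl_pos by (simp add: Omega_p_def field_simps)
  ultimately show ?thesis using that p by blast
qed

lemma inner_second_moment: "v \<bullet> (second_moment P *v v) = (\<integral>\<omega>. (fst (snd \<omega>) \<bullet> v)\<^sup>2 \<partial>P)"
proof -
  have int: "integrable P (\<lambda>\<omega>. fst (snd \<omega>) $ i * fst (snd \<omega>) $ j)" for i j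
  proof (rule integrable_bdd[where C = "ab * ab"])
    show "AE \<omega> in P. \<bar>fst (snd \<omega>) $ i * fst (snd \<omega>) $ j\<bar> \<le> ab * ab"
      using bounded
    proof eventually_elim
      case (elim \<omega>)
      have "\<bar>fst (snd \<omega>) $ i\<bar> \<le> ab" "\<bar>fst (snd \<omega>) $ j\<bar> \<le> ab"
        using component_le_norm_cart[of "fst (snd \<omega>)"] elim by (meson less_imp_le order_trans)+
      thus ?case by (simp add: abs_mult mult_mono')
    qed
  qed measurable
  have "v \<bullet> (second_moment P *v v)
      = (\<Sum>i\<in>UNIV. \<Sum>j\<in>UNIV. v $ i * v $ j * (\<integral>\<omega>. fst (snd \<omega>) $ i * fst (snd \<omega>) $ j \<partial>P))"
    by (simp add: inner_vec_def matrix_vector_mult_def second_moment_def sum_distrib_left mult_ac)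
  also have "\<dots> = (\<integral>\<omega>. (\<Sum>i\<in>UNIV. \<Sum>j\<in>UNIV. v $ i * v $ j * (fst (snd \<omega>) $ i * fst (snd \<omega>) $ j)) \<partial>P)"
    by (simp add: int Bochner_Integration.integral_sum)
  also have "\<dots> = (\<integral>\<omega>. (fst (snd \<omega>) \<bullet> v)\<^sup>2 \<partial>P)"
    by (simp add: inner_vec_def power2_eq_square sum_product mult_ac)
  finally show ?thesis .
qed

end

section \<open>Strong monotonicity of the dual gradient\<close>

definition order_sigma :: "('m::finite) obs measure \<Rightarrow> 'm obs measure" where
  "order_sigma P = vimage_algebra (space P) (\<lambda>\<omega>. fst (snd \<omega>)) borel"

text \<open>This is \<open>\<bar>a \<bullet> (p - q)\<bar>\<close> if the thresholds at
  \<open>p\<close> and \<open>q\<close> decide differently, and 0 otherwise. It bounds the surplus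
  at price \<open>q\<close> that is lost by deciding with \<open>p\<close>.\<close>

definition disagreement :: "real^'m \<Rightarrow> real^'m \<Rightarrow> ('m::finite) obs \<Rightarrow> real" where
  "disagreement p q \<omega> =
     (fst (snd \<omega>) \<bullet> (p - q)) * (of_bool (fst (snd \<omega>) \<bullet> q < fst \<omega>) - of_bool (fst (snd \<omega>) \<bullet> p < fst \<omega>))"

lemma disagreement_nonneg: "0 \<le> disagreement p q \<omega>"
  by (auto simp: disagreement_def inner_diff_right of_bool_def)

context bounded_orders
begin

lemma subalgebra_order_sigma: "finite_measure_subalgebra P (order_sigma P)"
proof
  show "subalgebra P (order_sigma P)"
    unfolding subalgebra_def order_sigma_def
    using measurable_proj(2) by (auto simp: sets_vimage_algebra2 dest: measurable_sets)
qed

text \<open>Given the order vector, the factor \<open>a \<bullet> (p - q)\<close> is known and the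
  indicators become acceptance probabilities. Nonnegativity survives the conditioning; it supplies
  the sign that the absolute values in the non-degeneracy condition leave open.\<close>

lemma disagreement_eq_accept_prob:
  "AE \<omega> in P. 0 \<le> (fst (snd \<omega>) \<bullet> (p - q)) * (accept_prob P q \<omega> - accept_prob P p \<omega>)"
  "integrable P (\<lambda>\<omega>. (fst (snd \<omega>) \<bullet> (p - q)) * (accept_prob P q \<omega> - accept_prob P p \<omega>))"
  "(\<integral>\<omega>. disagreement p q \<omega> \<partial>P) =
     (\<integral>\<omega>. (fst (snd \<omega>) \<bullet> (p - q)) * (accept_prob P q \<omega> - accept_prob P p \<omega>) \<partial>P)"
  "integrable P (disagreement p q)"
proof -
  interpret F: finite_measure_subalgebra P "order_sigma P" by (rule subalgebra_order_sigma)
  define y where "y = (\<lambda>\<omega>::'m obs. fst (snd \<omega>) \<bullet> (p - q))"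
  define I where "I = (\<lambda>p. \<lambda>\<omega>::'m obs. of_bool (fst (snd \<omega>) \<bullet> p < fst \<omega>) :: real)"
  have I [measurable]: "I p \<in> borel_measurable P" for p unfolding I_def by measurable
  have intI: "integrable P (I p)" for p
    by (rule integrable_bdd[where C = 1]) (auto simp: I_def)
  have "(\<lambda>\<omega>::'m obs. fst (snd \<omega>)) \<in> order_sigma P \<rightarrow>\<^sub>M borel"
    unfolding order_sigma_def using space_P by (intro measurable_vimage_algebra1) auto
  hence y [measurable]: "y \<in> borel_measurable (order_sigma P)" unfolding y_def by measurable
  have yP [measurable]: "y \<in> borel_measurable P" unfolding y_def by measurable
  have dis: "disagreement p q = (\<lambda>\<omega>. y \<omega> * (I q \<omega> - I p \<omega>))"
    by (auto simp: disagreement_def y_def I_def)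
  show int: "integrable P (disagreement p q)"
    unfolding dis
  proof (rule integrable_bdd[where C = "ab * norm (p - q)"])
    show "AE \<omega> in P. \<bar>y \<omega> * (I q \<omega> - I p \<omega>)\<bar> \<le> ab * norm (p - q)"
      using ab_le[of "p - q"] by eventually_elim (auto simp: y_def I_def of_bool_def)
  qed measurable
  let ?A = "\<lambda>p. real_cond_exp P (order_sigma P) (I p)"
  have A: "accept_prob P p = ?A p" for p
    by (simp add: accept_prob_def order_sigma_def I_def)
  have diff: "AE \<omega> in P. real_cond_exp P (order_sigma P) (\<lambda>\<omega>. I q \<omega> - I p \<omega>) \<omega> = ?A q \<omega> - ?A p \<omega>"
    by (rule F.real_cond_exp_diff[OF intI intI])
  have mult: "AE \<omega> in P. real_cond_exp P (order_sigma P) (disagreement p q) \<omega>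
      = y \<omega> * real_cond_exp P (order_sigma P) (\<lambda>\<omega>. I q \<omega> - I p \<omega>) \<omega>"
    unfolding dis by (rule F.real_cond_exp_mult) (use int dis in auto)
  have pos: "AE \<omega> in P. 0 \<le> real_cond_exp P (order_sigma P) (disagreement p q) \<omega>"
    by (rule F.real_cond_exp_pos) (auto simp: disagreement_nonneg borel_measurable_integrable[OF int])
  show "AE \<omega> in P. 0 \<le> (fst (snd \<omega>) \<bullet> (p - q)) * (accept_prob P q \<omega> - accept_prob P p \<omega>)"
    using diff mult pos by eventually_elim (simp add: A y_def)
  have i: "integrable P (\<lambda>\<omega>. y \<omega> * (I q \<omega> - I p \<omega>))" using int dis by simp
  note intg = F.real_cond_exp_intg[OF i y, simplified]
  have ae: "AE \<omega> in P. y \<omega> * real_cond_exp P (order_sigma P) (\<lambda>\<omega>. I q \<omega> - I p \<omega>) \<omega>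
     = (fst (snd \<omega>) \<bullet> (p - q)) * (accept_prob P q \<omega> - accept_prob P p \<omega>)"
    using diff by eventually_elim (simp add: A y_def)
  have m [measurable]: "accept_prob P p \<in> borel_measurable P" for p
    unfolding A by measurable
  show "integrable P (\<lambda>\<omega>. (fst (snd \<omega>) \<bullet> (p - q)) * (accept_prob P q \<omega> - accept_prob P p \<omega>))"
    by (rule Bochner_Integration.integrable_cong_AE_imp[OF intg(1)]) (use ae in \<open>auto elim: eventually_mono\<close>)
  show "(\<integral>\<omega>. disagreement p q \<omega> \<partial>P) =
     (\<integral>\<omega>. (fst (snd \<omega>) \<bullet> (p - q)) * (accept_prob P q \<omega> - accept_prob P p \<omega>) \<partial>P)"
    unfolding dis intg(2)[symmetric]
    by (rule integral_cong_AE) (use ae borel_measurable_integrable[OF intg(1)] in auto)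
qed

end

text \<open>All that the analysis of the policy uses of non-degeneracy.\<close>
locale regular_orders = bounded_orders P rb ab bb bl
  for P :: "('m::finite) obs measure" and rb ab bb bl +
  fixes \<gamma> \<mu> :: real and ps :: "real^'m"
  assumes gamma_pos: "0 < \<gamma>" and mu_pos: "0 < \<mu>"
    and ps_in: "ps \<in> Omega_p rb bl" and ps_slack: "(\<Sum>j\<in>UNIV. ps $ j) < rb / bl"
    and monotone: "\<And>p. p \<in> Omega_p rb bl \<Longrightarrow> \<gamma> * (norm (p - ps))\<^sup>2 \<le> - (\<integral>\<omega>. (p - ps) \<bullet> net_use p \<omega> \<partial>P)"
    and smooth: "\<And>p. p \<in> Omega_p rb bl \<Longrightarrow> (\<integral>\<omega>. disagreement p ps \<omega> \<partial>P) \<le> \<mu> * (norm (p - ps))\<^sup>2"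

text \<open>The expected disagreement lies between \<open>lam\<close> and \<open>mu\<close> times
  the second moment of \<open>a \<bullet> (p - ps)\<close>, which the least eigenvalue bounds from
  below and \<open>ab\<close> from above. This explains \<open>\<gamma> = lam * lmin\<close> and
  \<open>\<mu> = mu * ab^2\<close>. Complementary slackness at \<open>ps\<close> turns the lower
  bound into monotonicity.\<close>

lemma nondegenerate_regular:
  fixes P :: "('m::finite) obs measure"
  assumes nd: "nondegenerate P rb ab bb bl lmin lam mu"
  obtains ps where "regular_orders P rb ab bb bl (lam * lmin) (mu * ab\<^sup>2) ps"
proof -
  have bd: "bounded_dist P rb ab bb bl" using nd by (simp add: nondegenerate_def)
  interpret prob_space P using bd by (simp add: bounded_dist_def)
  interpret bounded_orders P rb ab bb bl
    by unfold_locales (use bd in \<open>auto simp: bounded_dist_def\<close>)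
  have lam: "0 < lam" "0 < mu" "0 < lmin" and min: "is_min_eigenvalue (second_moment P) lmin"
    using nd by (auto simp: nondegenerate_def)
  obtain ps where ps: "ps \<in> argmin_set P (mean_b P)" "ps \<in> Omega_p rb bl" "(\<Sum>j\<in>UNIV. ps $ j) < rb / bl"
    by (rule dual_minimizer_exists)
  define D where "D = (\<lambda>p. \<chi> j. \<integral>\<omega>. fst (snd \<omega>) $ j * of_bool (fst (snd \<omega>) \<bullet> p < fst \<omega>) \<partial>P)"
  have kkt: "ps $ j = 0 \<longleftrightarrow> D ps $ j < mean_b P $ j" "0 < ps $ j \<longleftrightarrow> mean_b P $ j = D ps $ j" for j
    using nd mean_b_in ps(1) unfolding nondegenerate_def D_def by (auto simp: Ball_def)
  have lip: "AE \<omega> in P. lam * \<bar>fst (snd \<omega>) \<bullet> p - fst (snd \<omega>) \<bullet> ps\<bar>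
            \<le> \<bar>accept_prob P p \<omega> - accept_prob P ps \<omega>\<bar> \<and>
          \<bar>accept_prob P p \<omega> - accept_prob P ps \<omega>\<bar>
            \<le> mu * \<bar>fst (snd \<omega>) \<bullet> p - fst (snd \<omega>) \<bullet> ps\<bar>" if "p \<in> Omega_p rb bl" for p
    using nd mean_b_in ps(1) that unfolding nondegenerate_def by blast
  have int_sq: "integrable P (\<lambda>\<omega>. (fst (snd \<omega>) \<bullet> v)\<^sup>2)" for v
  proof (rule integrable_bdd[where C = "(ab * norm v)\<^sup>2"])
    show "AE \<omega> in P. \<bar>(fst (snd \<omega>) \<bullet> v)\<^sup>2\<bar> \<le> (ab * norm v)\<^sup>2"
      using ab_le[of v]
    proof eventually_elim
      case (elim \<omega>)
      from power_mono[OF this, of 2] show ?case by simp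
    qed
  qed measurable
  have sq_ge: "lmin * (norm v)\<^sup>2 \<le> (\<integral>\<omega>. (fst (snd \<omega>) \<bullet> v)\<^sup>2 \<partial>P)" for v
    unfolding inner_second_moment[symmetric]
    by (rule matrix_min_eigenvalue_bound[OF _ min]) (simp add: second_moment_def mult.commute)
  have sq_le: "(\<integral>\<omega>. (fst (snd \<omega>) \<bullet> v)\<^sup>2 \<partial>P) \<le> ab\<^sup>2 * (norm v)\<^sup>2" for v
  proof -
    have "(\<integral>\<omega>. (fst (snd \<omega>) \<bullet> v)\<^sup>2 \<partial>P) \<le> (\<integral>\<omega>. (ab * norm v)\<^sup>2 \<partial>P)"
    proof (rule integral_mono_AE)
      show "AE \<omega> in P. (fst (snd \<omega>) \<bullet> v)\<^sup>2 \<le> (ab * norm v)\<^sup>2"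
        using ab_le[of v]
      proof eventually_elim
        case (elim \<omega>)
        from power_mono[OF this, of 2] show ?case by simp
      qed
    qed (auto intro: int_sq)
    thus ?thesis by (simp add: prob_space power_mult_distrib)
  qed
  note dis = disagreement_eq_accept_prob[of _ ps]
  show ?thesis
  proof (rule that, unfold_locales)
    fix p :: "real^'m" assume p: "p \<in> Omega_p rb bl"
    let ?y = "\<lambda>\<omega>. fst (snd \<omega>) \<bullet> (p - ps)"
    have lower: "lam * (norm (p - ps))\<^sup>2 * lmin \<le> (\<integral>\<omega>. disagreement p ps \<omega> \<partial>P)"
    proof -
      have "lam * (norm (p - ps))\<^sup>2 * lmin \<le> lam * (\<integral>\<omega>. (?y \<omega>)\<^sup>2 \<partial>P)"
        using sq_ge[of "p - ps"] lam by (simp add: mult_ac)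
      also have "\<dots> = (\<integral>\<omega>. lam * (?y \<omega>)\<^sup>2 \<partial>P)" by simp
      also have "\<dots> \<le> (\<integral>\<omega>. ?y \<omega> * (accept_prob P ps \<omega> - accept_prob P p \<omega>) \<partial>P)"
      proof (rule integral_mono_AE)
        show "AE \<omega> in P. lam * (?y \<omega>)\<^sup>2 \<le> ?y \<omega> * (accept_prob P ps \<omega> - accept_prob P p \<omega>)"
          using dis(1)[of p] lip[OF p]
        proof eventually_elim
          case (elim \<omega>)
          have "lam * (?y \<omega>)\<^sup>2 = \<bar>?y \<omega>\<bar> * (lam * \<bar>?y \<omega>\<bar>)" by (simp add: power2_eq_square)
          also have "\<dots> \<le> \<bar>?y \<omega>\<bar> * \<bar>accept_prob P ps \<omega> - accept_prob P p \<omega>\<bar>"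
            using elim by (intro mult_left_mono) (auto simp: inner_diff_right)
          also have "\<dots> = ?y \<omega> * (accept_prob P ps \<omega> - accept_prob P p \<omega>)"
            using elim(1) by (metis abs_mult abs_of_nonneg)
          finally show ?case .
        qed
      qed (auto intro: int_sq dis(2))
      finally show ?thesis by (simp add: dis(3))
    qed
    show "(\<integral>\<omega>. disagreement p ps \<omega> \<partial>P) \<le> mu * ab\<^sup>2 * (norm (p - ps))\<^sup>2"
    proof -
      have "(\<integral>\<omega>. disagreement p ps \<omega> \<partial>P) \<le> (\<integral>\<omega>. mu * (?y \<omega>)\<^sup>2 \<partial>P)"
        unfolding dis(3)
      proof (rule integral_mono_AE)
        show "AE \<omega> in P. ?y \<omega> * (accept_prob P ps \<omega> - accept_prob P p \<omega>) \<le> mu * (?y \<omega>)\<^sup>2"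
          using lip[OF p]
        proof eventually_elim
          case (elim \<omega>)
          have "?y \<omega> * (accept_prob P ps \<omega> - accept_prob P p \<omega>)
              \<le> \<bar>?y \<omega>\<bar> * \<bar>accept_prob P ps \<omega> - accept_prob P p \<omega>\<bar>" by (metis abs_ge_self abs_mult)
          also have "\<dots> \<le> \<bar>?y \<omega>\<bar> * (mu * \<bar>?y \<omega>\<bar>)"
            using elim by (intro mult_left_mono) (auto simp: inner_diff_right)
          finally show ?case by (simp add: power2_eq_square mult_ac)
        qed
      qed (auto intro: int_sq dis(2))
      also have "\<dots> = mu * (\<integral>\<omega>. (?y \<omega>)\<^sup>2 \<partial>P)" by simp
      also have "\<dots> \<le> mu * (ab\<^sup>2 * (norm (p - ps))\<^sup>2)" using sq_le lam by (intro mult_left_mono) auto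
      finally show ?thesis by (simp add: mult.assoc)
    qed
    have net: "(\<integral>\<omega>. v \<bullet> net_use q \<omega> \<partial>P) = v \<bullet> (D q - mean_b P)" for v q
    proof -
      have "(\<integral>\<omega>. v \<bullet> net_use q \<omega> \<partial>P) =
        (\<integral>\<omega>. (\<Sum>j\<in>UNIV. v $ j * (fst (snd \<omega>) $ j * of_bool (fst (snd \<omega>) \<bullet> q < fst \<omega>) - snd (snd \<omega>) $ j)) \<partial>P)"
        by (simp add: net_use_def inner_vec_def mult.commute)
      also have "\<dots> = (\<Sum>j\<in>UNIV. v $ j * ((\<integral>\<omega>. fst (snd \<omega>) $ j * of_bool (fst (snd \<omega>) \<bullet> q < fst \<omega>) \<partial>P)
          - (\<integral>\<omega>. snd (snd \<omega>) $ j \<partial>P)))"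
        by (simp add: integrable_use integrable_b
              Bochner_Integration.integral_sum Bochner_Integration.integral_diff)
      also have "\<dots> = v \<bullet> (D q - mean_b P)" by (simp add: inner_vec_def[of v] D_def mean_b_def)
      finally show ?thesis .
    qed
    have intv: "integrable P (\<lambda>\<omega>. v \<bullet> net_use q \<omega>)" for v q
    proof -
      have "integrable P (\<lambda>\<omega>. (\<Sum>j\<in>UNIV. v $ j * (fst (snd \<omega>) $ j * of_bool (fst (snd \<omega>) \<bullet> q < fst \<omega>) - snd (snd \<omega>) $ j)))"
        by (intro Bochner_Integration.integrable_sum integrable_mult_right Bochner_Integration.integrable_diff
              integrable_use integrable_b)
      thus ?thesis by (simp add: net_use_def inner_vec_def mult.commute)
    qed
    \<comment> \<open>Replenishments cancel in the difference of net uses at \<open>ps\<close> and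
      \<open>p\<close>, so the disagreement is this difference in the direction
      \<open>p - ps\<close>, for every order.\<close>
    have "(\<integral>\<omega>. disagreement p ps \<omega> \<partial>P) = (\<integral>\<omega>. (p - ps) \<bullet> net_use ps \<omega> - (p - ps) \<bullet> net_use p \<omega> \<partial>P)"
      by (intro Bochner_Integration.integral_cong refl)
        (auto simp: disagreement_def net_use_def inner_simps inner_commute of_bool_def)
    also have "\<dots> = (p - ps) \<bullet> (D ps - mean_b P) - (\<integral>\<omega>. (p - ps) \<bullet> net_use p \<omega> \<partial>P)"
      by (simp add: intv Bochner_Integration.integral_diff net)
    \<comment> \<open>Complementary slackness: mean net use at \<open>ps\<close> vanishes where
      \<open>ps $ j > 0\<close>; where \<open>ps $ j = 0\<close> it is negative and
      \<open>p $ j - ps $ j\<close> is nonnegative.\<close>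
    also have "(p - ps) \<bullet> (D ps - mean_b P) \<le> 0"
      unfolding inner_vec_def
    proof (rule sum_nonpos)
      fix j
      have "0 \<le> p $ j" "0 \<le> ps $ j" using p ps(2) by (auto simp: Omega_p_def nonneg_vec_def)
      thus "(p - ps) $ j \<bullet> (D ps - mean_b P) $ j \<le> 0"
        using kkt[of j] by (cases "ps $ j = 0") (auto simp: mult_le_0_iff)
    qed
    finally show "lam * lmin * (norm (p - ps))\<^sup>2 \<le> - (\<integral>\<omega>. (p - ps) \<bullet> net_use p \<omega> \<partial>P)"
      using lower by (simp add: mult_ac)
  qed (use lam ab_pos ps in auto)
qed

section \<open>Concentration of the prices\<close>

lemma exp_convex_comb:
  fixes l :: real
  assumes "0 \<le> l" "l \<le> 1"
  shows "exp ((1 - l) * x + l * y) \<le> (1 - l) * exp x + l * exp y"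
  using convex_onD[OF exp_convex, of l x y] assms by simp

lemma exp_minus_le: "0 \<le> x \<Longrightarrow> x \<le> 1 \<Longrightarrow> exp (- x) \<le> 1 - x / 2" for x :: real
proof -
  assume x: "0 \<le> x" "x \<le> 1"
  have "exp (-1::real) \<le> 1 / 2" using exp_ge_add_one_self[of 1] by (simp add: exp_minus field_simps)
  hence "x * exp (-1) \<le> x * (1 / 2)" using x by (intro mult_left_mono) auto
  moreover have "exp ((1 - x) * 0 + x * (-1)) \<le> (1 - x) * exp 0 + x * exp (-1)" by (rule exp_convex_comb[OF x])
  ultimately show ?thesis by simp
qed

lemma split_sum: "s \<le> t \<Longrightarrow> (\<Sum>k<t. f k) = (\<Sum>k<s. f k) + (\<Sum>k=s..<t. f k)" for f :: "nat \<Rightarrow> real"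
  by (metis atLeast0LessThan sum.atLeastLessThan_concat le0)

lemma sqrt_sqrt_mult: "0 \<le> n \<Longrightarrow> sqrt n * (sqrt n * x) = n * x"
  by (simp add: mult.assoc[symmetric])

lemma two_mult_le_weighted_squares:
  fixes x y \<gamma> :: real
  assumes "0 < \<gamma>"
  shows "2 * x * y \<le> \<gamma> / 2 * x\<^sup>2 + 2 / \<gamma> * y\<^sup>2"
proof -
  have "0 \<le> (\<gamma> / 2) * (x - 2 / \<gamma> * y)\<^sup>2" using assms by simp
  also have "\<dots> = \<gamma> / 2 * x\<^sup>2 - 2 * x * y + 2 / \<gamma> * y\<^sup>2"
    using assms by (simp add: power2_eq_square field_simps)
  finally show ?thesis by simp
qed

lemma sqrt_Suc_diff_le: "\<bar>sqrt (real (Suc n)) - sqrt (real n)\<bar> \<le> 1 / sqrt (real (Suc n))"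
proof -
  have "(sqrt (real (Suc n)) - sqrt (real n)) * sqrt (real (Suc n)) = real (Suc n) - sqrt (real n * real (Suc n))"
    by (simp add: algebra_simps flip: real_sqrt_mult)
  also have "\<dots> \<le> real (Suc n) - sqrt (real n * real n)"
    by (intro diff_left_mono real_sqrt_le_mono mult_left_mono) auto
  finally show ?thesis by (simp add: field_simps)
qed

lemma norm_vec_square: "(norm (vec x :: real^'n))\<^sup>2 = real CARD('n) * x\<^sup>2"
  unfolding power2_norm_eq_inner by (simp add: inner_vec_def power2_eq_square)

lemma norm_add_square: "(norm (x + y))\<^sup>2 = (norm x)\<^sup>2 + 2 * (x \<bullet> y) + (norm y)\<^sup>2"
  for x y :: "'a::real_inner"
  by (simp add: power2_norm_eq_inner inner_add_left inner_add_right inner_commute)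

text \<open>Here \<open>K\<close> is the rate, \<open>g = 1 / \<gamma>\<close>, and
  \<open>K * g / \<tau>\<close> the step size. One unit of rate pays for the growth of the weight
  from \<open>\<tau>\<close> to \<open>\<tau> + 1\<close>; the rest leaves a convex combination of
  the old weighted error and a constant, the form to which convexity of \<open>exp\<close>
  applies.\<close>

lemma rising_phase_arith:
  fixes \<tau> K g V W D G :: real
  assumes K: "2 \<le> K" "K \<le> \<tau>" and D: "0 \<le> D" and V: "0 \<le> V" "V \<le> W / \<tau>"
  shows "(\<tau> + 1) * ((1 - K / \<tau>) * D + 2 * (K * g / \<tau>) * g * V + 2 * (K * g / \<tau>)\<^sup>2 * V + 2 * (K * g / \<tau>)\<^sup>2 * G\<^sup>2)
     \<le> (1 - (K - 1) / \<tau>) * (\<tau> * D) + (K - 1) / \<tau> * (16 * g\<^sup>2 * W + 8 * K * g\<^sup>2 * G\<^sup>2)"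
proof -
  have \<tau>: "\<tau> > 0" "\<tau> \<ge> 2" using K by auto
  have W: "0 \<le> W" using order_trans[OF V] \<tau> by (simp add: zero_le_divide_iff)
  let ?x = "2 * (K * g / \<tau>) * g * V + 2 * (K * g / \<tau>)\<^sup>2 * V + 2 * (K * g / \<tau>)\<^sup>2 * G\<^sup>2"
  have x0: "0 \<le> ?x"
  proof -
    have "2 * (K * g / \<tau>) * g * V = 2 * (K / \<tau>) * g\<^sup>2 * V" by (simp add: power2_eq_square)
    also have "\<dots> \<ge> 0" using K V \<tau> by simp
    finally show ?thesis using V by simp
  qed
  have a: "(\<tau> + 1) * ((1 - K / \<tau>) * D) \<le> (1 - (K - 1) / \<tau>) * (\<tau> * D)"
  proof -
    have "(1 - (K - 1) / \<tau>) * (\<tau> * D) - (\<tau> + 1) * ((1 - K / \<tau>) * D) = (K / \<tau>) * D"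
      using \<tau> by (simp add: field_simps)
    also have "\<dots> \<ge> 0" using K D \<tau> by simp
    finally show ?thesis by simp
  qed
  have "(\<tau> + 1) * ?x \<le> 2 * \<tau> * ?x" using \<tau> x0 by (intro mult_right_mono) auto
  also have "\<dots> = 4 * K * g\<^sup>2 * V + 4 * K * g\<^sup>2 * V * (K / \<tau>) + 4 * K\<^sup>2 * g\<^sup>2 * G\<^sup>2 / \<tau>"
    using \<tau> by (simp add: field_simps power2_eq_square)
  also have "\<dots> \<le> 4 * K * g\<^sup>2 * V + 4 * K * g\<^sup>2 * V * 1 + 4 * K\<^sup>2 * g\<^sup>2 * G\<^sup>2 / \<tau>"
    using K V \<tau> by (intro add_mono mult_left_mono order_refl) auto
  also have "\<dots> = 8 * K * g\<^sup>2 * V + 4 * K\<^sup>2 * g\<^sup>2 * G\<^sup>2 / \<tau>" by simp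
  also have "\<dots> \<le> 8 * K * g\<^sup>2 * (W / \<tau>) + 4 * K\<^sup>2 * g\<^sup>2 * G\<^sup>2 / \<tau>"
    using K V by (intro add_mono mult_left_mono order_refl) auto
  also have "\<dots> = K / \<tau> * (8 * g\<^sup>2 * W + 4 * K * g\<^sup>2 * G\<^sup>2)"
    using \<tau> by (simp add: field_simps power2_eq_square)
  also have "\<dots> \<le> (2 * (K - 1)) / \<tau> * (8 * g\<^sup>2 * W + 4 * K * g\<^sup>2 * G\<^sup>2)"
    using K W \<tau> by (intro mult_right_mono divide_right_mono add_nonneg_nonneg) auto
  also have "\<dots> = (K - 1) / \<tau> * (16 * g\<^sup>2 * W + 8 * K * g\<^sup>2 * G\<^sup>2)"
    using \<tau> by (simp add: field_simps)
  finally show ?thesis using a by (simp only: distrib_left add.assoc)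
qed

text \<open>Now the weight falls from \<open>N + 1\<close> to \<open>N\<close>, which helps, but the
  push away from the base value costs \<open>4 / N\<close> of contraction; together
  \<open>K - 3\<close> is left. \<open>E\<close> is the squared error of the base value. Since its
  known exponential moment is that of \<open>H * E / 4\<close>, the term \<open>2 * E\<close> needs
  \<open>8 \<le> K - 3\<close>, hence \<open>11 \<le> K\<close>.\<close>

lemma falling_phase_arith:
  fixes N K g V W D G E H :: real
  assumes K: "11 \<le> K" "K \<le> N" "N + 1 \<le> H" and D: "0 \<le> D" and V: "0 \<le> V" "V \<le> W / N" and E: "0 \<le> E"
  shows "N * ((1 - K / N + 4 / N) * D + 2 / N * E + 2 * (K * g / N) * g * V + 4 * (K * g / N)\<^sup>2 * V + 2 * (K * g / N)\<^sup>2 * G\<^sup>2)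
     \<le> (1 - (K - 3) / (N + 1)) * ((N + 1) * D)
       + (K - 3) / (N + 1) * (H * E / 4 + (24 * g\<^sup>2 * W + 8 * K * g\<^sup>2 * G\<^sup>2))"
proof -
  have N: "N > 0" "N \<ge> 11" using K by auto
  have W: "0 \<le> W" using order_trans[OF V] N by (simp add: zero_le_divide_iff)
  have a: "N * ((1 - K / N + 4 / N) * D) = (1 - (K - 3) / (N + 1)) * ((N + 1) * D)"
    using N by (simp add: field_simps)
  have b: "N * (2 / N * E) \<le> (K - 3) / (N + 1) * (H * E / 4)"
  proof -
    have "N * (2 / N * E) = 8 / (N + 1) * ((N + 1) * E / 4)" using N by (simp add: field_simps)
    also have "\<dots> \<le> (K - 3) / (N + 1) * (H * E / 4)"
      using K N E by (intro mult_mono divide_right_mono mult_right_mono) auto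
    finally show ?thesis .
  qed
  have "N * (2 * (K * g / N) * g * V + 4 * (K * g / N)\<^sup>2 * V + 2 * (K * g / N)\<^sup>2 * G\<^sup>2)
     = 2 * K * g\<^sup>2 * V + 4 * K * g\<^sup>2 * V * (K / N) + 2 * K\<^sup>2 * g\<^sup>2 * G\<^sup>2 / N"
    using N by (simp add: field_simps power2_eq_square)
  also have "\<dots> \<le> 2 * K * g\<^sup>2 * V + 4 * K * g\<^sup>2 * V * 1 + 2 * K\<^sup>2 * g\<^sup>2 * G\<^sup>2 / N"
    using K V N by (intro add_mono mult_left_mono order_refl) auto
  also have "\<dots> = 6 * K * g\<^sup>2 * V + 2 * K\<^sup>2 * g\<^sup>2 * G\<^sup>2 / N" by simp
  also have "\<dots> \<le> 6 * K * g\<^sup>2 * (W / N) + 2 * K\<^sup>2 * g\<^sup>2 * G\<^sup>2 / N"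
    using K V by (intro add_mono mult_left_mono order_refl) auto
  also have "\<dots> = K / N * (6 * g\<^sup>2 * W + 2 * K * g\<^sup>2 * G\<^sup>2)"
    using N by (simp add: field_simps power2_eq_square)
  also have "\<dots> \<le> (4 * (K - 3) / (N + 1)) * (6 * g\<^sup>2 * W + 2 * K * g\<^sup>2 * G\<^sup>2)"
  proof (rule mult_right_mono)
    have "K * (N + 1) \<le> (2 * (K - 3)) * (2 * N)" using K N by (intro mult_mono) auto
    thus "K / N \<le> 4 * (K - 3) / (N + 1)" using N by (simp add: field_simps)
  qed (use K W in auto)
  also have "\<dots> = (K - 3) / (N + 1) * (24 * g\<^sup>2 * W + 8 * K * g\<^sup>2 * G\<^sup>2)"
    using N by (simp add: field_simps)
  finally show ?thesis using a b by (simp only: distrib_left add.assoc)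
qed

lemma sum_inverse_sqrt_le: "(\<Sum>k<n. 1 / sqrt (real (Suc k))) \<le> 2 * sqrt (real n)"
proof (induction n)
  case (Suc n)
  have "1 / sqrt (real (Suc n)) \<le> 2 * (sqrt (real (Suc n)) - sqrt (real n))"
  proof -
    have "2 * (sqrt (real n) * sqrt (real (Suc n))) \<le> (sqrt (real n))\<^sup>2 + (sqrt (real (Suc n)))\<^sup>2"
      using sum_squares_bound[of "sqrt (real n)" "sqrt (real (Suc n))"] by simp
    hence "1 \<le> 2 * (sqrt (real (Suc n)) - sqrt (real n)) * sqrt (real (Suc n))"
      by (simp add: algebra_simps power2_eq_square)
    thus ?thesis by (simp add: field_simps)
  qed
  thus ?case using Suc by simp
qed simp

lemma clock_rising: "t \<le> h \<Longrightarrow> clock h t = t"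
  and clock_falling: "h \<le> t \<Longrightarrow> clock h t = 2 * h - t"
  by (auto simp: clock_def)

lemma target_step_bound:
  assumes "T \<ge> 1" "t < 2 * (T div 2)" "0 < \<kappa>"
  shows "(target_step \<kappa> T t)\<^sup>2 \<le> 4 * \<kappa>\<^sup>2 * ln T / max (clock (T div 2) (Suc t)) (clock (T div 2) t)"
proof -
  define h where "h = T div 2"
  define n where "n = min (clock h (Suc t)) (clock h t)"
  have t: "t < 2 * h" using assms(2) by (simp add: h_def)
  have n: "if t < h then clock h (Suc t) = Suc n \<and> clock h t = n else clock h (Suc t) = n \<and> clock h t = Suc n"
    using t unfolding n_def clock_def by (cases "t < h") auto
  hence mx: "max (clock h (Suc t)) (clock h t) = Suc n" by (auto split: if_splits)
  have "\<bar>sqrt (clock h (Suc t)) - sqrt (clock h t)\<bar> = \<bar>sqrt (real (Suc n)) - sqrt (real n)\<bar>"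
    using n by (auto split: if_splits)
  also have "\<dots> \<le> 1 / sqrt (real (Suc n))" by (rule sqrt_Suc_diff_le)
  finally have "\<bar>sqrt (clock h (Suc t)) - sqrt (clock h t)\<bar>\<^sup>2 \<le> (1 / sqrt (real (Suc n)))\<^sup>2"
    by (intro power_mono) auto
  hence "(sqrt (clock h (Suc t)) - sqrt (clock h t))\<^sup>2 \<le> 1 / real (Suc n)"
    by (simp add: power_divide)
  hence "4 * \<kappa>\<^sup>2 * ln T * (sqrt (clock h (Suc t)) - sqrt (clock h t))\<^sup>2 \<le> 4 * \<kappa>\<^sup>2 * ln T * (1 / real (Suc n))"
    using assms by (intro mult_left_mono) auto
  thus ?thesis
    unfolding h_def[symmetric] mx target_step_def using assms by (simp add: power_mult_distrib)
qed

text \<open>Fubini in the role of a conditional expectation: in the applications \<open>f\<close>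
  depends on the orders up to \<open>t\<close> and \<open>g\<close> on those before
  \<open>t\<close>, and integrating out coordinate \<open>t\<close> alone is conditioning on the
  past.\<close>

lemma (in prob_space) nn_integral_PiM_coordinate:
  fixes T :: nat
  assumes t: "t < T" and [measurable]: "f \<in> borel_measurable (PiM {..<T} (\<lambda>_. M))" "g \<in> borel_measurable (PiM {..<T} (\<lambda>_. M))"
    and indep: "\<And>x y. g (x(t := y)) = g x"
    and le: "\<And>x. (\<integral>\<^sup>+y. f (x(t := y)) \<partial>M) \<le> g x"
  shows "(\<integral>\<^sup>+x. f x \<partial>PiM {..<T} (\<lambda>_. M)) \<le> (\<integral>\<^sup>+x. g x \<partial>PiM {..<T} (\<lambda>_. M))"
proof -
  interpret product_sigma_finite "\<lambda>_::nat. M" by unfold_locales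
  define I where "I = {..<T} - {t}"
  have I: "finite I" "t \<notin> I" "{..<T} = insert t I" using t by (auto simp: I_def)
  have "(\<integral>\<^sup>+x. f x \<partial>PiM {..<T} (\<lambda>_. M)) = (\<integral>\<^sup>+x. (\<integral>\<^sup>+y. f (x(t := y)) \<partial>M) \<partial>PiM I (\<lambda>_. M))"
    unfolding I(3) by (rule product_nn_integral_insert) (use I in \<open>auto simp flip: I(3)\<close>)
  also have "\<dots> \<le> (\<integral>\<^sup>+x. g x \<partial>PiM I (\<lambda>_. M))" by (intro nn_integral_mono le)
  also have "\<dots> = (\<integral>\<^sup>+x. (\<integral>\<^sup>+y. g (x(t := y)) \<partial>M) \<partial>PiM I (\<lambda>_. M))"
    by (simp add: indep emeasure_space_1)
  also have "\<dots> = (\<integral>\<^sup>+x. g x \<partial>PiM {..<T} (\<lambda>_. M))"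
    unfolding I(3) by (rule product_nn_integral_insert[symmetric]) (use I in \<open>auto simp flip: I(3)\<close>)
  finally show ?thesis .
qed

section \<open>Exponential moments of the price error\<close>

context regular_orders
begin

text \<open>The rate is large enough, and the scale of the inventory target large enough compared to the noise,
  for \<open>radius2_small\<close>. At the inverse temperature \<open>temp\<close>, the quadratic term of Hoeffding's lemma
  uses up a quarter of the contraction provided by strong monotonicity.\<close>
definition dimn :: real where "dimn = real CARD('m)"
definition rate :: real where "rate = 720 * dimn"
definition gain :: real where "gain = rate / \<gamma>"
definition use_bound :: real where "use_bound = ab + dimn * bb"
definition diam2 :: real where "diam2 = 4 * (rb / bl)\<^sup>2"
definition scale :: real where "scale = 1 + 9 * (32 * rate * use_bound\<^sup>2 + (rate + 1) * diam2 * \<gamma>\<^sup>2)"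
definition temp :: real where "temp = \<gamma> / (8 * gain * use_bound\<^sup>2)"

abbreviation "\<Omega> \<equiv> Omega_p rb bl :: (real^'m) set"
abbreviation "Q T \<equiv> PiM {..<T} (\<lambda>_. P)"
abbreviation price :: "nat \<Rightarrow> (nat \<Rightarrow> 'm obs) \<Rightarrow> nat \<Rightarrow> real^'m" where
  "price T w t \<equiv> fst (state rb bl gain scale T w t)"
abbreviation avg :: "nat \<Rightarrow> (nat \<Rightarrow> 'm obs) \<Rightarrow> nat \<Rightarrow> real^'m" where
  "avg T w t \<equiv> snd (state rb bl gain scale T w t)"
abbreviation err :: "nat \<Rightarrow> (nat \<Rightarrow> 'm obs) \<Rightarrow> nat \<Rightarrow> real" where
  "err T w t \<equiv> (norm (price T w t - ps))\<^sup>2"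

lemma dimn_ge_1: "1 \<le> dimn" unfolding dimn_def by (simp add: Suc_le_eq)

lemma rate_ge: "720 \<le> rate" using dimn_ge_1 by (simp add: rate_def)

lemma constants_pos: "0 < rate" "0 < gain" "0 < use_bound" "0 < diam2" "0 < scale" "1 \<le> scale" "0 < temp"
proof -
  show r: "0 < rate" using rate_ge by simp
  show g: "0 < gain" using r gamma_pos by (simp add: gain_def)
  show u: "0 < use_bound" using ab_pos bb_pos dimn_ge_1 by (simp add: use_bound_def add_pos_nonneg)
  show d: "0 < diam2" using rb_pos bl_pos by (simp add: diam2_def)
  show "1 \<le> scale" using r u d gamma_pos by (simp add: scale_def)
  thus "0 < scale" by simp
  show "0 < temp" using g u gamma_pos by (simp add: temp_def)
qed

lemma Omega_ne: "\<Omega> \<noteq> {}" using ps_in by auto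

lemma closest_in: "closest_point \<Omega> q \<in> \<Omega>"
  by (rule closest_point_in_set[OF closed_Omega_p Omega_ne])

lemma closest_nonexp: "norm (closest_point \<Omega> q - ps) \<le> norm (q - ps)"
  using closest_point_lipschitz[OF convex_Omega_p closed_Omega_p Omega_ne, of q ps]
  by (simp add: closest_point_self ps_in dist_norm)

lemma diam2_bound: "p \<in> \<Omega> \<Longrightarrow> (norm (p - ps))\<^sup>2 \<le> diam2"
proof -
  assume "p \<in> \<Omega>"
  hence "norm (p - ps) \<le> 2 * (rb / bl)"
    using norm_triangle_ineq4[of p ps] norm_Omega_p[of p rb bl] norm_Omega_p[OF ps_in] by linarith
  hence "(norm (p - ps))\<^sup>2 \<le> (2 * (rb / bl))\<^sup>2" by (intro power_mono) auto
  thus ?thesis by (simp add: diam2_def power_mult_distrib power_divide)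
qed

lemma state_in: "price T w t \<in> \<Omega>" "avg T w t \<in> \<Omega>"
proof (induction t)
  case (Suc t)
  { case 1 show ?case by (simp add: next_price_def closest_in) }
  { case 2
    have "avg T w t + (1 / real (Suc t)) *\<^sub>R (price T w t - avg T w t)
        = (1 - 1 / real (Suc t)) *\<^sub>R avg T w t + (1 / real (Suc t)) *\<^sub>R price T w t"
      by (simp add: algebra_simps)
    also have "\<dots> \<in> \<Omega>" by (rule convexD[OF convex_Omega_p Suc(2,1)]) auto
    finally show ?case using Suc by (simp add: next_avg_def) }
qed (use R_pos in \<open>auto intro!: Omega_p_nonempty\<close>)

lemma net_use_bound: "AE \<omega> in P. norm (net_use p \<omega>) \<le> use_bound"
  using bounded
proof eventually_elim
  case (elim \<omega>)
  have "norm (net_use p \<omega>) \<le> norm (of_bool (fst (snd \<omega>) \<bullet> p < fst \<omega>) *\<^sub>R fst (snd \<omega>)) + norm (snd (snd \<omega>))"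
    unfolding net_use_def by (rule norm_triangle_ineq4)
  also have "norm (of_bool (fst (snd \<omega>) \<bullet> p < fst \<omega>) *\<^sub>R fst (snd \<omega>)) \<le> ab" using elim ab_pos by (auto simp: of_bool_def)
  also have "norm (snd (snd \<omega>)) \<le> (\<Sum>j\<in>UNIV. \<bar>snd (snd \<omega>) $ j\<bar>)" by (rule norm_le_l1_cart)
  also have "\<dots> \<le> (\<Sum>j\<in>(UNIV::'m set). bb)" using elim by (intro sum_mono) (auto intro: less_imp_le)
  finally show ?case by (simp add: use_bound_def dimn_def)
qed

lemma net_use_measurable [measurable]: "net_use p \<in> borel_measurable P"
  unfolding net_use_def[abs_def] by measurable

text \<open>\<open>e\<close> is the part of the step that is known before the order arrives.
  Projection does not increase the distance to \<open>ps\<close>, so the square can be expanded. The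
  mean of the linear term contributes \<open>- 2 * \<eta> * \<gamma>\<close> by monotonicity;
  Hoeffding's lemma gives back a quarter of it, leaving 3/2.\<close>

lemma one_step:
  assumes p: "p \<in> \<Omega>" and \<eta>: "0 < \<eta>" and N: "0 < N" "N * \<eta> \<le> 2 * gain"
  shows "(\<integral>\<^sup>+\<omega>. ennreal (exp (temp * (N * (norm (closest_point \<Omega> (p + e + \<eta> *\<^sub>R net_use p \<omega>) - ps))\<^sup>2))) \<partial>P)
    \<le> ennreal (exp (temp * (N * ((1 - 3/2 * \<eta> * \<gamma>) * (norm (p - ps))\<^sup>2 + 2 * ((p - ps) \<bullet> e)
           + 2 * (norm e)\<^sup>2 + 2 * \<eta>\<^sup>2 * use_bound\<^sup>2))))"
proof -
  define X where "X = (\<lambda>\<omega>. (p - ps) \<bullet> net_use p \<omega>)"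
  define d where "d = norm (p - ps)"
  define l where "l = 2 * temp * N * \<eta>"
  define A where "A = temp * (N * (d\<^sup>2 + 2 * ((p - ps) \<bullet> e) + 2 * (norm e)\<^sup>2 + 2 * \<eta>\<^sup>2 * use_bound\<^sup>2))"
  have l: "0 < l" using constants_pos \<eta> N by (simp add: l_def)
  have Xm [measurable]: "X \<in> borel_measurable P" unfolding X_def by measurable
  have Xb: "AE \<omega> in P. X \<omega> \<in> {- (use_bound * d)..use_bound * d}"
    using net_use_bound[of p]
  proof eventually_elim
    case (elim \<omega>)
    have "\<bar>X \<omega>\<bar> \<le> d * norm (net_use p \<omega>)" unfolding X_def d_def by (rule Cauchy_Schwarz_ineq2)
    also have "\<dots> \<le> d * use_bound" using elim by (intro mult_left_mono) (auto simp: d_def)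
    finally show ?case by (auto simp: mult.commute abs_le_iff)
  qed
  \<comment> \<open>The range is proportional to the distance \<open>d\<close>, so the Hoeffding
    term is quadratic in \<open>d\<close> and can be set against the contraction.\<close>
  interpret X: interval_bounded_random_variable P X "- (use_bound * d)" "use_bound * d"
    by unfold_locales (use Xb in auto)
  have EX: "expectation X \<le> - \<gamma> * d\<^sup>2" using monotone[OF p] by (simp add: X_def d_def)
  have pt: "AE \<omega> in P. ennreal (exp (temp * (N * (norm (closest_point \<Omega> (p + e + \<eta> *\<^sub>R net_use p \<omega>) - ps))\<^sup>2)))
      \<le> ennreal (exp (A + l * expectation X)) * ennreal (exp (l * (X \<omega> - expectation X)))"
    using net_use_bound[of p]
  proof eventually_elim
    case (elim \<omega>)
    let ?g = "net_use p \<omega>"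
    have "(norm (closest_point \<Omega> (p + e + \<eta> *\<^sub>R ?g) - ps))\<^sup>2 \<le> (norm ((p - ps) + (e + \<eta> *\<^sub>R ?g)))\<^sup>2"
      using closest_nonexp[of "p + e + \<eta> *\<^sub>R ?g"] by (intro power_mono) (auto simp: algebra_simps)
    also have "\<dots> = d\<^sup>2 + 2 * ((p - ps) \<bullet> e) + 2 * \<eta> * X \<omega> + (norm (e + \<eta> *\<^sub>R ?g))\<^sup>2"
      unfolding d_def X_def norm_add_square[of "p - ps"] by (simp add: inner_add_right)
    also have "(norm (e + \<eta> *\<^sub>R ?g))\<^sup>2 \<le> 2 * (norm e)\<^sup>2 + 2 * (norm (\<eta> *\<^sub>R ?g))\<^sup>2"
    proof -
      have "(norm (e + \<eta> *\<^sub>R ?g))\<^sup>2 \<le> (norm e + norm (\<eta> *\<^sub>R ?g))\<^sup>2" by (intro power_mono norm_triangle_ineq) auto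
      also have "\<dots> \<le> 2 * (norm e)\<^sup>2 + 2 * (norm (\<eta> *\<^sub>R ?g))\<^sup>2"
        using sum_squares_bound[of "norm e" "norm (\<eta> *\<^sub>R ?g)"] by (simp add: power2_sum)
      finally show ?thesis .
    qed
    also have "(norm (\<eta> *\<^sub>R ?g))\<^sup>2 \<le> \<eta>\<^sup>2 * use_bound\<^sup>2"
      using elim \<eta> by (simp add: power_mult_distrib power_mono)
    finally have "(norm (closest_point \<Omega> (p + e + \<eta> *\<^sub>R ?g) - ps))\<^sup>2
       \<le> (d\<^sup>2 + 2 * ((p - ps) \<bullet> e) + 2 * (norm e)\<^sup>2 + 2 * \<eta>\<^sup>2 * use_bound\<^sup>2) + 2 * \<eta> * X \<omega>" by simp
    hence "temp * (N * (norm (closest_point \<Omega> (p + e + \<eta> *\<^sub>R ?g) - ps))\<^sup>2)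
      \<le> temp * (N * ((d\<^sup>2 + 2 * ((p - ps) \<bullet> e) + 2 * (norm e)\<^sup>2 + 2 * \<eta>\<^sup>2 * use_bound\<^sup>2) + 2 * \<eta> * X \<omega>))"
      using constants_pos N by (intro mult_left_mono) auto
    also have "\<dots> = (A + l * expectation X) + l * (X \<omega> - expectation X)"
      unfolding A_def l_def by (simp add: algebra_simps)
    finally have "exp (temp * (N * (norm (closest_point \<Omega> (p + e + \<eta> *\<^sub>R ?g) - ps))\<^sup>2))
       \<le> exp (A + l * expectation X) * exp (l * (X \<omega> - expectation X))"
      by (simp only: mult_exp_exp exp_le_cancel_iff)
    thus ?case by (simp only: ennreal_mult[symmetric] exp_ge_zero ennreal_leI)
  qed
  have "(\<integral>\<^sup>+\<omega>. ennreal (exp (temp * (N * (norm (closest_point \<Omega> (p + e + \<eta> *\<^sub>R net_use p \<omega>) - ps))\<^sup>2))) \<partial>P)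
     \<le> (\<integral>\<^sup>+\<omega>. ennreal (exp (A + l * expectation X)) * ennreal (exp (l * (X \<omega> - expectation X))) \<partial>P)"
    by (rule nn_integral_mono_AE[OF pt])
  also have "\<dots> = ennreal (exp (A + l * expectation X)) * (\<integral>\<^sup>+\<omega>. ennreal (exp (l * (X \<omega> - expectation X))) \<partial>P)"
    by (rule nn_integral_cmult) measurable
  also have "\<dots> \<le> ennreal (exp (A + l * expectation X))
      * ennreal (exp (l\<^sup>2 * (use_bound * d - - (use_bound * d))\<^sup>2 / 8))"
    by (intro mult_left_mono X.Hoeffdings_lemma_nn_integral l) auto
  also have "\<dots> = ennreal (exp (A + l * expectation X + l\<^sup>2 * (use_bound * d)\<^sup>2 / 2))"
    by (simp add: ennreal_mult[symmetric] mult_exp_exp power_mult_distrib)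
  also have "\<dots> \<le> ennreal (exp (temp * (N * ((1 - 3/2 * \<eta> * \<gamma>) * d\<^sup>2 + 2 * ((p - ps) \<bullet> e)
           + 2 * (norm e)\<^sup>2 + 2 * \<eta>\<^sup>2 * use_bound\<^sup>2))))"
  proof (intro ennreal_leI, unfold exp_le_cancel_iff)
    have 1: "l * expectation X \<le> l * (- \<gamma> * d\<^sup>2)" using EX l by (intro mult_left_mono) auto
    have "l\<^sup>2 * (use_bound * d)\<^sup>2 / 2 = (temp * N * \<eta> * d\<^sup>2) * (2 * temp * use_bound\<^sup>2 * (N * \<eta>))"
      by (simp add: l_def power2_eq_square)
    also have "\<dots> \<le> (temp * N * \<eta> * d\<^sup>2) * (2 * temp * use_bound\<^sup>2 * (2 * gain))"
      using constants_pos N \<eta> by (intro mult_left_mono) auto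
    also have "2 * temp * use_bound\<^sup>2 * (2 * gain) = \<gamma> / 2"
      using constants_pos by (simp add: temp_def field_simps)
    finally have 2: "l\<^sup>2 * (use_bound * d)\<^sup>2 / 2 \<le> (temp * N * \<eta> * d\<^sup>2) * (\<gamma> / 2)" .
    have "A + l * (- \<gamma> * d\<^sup>2) + (temp * N * \<eta> * d\<^sup>2) * (\<gamma> / 2)
      = temp * (N * ((1 - 3/2 * \<eta> * \<gamma>) * d\<^sup>2 + 2 * ((p - ps) \<bullet> e) + 2 * (norm e)\<^sup>2 + 2 * \<eta>\<^sup>2 * use_bound\<^sup>2))"
      unfolding A_def l_def by (simp add: algebra_simps)
    thus "A + l * expectation X + l\<^sup>2 * (use_bound * d)\<^sup>2 / 2
      \<le> temp * (N * ((1 - 3/2 * \<eta> * \<gamma>) * d\<^sup>2 + 2 * ((p - ps) \<bullet> e) + 2 * (norm e)\<^sup>2 + 2 * \<eta>\<^sup>2 * use_bound\<^sup>2))"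
      using 1 2 by linarith
  qed
  finally show ?thesis unfolding d_def .
qed


lemma measurable_closest [measurable]: "closest_point \<Omega> \<in> borel \<rightarrow>\<^sub>M borel"
  by (intro borel_measurable_continuous_onI continuous_on_closest_point convex_Omega_p closed_Omega_p Omega_ne)

lemma state_measurable:
  "t \<le> T \<Longrightarrow> (\<lambda>w. price T w t) \<in> Q T \<rightarrow>\<^sub>M borel \<and> (\<lambda>w. avg T w t) \<in> Q T \<rightarrow>\<^sub>M borel"
proof (induction t)
  case (Suc t)
  have [measurable]: "(\<lambda>w. price T w t) \<in> Q T \<rightarrow>\<^sub>M borel" "(\<lambda>w. avg T w t) \<in> Q T \<rightarrow>\<^sub>M borel"
    using Suc by auto
  have [measurable]: "(\<lambda>w. w t) \<in> Q T \<rightarrow>\<^sub>M P" using Suc(2) by (intro measurable_component_singleton) auto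
  have [measurable]: "(\<lambda>w. net_use (price T w t) (w t)) \<in> Q T \<rightarrow>\<^sub>M borel"
    unfolding net_use_def by measurable
  have "(\<lambda>w. price T w t + x *\<^sub>R (price T w t - avg T w t) + y *\<^sub>R (net_use (price T w t) (w t) + v)) \<in> Q T \<rightarrow>\<^sub>M borel"
    for x y v by measurable
  from measurable_compose[OF this measurable_closest]
  have "(\<lambda>w. price T w (Suc t)) \<in> Q T \<rightarrow>\<^sub>M borel" unfolding state.simps fst_conv next_price_def .
  moreover have "(\<lambda>w. avg T w (Suc t)) \<in> Q T \<rightarrow>\<^sub>M borel"
    unfolding state.simps snd_conv next_avg_def by (cases "t < T div 2") simp_all
  ultimately show ?case ..
qed simp

lemma price_measurable [measurable]: "t \<le> T \<Longrightarrow> (\<lambda>w. price T w t) \<in> Q T \<rightarrow>\<^sub>M borel"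
  and avg_measurable [measurable]: "t \<le> T \<Longrightarrow> (\<lambda>w. avg T w t) \<in> Q T \<rightarrow>\<^sub>M borel"
  using state_measurable by auto


lemma prob_space_Q: "prob_space (Q T)"
  by (intro prob_space_PiM) unfold_locales

lemma state_upd: "t \<le> k \<Longrightarrow> state rb bl gain scale T (w(k := y)) t = state rb bl gain scale T w t"
  by (rule state_cong) simp

text \<open>Young's inequality, with the weight chosen so that the target step takes
  \<open>\<eta> * \<gamma> / 2\<close> of the factor 3/2 in \<open>one_step\<close>. Exactly
  \<open>\<eta> * \<gamma>\<close>, that is, rate over clock, remains.\<close>

lemma shift_term:
  assumes "0 \<le> \<eta>"
  shows "2 * ((p - ps) \<bullet> (\<eta> *\<^sub>R v)) \<le> \<eta> * \<gamma> / 2 * (norm (p - ps))\<^sup>2 + 2 * \<eta> * (1 / \<gamma>) * (norm v)\<^sup>2"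
proof -
  have "2 * ((p - ps) \<bullet> v) \<le> 2 * norm (p - ps) * norm v"
    using norm_cauchy_schwarz[of "p - ps" v] by simp
  also have "\<dots> \<le> \<gamma> / 2 * (norm (p - ps))\<^sup>2 + 2 / \<gamma> * (norm v)\<^sup>2"
    by (rule two_mult_le_weighted_squares[OF gamma_pos])
  finally have "\<eta> * (2 * ((p - ps) \<bullet> v)) \<le> \<eta> * (\<gamma> / 2 * (norm (p - ps))\<^sup>2 + 2 / \<gamma> * (norm v)\<^sup>2)"
    using assms by (rule mult_left_mono)
  thus ?thesis by (simp add: algebra_simps)
qed

definition shift_var :: "nat \<Rightarrow> real" where
  "shift_var T = 4 * dimn * scale\<^sup>2 * ln T"

lemma shift_var_nonneg: "1 \<le> T \<Longrightarrow> 0 \<le> shift_var T"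
  using dimn_ge_1 by (simp add: shift_var_def)

lemma norm_shift:
  assumes "1 \<le> T" "t < 2 * (T div 2)" "0 < n" "n \<le> max (clock (T div 2) (Suc t)) (clock (T div 2) t)"
  shows "(norm (vec (target_step scale T t) :: real^'m))\<^sup>2 \<le> shift_var T / n"
proof -
  have "(target_step scale T t)\<^sup>2 \<le> 4 * scale\<^sup>2 * ln T / max (clock (T div 2) (Suc t)) (clock (T div 2) t)"
    using assms constants_pos by (intro target_step_bound) auto
  also have "\<dots> \<le> 4 * scale\<^sup>2 * ln T / n"
    using assms by (intro divide_left_mono mult_pos_pos) auto
  finally have "dimn * (target_step scale T t)\<^sup>2 \<le> dimn * (4 * scale\<^sup>2 * ln T / n)"
    using dimn_ge_1 by (intro mult_left_mono) auto
  thus ?thesis by (simp add: norm_vec_square shift_var_def dimn_def mult_ac)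
qed

text \<open>The first two summands are the constant towards which \<open>rising_phase_arith\<close>
  contracts, with \<open>shift_var T\<close> of order \<open>ln T\<close>. The last one covers the
  early periods, in which only the diameter of the price space bounds the error.\<close>

definition rising_exponent :: "nat \<Rightarrow> real" where
  "rising_exponent T = 16 * (1 / \<gamma>)\<^sup>2 * shift_var T + 8 * rate * (1 / \<gamma>)\<^sup>2 * use_bound\<^sup>2 + (rate + 1) * diam2"

lemma err_le: "err T w t \<le> diam2"
  by (rule diam2_bound[OF state_in(1)])

text \<open>The bound is preserved: the recursion and convexity of \<open>exp\<close> make the new
  moment at most a convex combination of the old one and a constant, both below the claimed
  bound.\<close>

lemma rising_phase:
  assumes T: "1 \<le> T" and t: "t \<le> T div 2"
  shows "(\<integral>\<^sup>+w. ennreal (exp (temp * (real (Suc t) * err T w t))) \<partial>Q T) \<le> ennreal (exp (temp * rising_exponent T))"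
  using t
proof (induction t)
  case (Suc t)
  interpret Q: prob_space "Q T" by (rule prob_space_Q)
  have t: "t < T" "t \<le> T" "Suc t \<le> T" using Suc.prems by auto
  have th: "t < T div 2" using Suc.prems by simp
  note [measurable] = price_measurable[OF t(2)] price_measurable[OF t(3)]
  define \<tau> where "\<tau> = real (Suc t)"
  have \<tau>: "\<tau> > 0" by (simp add: \<tau>_def)
  \<comment> \<open>For \<open>\<tau> < rate\<close> the weight \<open>(rate - 1) / \<tau>\<close>
    of the convex combination may exceed 1, so the diameter has to serve.\<close>
  show ?case
  proof (cases "\<tau> < rate")
    case True
    have "(\<integral>\<^sup>+w. ennreal (exp (temp * (real (Suc (Suc t)) * err T w (Suc t)))) \<partial>Q T)
       \<le> (\<integral>\<^sup>+w. ennreal (exp (temp * rising_exponent T)) \<partial>Q T)"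
    proof (intro nn_integral_mono ennreal_leI, unfold exp_le_cancel_iff, intro mult_left_mono)
      fix w
      have "real (Suc (Suc t)) * err T w (Suc t) \<le> (rate + 1) * diam2"
        using True err_le[of T w "Suc t"] constants_pos by (intro mult_mono) (auto simp: \<tau>_def)
      also have "\<dots> \<le> rising_exponent T"
        unfolding rising_exponent_def using shift_var_nonneg[OF T] constants_pos by simp
      finally show "real (Suc (Suc t)) * err T w (Suc t) \<le> rising_exponent T" .
    qed (use constants_pos in auto)
    thus ?thesis by (simp add: Q.emeasure_space_1)
  next
    case False
    define \<alpha> where "\<alpha> = (rate - 1) / \<tau>"
    have \<alpha>: "0 \<le> \<alpha>" "\<alpha> \<le> 1" using False rate_ge \<tau> by (auto simp: \<alpha>_def)
    define Y where "Y = 16 * (1 / \<gamma>)\<^sup>2 * shift_var T + 8 * rate * (1 / \<gamma>)\<^sup>2 * use_bound\<^sup>2"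
    define f where "f = (\<lambda>w. ennreal (exp (temp * (real (Suc (Suc t)) * err T w (Suc t)))))"
    define g where "g = (\<lambda>w. ennreal (1 - \<alpha>) * ennreal (exp (temp * (real (Suc t) * err T w t))) + ennreal \<alpha> * ennreal (exp (temp * Y)))"
    have "(\<integral>\<^sup>+w. f w \<partial>Q T) \<le> (\<integral>\<^sup>+w. g w \<partial>Q T)"
    proof (rule nn_integral_PiM_coordinate[OF t(1)])
      show "f \<in> borel_measurable (Q T)" "g \<in> borel_measurable (Q T)" unfolding f_def g_def by measurable
      show "g (x(t := y)) = g x" for x y by (simp add: g_def state_upd)
      fix x :: "nat \<Rightarrow> 'm obs"
      define p where "p = price T x t"
      define v :: "real^'m" where "v = vec (target_step scale T t)"
      define \<eta> where "\<eta> = gain / \<tau>"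
      have \<eta>: "\<eta> > 0" "\<eta> = rate * (1 / \<gamma>) / \<tau>" using constants_pos gamma_pos \<tau> by (auto simp: \<eta>_def gain_def)
      have pin: "p \<in> \<Omega>" unfolding p_def by (rule state_in)
      have clk: "clock (T div 2) (Suc t) = Suc t" using Suc.prems by (rule clock_rising)
      have "f (x(t := y)) = ennreal (exp (temp * ((\<tau> + 1) * (norm (closest_point \<Omega> (p + \<eta> *\<^sub>R v + \<eta> *\<^sub>R net_use p y) - ps))\<^sup>2)))" for y
        using th clk by (simp add: f_def state_upd next_price_def p_def v_def \<eta>_def \<tau>_def algebra_simps)
      hence "(\<integral>\<^sup>+y. f (x(t := y)) \<partial>P) \<le> ennreal (exp (temp * ((\<tau> + 1) * ((1 - 3/2 * \<eta> * \<gamma>) * (norm (p - ps))\<^sup>2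
          + 2 * ((p - ps) \<bullet> (\<eta> *\<^sub>R v)) + 2 * (norm (\<eta> *\<^sub>R v))\<^sup>2 + 2 * \<eta>\<^sup>2 * use_bound\<^sup>2))))"
        using one_step[OF pin \<eta>(1), of "\<tau> + 1" "\<eta> *\<^sub>R v"] \<tau> constants_pos
        by (simp add: \<eta>_def field_simps \<tau>_def)
      also have "\<dots> \<le> ennreal (exp ((1 - \<alpha>) * (temp * (\<tau> * (norm (p - ps))\<^sup>2)) + \<alpha> * (temp * Y)))"
      proof (intro ennreal_leI, unfold exp_le_cancel_iff)
        have "(1 - 3/2 * \<eta> * \<gamma>) * (norm (p - ps))\<^sup>2
          + 2 * ((p - ps) \<bullet> (\<eta> *\<^sub>R v)) + 2 * (norm (\<eta> *\<^sub>R v))\<^sup>2 + 2 * \<eta>\<^sup>2 * use_bound\<^sup>2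
          \<le> (1 - \<eta> * \<gamma>) * (norm (p - ps))\<^sup>2 + 2 * \<eta> * (1 / \<gamma>) * (norm v)\<^sup>2 + 2 * \<eta>\<^sup>2 * (norm v)\<^sup>2 + 2 * \<eta>\<^sup>2 * use_bound\<^sup>2"
          using shift_term[of \<eta> p v] \<eta>(1) by (simp add: power_mult_distrib) (simp add: algebra_simps)
        also have "\<eta> * \<gamma> = rate / \<tau>" using \<eta> gamma_pos by simp
        finally have "(\<tau> + 1) * ((1 - 3/2 * \<eta> * \<gamma>) * (norm (p - ps))\<^sup>2
          + 2 * ((p - ps) \<bullet> (\<eta> *\<^sub>R v)) + 2 * (norm (\<eta> *\<^sub>R v))\<^sup>2 + 2 * \<eta>\<^sup>2 * use_bound\<^sup>2)
          \<le> (\<tau> + 1) * ((1 - rate / \<tau>) * (norm (p - ps))\<^sup>2 + 2 * \<eta> * (1 / \<gamma>) * (norm v)\<^sup>2 + 2 * \<eta>\<^sup>2 * (norm v)\<^sup>2 + 2 * \<eta>\<^sup>2 * use_bound\<^sup>2)"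
          using \<tau> by (intro mult_left_mono) auto
        also have "\<dots> \<le> (1 - \<alpha>) * (\<tau> * (norm (p - ps))\<^sup>2) + \<alpha> * Y"
          unfolding \<eta>(2) \<alpha>_def Y_def
        proof (rule rising_phase_arith)
          show "(norm v)\<^sup>2 \<le> shift_var T / \<tau>"
            unfolding v_def \<tau>_def using T th clk by (intro norm_shift) auto
        qed (use rate_ge False in auto)
        finally have "temp * ((\<tau> + 1) * ((1 - 3/2 * \<eta> * \<gamma>) * (norm (p - ps))\<^sup>2
          + 2 * ((p - ps) \<bullet> (\<eta> *\<^sub>R v)) + 2 * (norm (\<eta> *\<^sub>R v))\<^sup>2 + 2 * \<eta>\<^sup>2 * use_bound\<^sup>2))
          \<le> temp * ((1 - \<alpha>) * (\<tau> * (norm (p - ps))\<^sup>2) + \<alpha> * Y)"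
          using constants_pos by (intro mult_left_mono) auto
        also have "\<dots> = (1 - \<alpha>) * (temp * (\<tau> * (norm (p - ps))\<^sup>2)) + \<alpha> * (temp * Y)"
          by (simp add: algebra_simps)
        finally show "temp * ((\<tau> + 1) * ((1 - 3/2 * \<eta> * \<gamma>) * (norm (p - ps))\<^sup>2
          + 2 * ((p - ps) \<bullet> (\<eta> *\<^sub>R v)) + 2 * (norm (\<eta> *\<^sub>R v))\<^sup>2 + 2 * \<eta>\<^sup>2 * use_bound\<^sup>2))
          \<le> (1 - \<alpha>) * (temp * (\<tau> * (norm (p - ps))\<^sup>2)) + \<alpha> * (temp * Y)" .
      qed
      also have "\<dots> \<le> ennreal ((1 - \<alpha>) * exp (temp * (\<tau> * (norm (p - ps))\<^sup>2)) + \<alpha> * exp (temp * Y))"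
        by (intro ennreal_leI exp_convex_comb \<alpha>)
      also have "\<dots> = g x"
        unfolding g_def p_def \<tau>_def using \<alpha> by (simp add: ennreal_mult ennreal_plus)
      finally show "(\<integral>\<^sup>+y. f (x(t := y)) \<partial>P) \<le> g x" .
    qed
    also have "\<dots> = ennreal (1 - \<alpha>) * (\<integral>\<^sup>+w. ennreal (exp (temp * (real (Suc t) * err T w t))) \<partial>Q T) + ennreal \<alpha> * ennreal (exp (temp * Y))"
      unfolding g_def by (subst nn_integral_add) (auto simp: nn_integral_cmult Q.emeasure_space_1)
    also have "\<dots> \<le> ennreal (1 - \<alpha>) * ennreal (exp (temp * rising_exponent T)) + ennreal \<alpha> * ennreal (exp (temp * rising_exponent T))"
    proof (intro add_mono mult_left_mono ennreal_leI)
      show "exp (temp * Y) \<le> exp (temp * rising_exponent T)"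
        using constants_pos by (simp add: Y_def rising_exponent_def)
    qed (use Suc in auto)
    also have "\<dots> = ennreal (exp (temp * rising_exponent T))"
      using \<alpha> by (simp add: ennreal_mult[symmetric] ennreal_plus[symmetric] distrib_right[symmetric] del: ennreal_plus)
    finally show ?thesis unfolding f_def .
  qed
next
  case 0
  interpret Q: prob_space "Q T" by (rule prob_space_Q)
  have "(\<integral>\<^sup>+w. ennreal (exp (temp * (real (Suc 0) * err T w 0))) \<partial>Q T)
     \<le> (\<integral>\<^sup>+w. ennreal (exp (temp * rising_exponent T)) \<partial>Q T)"
  proof (intro nn_integral_mono ennreal_leI, unfold exp_le_cancel_iff, intro mult_left_mono)
    fix w
    have "real (Suc 0) * err T w 0 \<le> (rate + 1) * diam2"
      using err_le[of T w 0] constants_pos by (intro mult_mono) auto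
    also have "\<dots> \<le> rising_exponent T"
      unfolding rising_exponent_def using shift_var_nonneg[OF T] constants_pos by simp
    finally show "real (Suc 0) * err T w 0 \<le> rising_exponent T" .
  qed (use constants_pos in auto)
  thus ?case by (simp add: Q.emeasure_space_1)
qed

section \<open>The averaged price and the second half of the horizon\<close>

lemma avg_eq_mean: "t \<le> T div 2 \<Longrightarrow> real t *\<^sub>R avg T w t = (\<Sum>k<t. price T w k)"
proof (induction t)
  case (Suc t)
  have "real (Suc t) *\<^sub>R avg T w (Suc t) = real (Suc t) *\<^sub>R avg T w t + (price T w t - avg T w t)"
    using Suc.prems by (simp add: next_avg_def scaleR_right_distrib)
  also have "\<dots> = real t *\<^sub>R avg T w t + price T w t" by (simp add: algebra_simps)
  finally show ?case using Suc by simp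
qed simp

lemma avg_err:
  assumes "t \<le> T div 2"
  shows "real t * norm (avg T w t - ps) \<le> (\<Sum>k<t. norm (price T w k - ps))"
proof -
  have "real t *\<^sub>R (avg T w t - ps) = (\<Sum>k<t. price T w k - ps)"
    using avg_eq_mean[OF assms, of w] by (simp add: scaleR_diff_right sum_subtractf sum_constant_scaleR del: sum_constant)
  hence "real t * norm (avg T w t - ps) = norm (\<Sum>k<t. price T w k - ps)"
    by (metis abs_of_nat norm_scaleR)
  thus ?thesis by (simp add: norm_sum)
qed

text \<open>Jensen's inequality for \<open>exp\<close> after Cauchy-Schwarz, both with weights
  proportional to \<open>1 / sqrt (k + 1)\<close>, the typical size of the price errors. The weights
  sum to at most \<open>2 * sqrt h\<close>, whose square explains the division by 4. Averaging thus
  loses only a constant against the accuracy of the latest price.\<close>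

lemma average_price:
  assumes T: "2 \<le> T"
  shows "(\<integral>\<^sup>+w. ennreal (exp (temp * (real (T div 2) * (norm (avg T w (T div 2) - ps))\<^sup>2 / 4))) \<partial>Q T)
     \<le> ennreal (exp (temp * rising_exponent T))"
proof -
  define h where "h = T div 2"
  have h: "0 < h" "h \<le> T" using T by (auto simp: h_def)
  define u where "u = (\<lambda>k. 1 / sqrt (real (Suc k)))"
  define U where "U = (\<Sum>k<h. u k)"
  have u: "0 < u k" for k by (simp add: u_def)
  have U: "0 < U" unfolding U_def using h u by (intro sum_pos) auto
  have Uh: "U \<le> 2 * sqrt h" unfolding U_def u_def by (rule sum_inverse_sqrt_le)
  have sum_conv: "ennreal (\<Sum>k<h. u k / U * c k) = (\<Sum>k<h. ennreal (u k / U) * ennreal (c k))"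
    if "\<And>k. 0 \<le> c k" for c
  proof -
    have "(\<Sum>k<h. ennreal (u k / U) * ennreal (c k)) = (\<Sum>k<h. ennreal (u k / U * c k))"
      using that U u by (intro sum.cong refl ennreal_mult[symmetric]) (auto simp: less_imp_le)
    also have "\<dots> = ennreal (\<Sum>k<h. u k / U * c k)"
      using that U u by (intro sum_ennreal mult_nonneg_nonneg divide_nonneg_pos) (auto simp: less_imp_le)
    finally show ?thesis by simp
  qed
  have pt: "exp (temp * (real h * (norm (avg T w h - ps))\<^sup>2 / 4))
     \<le> (\<Sum>k<h. u k / U * exp (temp * (real (Suc k) * err T w k)))" for w
  proof -
    define y where "y = (\<lambda>k. sqrt (real (Suc k)) * norm (price T w k - ps))"
    have y2: "(y k)\<^sup>2 = real (Suc k) * err T w k" for k by (simp add: y_def power_mult_distrib)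
    have sq: "sqrt (u k) * (sqrt (u k) * y k) = norm (price T w k - ps)" for k
      using u[of k] by (simp add: mult.assoc[symmetric]) (simp add: y_def u_def)
    have "(real h * norm (avg T w h - ps))\<^sup>2 \<le> (\<Sum>k<h. norm (price T w k - ps))\<^sup>2"
      using avg_err[of h T w] by (intro power_mono) (auto simp: h_def)
    also have "\<dots> = (\<Sum>k<h. sqrt (u k) * (sqrt (u k) * y k))\<^sup>2" by (simp add: sq)
    also have "\<dots> \<le> (\<Sum>k<h. (sqrt (u k))\<^sup>2) * (\<Sum>k<h. (sqrt (u k) * y k)\<^sup>2)"
      by (rule Cauchy_Schwarz_ineq_sum)
    also have "\<dots> = U * (\<Sum>k<h. u k * (real (Suc k) * err T w k))"
      using u by (simp add: U_def power_mult_distrib y2 less_imp_le)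
    also have "\<dots> = U\<^sup>2 * (\<Sum>k<h. u k / U * (real (Suc k) * err T w k))"
      using U by (simp add: sum_distrib_left power2_eq_square)
    also have "\<dots> \<le> (2 * sqrt h)\<^sup>2 * (\<Sum>k<h. u k / U * (real (Suc k) * err T w k))"
      using U Uh u by (intro mult_right_mono power_mono sum_nonneg) (auto simp: less_imp_le)
    finally have "real h * (real h * (norm (avg T w h - ps))\<^sup>2 / 4) \<le> real h * (\<Sum>k<h. u k / U * (real (Suc k) * err T w k))"
      by (simp only: power_mult_distrib real_sqrt_pow2 of_nat_0_le_iff) (simp add: power2_eq_square mult_ac)
    hence "real h * (norm (avg T w h - ps))\<^sup>2 / 4 \<le> (\<Sum>k<h. u k / U * (real (Suc k) * err T w k))"
      using h by (simp only: mult_le_cancel_left_pos of_nat_0_less_iff)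
    hence "temp * (real h * (norm (avg T w h - ps))\<^sup>2 / 4) \<le> temp * (\<Sum>k<h. u k / U * (real (Suc k) * err T w k))"
      using constants_pos by (intro mult_left_mono) auto
    also have "\<dots> = (\<Sum>k<h. (u k / U) *\<^sub>R (temp * (real (Suc k) * err T w k)))"
      by (simp add: sum_distrib_left mult_ac)
    finally have "exp (temp * (real h * (norm (avg T w h - ps))\<^sup>2 / 4))
      \<le> exp (\<Sum>k<h. (u k / U) *\<^sub>R (temp * (real (Suc k) * err T w k)))" by simp
    also have "\<dots> \<le> (\<Sum>k<h. u k / U * exp (temp * (real (Suc k) * err T w k)))"
      using U u h by (intro convex_on_sum[OF _ _ exp_convex])
        (auto simp: sum_divide_distrib[symmetric] U_def[symmetric] less_imp_le lessThan_empty_iff)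
    finally show ?thesis .
  qed
  have "(\<integral>\<^sup>+w. ennreal (exp (temp * (real h * (norm (avg T w h - ps))\<^sup>2 / 4))) \<partial>Q T)
     \<le> (\<integral>\<^sup>+w. (\<Sum>k<h. ennreal (u k / U) * ennreal (exp (temp * (real (Suc k) * err T w k)))) \<partial>Q T)"
  proof (rule nn_integral_mono)
    fix w
    have "ennreal (exp (temp * (real h * (norm (avg T w h - ps))\<^sup>2 / 4)))
      \<le> ennreal (\<Sum>k<h. u k / U * exp (temp * (real (Suc k) * err T w k)))" by (rule ennreal_leI[OF pt])
    also have "\<dots> = (\<Sum>k<h. ennreal (u k / U) * ennreal (exp (temp * (real (Suc k) * err T w k))))"
      by (rule sum_conv) simp
    finally show "ennreal (exp (temp * (real h * (norm (avg T w h - ps))\<^sup>2 / 4)))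
      \<le> (\<Sum>k<h. ennreal (u k / U) * ennreal (exp (temp * (real (Suc k) * err T w k))))" .
  qed
  also have "\<dots> = (\<Sum>k<h. ennreal (u k / U) * (\<integral>\<^sup>+w. ennreal (exp (temp * (real (Suc k) * err T w k))) \<partial>Q T))"
  proof -
    have [measurable]: "(\<lambda>w. price T w k) \<in> Q T \<rightarrow>\<^sub>M borel" if "k < h" for k
      using that h by (intro price_measurable) auto
    show ?thesis by (subst nn_integral_sum) (auto simp: nn_integral_cmult)
  qed
  also have "\<dots> \<le> (\<Sum>k<h. ennreal (u k / U) * ennreal (exp (temp * rising_exponent T)))"
    using T by (intro sum_mono mult_left_mono rising_phase) (auto simp: h_def)
  also have "\<dots> = ennreal (\<Sum>k<h. u k / U * exp (temp * rising_exponent T))"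
    by (rule sum_conv[symmetric]) simp
  also have "(\<Sum>k<h. u k / U * exp (temp * rising_exponent T)) = exp (temp * rising_exponent T)"
    using U by (simp add: sum_distrib_right[symmetric] sum_divide_distrib[symmetric] U_def[symmetric])
  finally show ?thesis unfolding h_def .
qed

definition falling_exponent :: "nat \<Rightarrow> real" where
  "falling_exponent T = rising_exponent T + (24 * (1 / \<gamma>)\<^sup>2 * shift_var T + 8 * rate * (1 / \<gamma>)\<^sup>2 * use_bound\<^sup>2)"

lemma avg_frozen: "T div 2 \<le> t \<Longrightarrow> avg T w t = avg T w (T div 2)"
  by (induction t rule: dec_induct) (auto simp: next_avg_def)

lemma falling_phase:
  assumes T: "2 \<le> T" and t: "T div 2 \<le> t" "rate + 1 \<le> real (2 * (T div 2) - t)"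
  shows "(\<integral>\<^sup>+w. ennreal (exp (temp * (real (2 * (T div 2) - t) * err T w t))) \<partial>Q T) \<le> ennreal (exp (temp * falling_exponent T))"
  using t
proof (induction t rule: dec_induct)
  case base
  have "(\<integral>\<^sup>+w. ennreal (exp (temp * (real (2 * (T div 2) - T div 2) * err T w (T div 2)))) \<partial>Q T)
     \<le> (\<integral>\<^sup>+w. ennreal (exp (temp * (real (Suc (T div 2)) * err T w (T div 2)))) \<partial>Q T)"
    using constants_pos by (intro nn_integral_mono ennreal_leI) (auto intro!: mult_left_mono mult_right_mono)
  also have "\<dots> \<le> ennreal (exp (temp * rising_exponent T))" using T by (intro rising_phase) auto
  also have "\<dots> \<le> ennreal (exp (temp * falling_exponent T))"
    using shift_var_nonneg[of T] constants_pos T by (intro ennreal_leI) (auto simp: falling_exponent_def intro!: mult_left_mono)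
  finally show ?case .
next
  case (step t)
  interpret Q: prob_space "Q T" by (rule prob_space_Q)
  define h where "h = T div 2"
  define N where "N = real (2 * h - Suc t)"
  have NK: "rate + 1 \<le> N" using step.prems by (simp add: N_def h_def)
  have N: "N > 0" "N \<ge> 721" using NK rate_ge by auto
  have lt: "Suc t < 2 * h"
  proof (rule ccontr)
    assume "\<not> Suc t < 2 * h"
    hence "N = 0" by (simp add: N_def)
    thus False using N by simp
  qed
  have ht: "h \<le> t" using step by (simp add: h_def)
  have t: "t < T" "t \<le> T" "Suc t \<le> T" "h \<le> T" using lt by (auto simp: h_def)
  have N1: "real (2 * h - t) = N + 1" using lt by (simp add: N_def)
  note [measurable] = price_measurable[OF t(2)] price_measurable[OF t(3)] avg_measurable[OF t(4)]
  define \<alpha> where "\<alpha> = (rate - 3) / (N + 1)"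
  have \<alpha>: "0 \<le> \<alpha>" "\<alpha> \<le> 1" using NK rate_ge N by (auto simp: \<alpha>_def)
  define Y where "Y = 24 * (1 / \<gamma>)\<^sup>2 * shift_var T + 8 * rate * (1 / \<gamma>)\<^sup>2 * use_bound\<^sup>2"
  \<comment> \<open>Depends on orders before \<open>h\<close> only and stays fixed along the
    recursion; the factor 1/4 is the one of \<open>average_price\<close>.\<close>
  define Z where "Z = (\<lambda>w. real h * (norm (avg T w h - ps))\<^sup>2 / 4)"
  define f where "f = (\<lambda>w. ennreal (exp (temp * (N * err T w (Suc t)))))"
  define g where "g = (\<lambda>w. ennreal (1 - \<alpha>) * ennreal (exp (temp * ((N + 1) * err T w t)))
      + ennreal \<alpha> * (ennreal (exp (temp * Y)) * ennreal (exp (temp * Z w))))"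
  have "(\<integral>\<^sup>+w. f w \<partial>Q T) \<le> (\<integral>\<^sup>+w. g w \<partial>Q T)"
  proof (rule nn_integral_PiM_coordinate[OF t(1)])
    show "f \<in> borel_measurable (Q T)" "g \<in> borel_measurable (Q T)" unfolding f_def g_def Z_def by measurable
    show "g (x(t := y)) = g x" for x y using ht by (simp add: g_def Z_def state_upd)
    fix x :: "nat \<Rightarrow> 'm obs"
    define p where "p = price T x t"
    define m where "m = avg T x h"
    have mt: "avg T x t = m" using avg_frozen[of T t x] ht by (simp add: h_def m_def)
    define D where "D = (norm (p - ps))\<^sup>2"
    define E where "E = (norm (m - ps))\<^sup>2"
    define v :: "real^'m" where "v = vec (target_step scale T t)"
    define \<eta> where "\<eta> = gain / N"
    \<comment> \<open>All displacements known before the order arrives: the push away from the base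
      value and the target step.\<close>
    define e where "e = (1 / N) *\<^sub>R (p - m) + \<eta> *\<^sub>R v"
    have \<eta>: "\<eta> > 0" "\<eta> = rate * (1 / \<gamma>) / N" using constants_pos gamma_pos N by (auto simp: \<eta>_def gain_def)
    have pin: "p \<in> \<Omega>" unfolding p_def by (rule state_in)
    have clk: "clock h (Suc t) = 2 * h - Suc t" "clock h t = 2 * h - t"
      using ht by (intro clock_falling; simp)+
    have "f (x(t := y)) = ennreal (exp (temp * (N * (norm (closest_point \<Omega> (p + e + \<eta> *\<^sub>R net_use p y) - ps))\<^sup>2)))" for y
      using clk ht mt by (simp add: f_def state_upd next_price_def p_def v_def \<eta>_def e_def N_def h_def[symmetric] algebra_simps)
    hence "(\<integral>\<^sup>+y. f (x(t := y)) \<partial>P) \<le> ennreal (exp (temp * (N * ((1 - 3/2 * \<eta> * \<gamma>) * D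
        + 2 * ((p - ps) \<bullet> e) + 2 * (norm e)\<^sup>2 + 2 * \<eta>\<^sup>2 * use_bound\<^sup>2))))"
      using one_step[OF pin \<eta>(1) N(1), of e] constants_pos N by (simp add: \<eta>_def D_def)
    also have "\<dots> \<le> ennreal (exp ((1 - \<alpha>) * (temp * ((N + 1) * D)) + \<alpha> * (temp * (Z x + Y))))"
    proof (intro ennreal_leI, unfold exp_le_cancel_iff)
      have D0: "0 \<le> D" "0 \<le> E" by (auto simp: D_def E_def)
      have pm: "(norm (p - m))\<^sup>2 \<le> 2 * D + 2 * E"
      proof -
        have "(norm (p - m))\<^sup>2 = D + 2 * ((p - ps) \<bullet> (ps - m)) + E"
          using norm_add_square[of "p - ps" "ps - m"] by (simp add: D_def E_def norm_minus_commute)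
        also have "(p - ps) \<bullet> (ps - m) \<le> norm (p - ps) * norm (ps - m)" by (rule norm_cauchy_schwarz)
        also have "2 * (norm (p - ps) * norm (ps - m)) \<le> D + E"
          using sum_squares_bound[of "norm (p - ps)" "norm (ps - m)"] by (simp add: D_def E_def norm_minus_commute)
        finally show ?thesis by simp
      qed
      have 1: "2 * ((p - ps) \<bullet> ((1 / N) *\<^sub>R (p - m))) \<le> (3 * D + E) / N"
      proof -
        have "(p - ps) \<bullet> (p - m) = D + (p - ps) \<bullet> (ps - m)"
          by (simp add: D_def power2_norm_eq_inner inner_diff_right)
        also have "(p - ps) \<bullet> (ps - m) \<le> norm (p - ps) * norm (ps - m)" by (rule norm_cauchy_schwarz)
        also have "norm (p - ps) * norm (ps - m) \<le> (D + E) / 2"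
          using sum_squares_bound[of "norm (p - ps)" "norm (ps - m)"] by (simp add: D_def E_def norm_minus_commute)
        finally have "(p - ps) \<bullet> (p - m) \<le> D + (D + E) / 2" by simp
        hence "2 * ((p - ps) \<bullet> (p - m)) \<le> 2 * (D + (D + E) / 2)" by (rule mult_left_mono) simp
        also have "2 * (D + (D + E) / 2) = 3 * D + E" by (simp add: field_simps)
        finally have "2 * ((p - ps) \<bullet> (p - m)) \<le> 3 * D + E" .
        hence "2 * ((p - ps) \<bullet> (p - m)) / N \<le> (3 * D + E) / N" using N by (intro divide_right_mono) auto
        thus ?thesis by simp
      qed
      have 2: "2 * (norm e)\<^sup>2 \<le> (D + E) / N + 4 * \<eta>\<^sup>2 * (norm v)\<^sup>2"
      proof -
        have "(norm e)\<^sup>2 \<le> 2 * (norm ((1 / N) *\<^sub>R (p - m)))\<^sup>2 + 2 * (norm (\<eta> *\<^sub>R v))\<^sup>2"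
        proof -
          have "(norm e)\<^sup>2 \<le> (norm ((1 / N) *\<^sub>R (p - m)) + norm (\<eta> *\<^sub>R v))\<^sup>2"
            unfolding e_def by (intro power_mono norm_triangle_ineq) auto
          also have "\<dots> \<le> 2 * (norm ((1 / N) *\<^sub>R (p - m)))\<^sup>2 + 2 * (norm (\<eta> *\<^sub>R v))\<^sup>2"
            using sum_squares_bound[of "norm ((1 / N) *\<^sub>R (p - m))" "norm (\<eta> *\<^sub>R v)"] by (simp only: power2_sum)
          finally show ?thesis .
        qed
        also have "(norm ((1 / N) *\<^sub>R (p - m)))\<^sup>2 = (norm (p - m))\<^sup>2 / N\<^sup>2"
          using N by (simp add: power_divide)
        also have "(norm (p - m))\<^sup>2 / N\<^sup>2 \<le> (2 * D + 2 * E) / N\<^sup>2" using pm by (intro divide_right_mono) auto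
        also have "(2 * D + 2 * E) / N\<^sup>2 \<le> (2 * D + 2 * E) / (8 * N)"
          using D0 N by (intro divide_left_mono) (auto simp: power2_eq_square)
        finally show ?thesis using N by (simp add: power_mult_distrib field_simps)
      qed
      have 3: "2 * ((p - ps) \<bullet> (\<eta> *\<^sub>R v)) \<le> \<eta> * \<gamma> / 2 * D + 2 * \<eta> * (1 / \<gamma>) * (norm v)\<^sup>2"
        unfolding D_def using \<eta> by (intro shift_term) simp
      have "(1 - 3/2 * \<eta> * \<gamma>) * D + 2 * ((p - ps) \<bullet> e) + 2 * (norm e)\<^sup>2 + 2 * \<eta>\<^sup>2 * use_bound\<^sup>2
        \<le> (1 - 3/2 * \<eta> * \<gamma>) * D + ((3 * D + E) / N + (\<eta> * \<gamma> / 2 * D + 2 * \<eta> * (1 / \<gamma>) * (norm v)\<^sup>2))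
          + ((D + E) / N + 4 * \<eta>\<^sup>2 * (norm v)\<^sup>2) + 2 * \<eta>\<^sup>2 * use_bound\<^sup>2"
        unfolding inner_add_right[of _ "(1 / N) *\<^sub>R (p - m)" "\<eta> *\<^sub>R v", folded e_def] distrib_left[of 2]
        by (intro add_mono order_refl 1 2 3)
      also have "\<dots> = (1 - \<eta> * \<gamma> + 4 / N) * D + 2 / N * E + 2 * \<eta> * (1 / \<gamma>) * (norm v)\<^sup>2 + 4 * \<eta>\<^sup>2 * (norm v)\<^sup>2 + 2 * \<eta>\<^sup>2 * use_bound\<^sup>2"
        by (simp add: algebra_simps add_divide_distrib)
      also have "\<eta> * \<gamma> = rate / N" using \<eta> gamma_pos by simp
      finally have "N * ((1 - 3/2 * \<eta> * \<gamma>) * D + 2 * ((p - ps) \<bullet> e) + 2 * (norm e)\<^sup>2 + 2 * \<eta>\<^sup>2 * use_bound\<^sup>2)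
        \<le> N * ((1 - rate / N + 4 / N) * D + 2 / N * E + 2 * \<eta> * (1 / \<gamma>) * (norm v)\<^sup>2 + 4 * \<eta>\<^sup>2 * (norm v)\<^sup>2 + 2 * \<eta>\<^sup>2 * use_bound\<^sup>2)"
        using N by (intro mult_left_mono) auto
      also have "\<dots> \<le> (1 - \<alpha>) * ((N + 1) * D) + \<alpha> * (real h * E / 4 + Y)"
        unfolding \<eta>(2) \<alpha>_def Y_def
      proof (rule falling_phase_arith)
        have "real (2 * h - t) \<le> real h" using ht by simp
        thus "N + 1 \<le> real h" by (simp add: N1)
        show "(norm v)\<^sup>2 \<le> shift_var T / N"
          unfolding v_def N_def using T lt clk N by (intro norm_shift) (auto simp: h_def)
      qed (use NK rate_ge D0 in auto)
      finally have "temp * (N * ((1 - 3/2 * \<eta> * \<gamma>) * D + 2 * ((p - ps) \<bullet> e) + 2 * (norm e)\<^sup>2 + 2 * \<eta>\<^sup>2 * use_bound\<^sup>2))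
        \<le> temp * ((1 - \<alpha>) * ((N + 1) * D) + \<alpha> * (Z x + Y))"
        using constants_pos unfolding Z_def E_def m_def by (intro mult_left_mono) auto
      also have "\<dots> = (1 - \<alpha>) * (temp * ((N + 1) * D)) + \<alpha> * (temp * (Z x + Y))"
        by (simp add: algebra_simps)
      finally show "temp * (N * ((1 - 3/2 * \<eta> * \<gamma>) * D + 2 * ((p - ps) \<bullet> e) + 2 * (norm e)\<^sup>2 + 2 * \<eta>\<^sup>2 * use_bound\<^sup>2))
        \<le> (1 - \<alpha>) * (temp * ((N + 1) * D)) + \<alpha> * (temp * (Z x + Y))" .
    qed
    also have "\<dots> \<le> ennreal ((1 - \<alpha>) * exp (temp * ((N + 1) * D)) + \<alpha> * exp (temp * (Z x + Y)))"
      by (intro ennreal_leI exp_convex_comb \<alpha>)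
    also have "\<dots> = g x"
    proof -
      have "exp (temp * (Z x + Y)) = exp (temp * Y) * exp (temp * Z x)"
        by (simp add: distrib_left exp_add)
      thus ?thesis unfolding g_def D_def p_def using \<alpha> by (simp add: ennreal_mult ennreal_plus)
    qed
    finally show "(\<integral>\<^sup>+y. f (x(t := y)) \<partial>P) \<le> g x" .
  qed
  also have "\<dots> = ennreal (1 - \<alpha>) * (\<integral>\<^sup>+w. ennreal (exp (temp * ((N + 1) * err T w t))) \<partial>Q T)
     + ennreal \<alpha> * (ennreal (exp (temp * Y)) * (\<integral>\<^sup>+w. ennreal (exp (temp * Z w)) \<partial>Q T))"
    unfolding g_def Z_def by (subst nn_integral_add) (auto simp: nn_integral_cmult)
  also have "\<dots> \<le> ennreal (1 - \<alpha>) * ennreal (exp (temp * falling_exponent T))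
     + ennreal \<alpha> * (ennreal (exp (temp * Y)) * ennreal (exp (temp * rising_exponent T)))"
  proof (intro add_mono mult_left_mono)
    show "(\<integral>\<^sup>+w. ennreal (exp (temp * Z w)) \<partial>Q T) \<le> ennreal (exp (temp * rising_exponent T))"
      using average_price[OF T] by (simp add: Z_def h_def)
    have "rate + 1 \<le> real (2 * (T div 2) - t)" using NK N1 by (simp add: h_def)
    from step.IH[OF this] show "(\<integral>\<^sup>+w. ennreal (exp (temp * ((N + 1) * err T w t))) \<partial>Q T) \<le> ennreal (exp (temp * falling_exponent T))"
      by (simp add: N1[symmetric] h_def)
  qed auto
  also have "\<dots> = ennreal ((1 - \<alpha>) * exp (temp * falling_exponent T) + \<alpha> * exp (temp * falling_exponent T))"
    using \<alpha> by (simp add: ennreal_mult ennreal_plus falling_exponent_def Y_def distrib_left exp_add mult_ac)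
  also have "\<dots> = ennreal (exp (temp * falling_exponent T))" by (simp add: algebra_simps)
  finally show ?case by (simp add: f_def N_def h_def)
qed

end

section \<open>Inventory on the good event\<close>

context regular_orders
begin

text \<open>Within this distance of \<open>ps\<close> the budget face is inactive and prices of
  scarce resources stay positive. The policy does not know \<rho>; it decides only from which
  horizon on \<open>large\<close> holds.\<close>

definition slack_radius :: "real \<Rightarrow> bool" where
  "slack_radius \<rho> \<longleftrightarrow> 0 < \<rho> \<and>
    (\<forall>p. norm (p - ps) < \<rho> \<longrightarrow> (\<Sum>j\<in>UNIV. p $ j) < rb / bl \<and> (\<forall>j. 0 < ps $ j \<longrightarrow> 0 < p $ j))"

lemma slack_radius_exists: "\<exists>\<rho>. slack_radius \<rho>"
proof -
  have "open ({p::real^'m. (\<Sum>j\<in>UNIV. p $ j) < rb / bl} \<inter> (\<Inter>j\<in>{j. 0 < ps $ j}. {p. 0 < p $ j}))" (is "open ?S")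
    by (intro open_Int open_INT ballI open_Collect_less continuous_intros) auto
  moreover have "ps \<in> ?S" using ps_slack by auto
  ultimately obtain \<rho> where "0 < \<rho>" "ball ps \<rho> \<subseteq> ?S" by (meson openE)
  thus ?thesis
    by (intro exI[of _ \<rho>]) (auto simp: slack_radius_def ball_def dist_norm norm_minus_commute subset_iff)
qed

text \<open>Chosen for a tail probability \<open>T^-2\<close> at level
  \<open>radius2 * ln T\<close>. The number 160 is 4 * (16 + 24), from \<open>shift_var\<close> in
  the two exponents. In 32 = (8 + 8) + 16, the bracket comes from the noise in the exponents, and 16
  from \<open>2 / temp\<close>, the price of the tail probability.\<close>

definition radius2 :: real where
  "radius2 = 160 * dimn * scale\<^sup>2 / \<gamma>\<^sup>2 + 32 * rate * use_bound\<^sup>2 / \<gamma>\<^sup>2 + (rate + 1) * diam2"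

lemma radius2_pos: "0 < radius2"
  unfolding radius2_def using constants_pos gamma_pos dimn_ge_1
  by (intro add_pos_pos mult_pos_pos divide_pos_pos zero_less_power) auto

text \<open>Closes the circle between target and price error: \<open>radius2\<close> contains
  \<open>scale^2\<close>, but only times \<open>dimn\<close>, while the square of
  \<open>gain\<close> brings \<open>dimn^2\<close> and a large factor. The parts without
  \<open>scale\<close> are covered by the definition of \<open>scale\<close>.\<close>

lemma radius2_small: "3 * sqrt radius2 / gain \<le> 2 * scale"
proof -
  define X where "X = 32 * rate * use_bound\<^sup>2 + (rate + 1) * diam2 * \<gamma>\<^sup>2"
  have X: "0 \<le> X" "9 * X \<le> scale\<^sup>2"
  proof -
    show "0 \<le> X" using constants_pos by (simp add: X_def)
    have "9 * X \<le> scale * 1" by (simp add: scale_def X_def)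
    also have "\<dots> \<le> scale * scale" using constants_pos by (intro mult_left_mono) auto
    finally show "9 * X \<le> scale\<^sup>2" by (simp add: power2_eq_square)
  qed
  have rad: "radius2 * \<gamma>\<^sup>2 = 160 * dimn * scale\<^sup>2 + X"
    using gamma_pos by (simp add: radius2_def X_def field_simps)
  have "9 * (160 * dimn * scale\<^sup>2 + X) \<le> 4 * rate\<^sup>2 * scale\<^sup>2"
  proof -
    have "1440 * dimn * scale\<^sup>2 \<le> 1440 * dimn\<^sup>2 * scale\<^sup>2"
      using dimn_ge_1 by (intro mult_right_mono) (auto simp: power2_eq_square)
    moreover have "1 * scale\<^sup>2 \<le> dimn\<^sup>2 * scale\<^sup>2"
      using dimn_ge_1 by (intro mult_right_mono) (auto simp: one_le_power)
    ultimately have "9 * (160 * dimn * scale\<^sup>2 + X) \<le> 1441 * (dimn\<^sup>2 * scale\<^sup>2)" using X by simp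
    also have "\<dots> \<le> (4 * 720\<^sup>2) * (dimn\<^sup>2 * scale\<^sup>2)" by (intro mult_right_mono) auto
    finally show ?thesis by (simp add: rate_def power_mult_distrib)
  qed
  hence "9 * (radius2 * \<gamma>\<^sup>2) \<le> (2 * rate * scale)\<^sup>2" by (simp add: rad power_mult_distrib)
  hence "(3 * sqrt radius2 * \<gamma>)\<^sup>2 \<le> (2 * rate * scale)\<^sup>2"
    using radius2_pos by (simp add: power_mult_distrib)
  hence "3 * sqrt radius2 * \<gamma> \<le> 2 * rate * scale"
    by (rule power2_le_imp_le) (use constants_pos in auto)
  thus ?thesis using constants_pos gamma_pos by (simp add: gain_def field_simps)
qed

text \<open>One order plus the largest total net use that \<open>net_use_sum\<close> permits. Its
  order is \<open>ln T\<close> to the power 3/2, less than what the squared logarithm of warm-up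
  periods collects.\<close>

definition buffer :: "nat \<Rightarrow> real" where
  "buffer T = ab + 4 * scale * sqrt (ln T) * sqrt (warmup T)"

definition good :: "nat \<Rightarrow> (nat \<Rightarrow> 'm obs) \<Rightarrow> bool" where
  "good T w \<longleftrightarrow>
     (\<forall>t\<le>T div 2. real (Suc t) * err T w t \<le> radius2 * ln T) \<and>
     (\<forall>t. T div 2 \<le> t \<longrightarrow> rate + 1 \<le> real (2 * (T div 2) - t) \<longrightarrow>
        real (2 * (T div 2) - t) * err T w t \<le> radius2 * ln T) \<and>
     (\<forall>j. buffer T \<le> (\<Sum>k<warmup T. snd (snd (w k)) $ j))"

text \<open>The accepting window is nonempty, prices contract throughout it, and on the good event
  they stay closer than \<rho> to \<open>ps\<close> there.\<close>

definition large :: "real \<Rightarrow> nat \<Rightarrow> bool" where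
  "large \<rho> T \<longleftrightarrow> 1 \<le> ln T \<and> warmup T < T div 2 \<and> rate + 1 \<le> real (warmup T) \<and> radius2 * ln T < \<rho>\<^sup>2 * real (warmup T)"

text \<open>As long as no projection is active, \<open>control\<close> is the deviation of the inventory from its target,
  up to an additive constant.\<close>
definition control :: "nat \<Rightarrow> (nat \<Rightarrow> 'm obs) \<Rightarrow> nat \<Rightarrow> real^'m" where
  "control T w t = (clock (T div 2) t / gain) *\<^sub>R (price T w t - avg T w t)"

text \<open>The price update was designed for this identity. A projection adds a nonnegative
  correction, so that in general net use is only bounded from above; for a price that stays positive
  the correction vanishes.\<close>

lemma control_step:
  assumes t: "Suc t < 2 * (T div 2)" and slack: "(\<Sum>j\<in>UNIV. price T w (Suc t) $ j) < rb / bl"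
  shows "net_use (price T w t) (w t) $ j + target_step scale T t \<le> control T w (Suc t) $ j - control T w t $ j"
    and "0 < price T w (Suc t) $ j \<Longrightarrow>
      net_use (price T w t) (w t) $ j + target_step scale T t = control T w (Suc t) $ j - control T w t $ j"
proof -
  define h where "h = T div 2"
  define N where "N = real (clock h (Suc t))"
  define X where "X = net_use (price T w t) (w t) + vec (target_step scale T t)"
  define q where "q = price T w t + (if t < h then 0 else 1 / N) *\<^sub>R (price T w t - avg T w t) + (gain / N) *\<^sub>R X"
  have N: "0 < N" using t by (auto simp: N_def clock_def h_def)
  have p': "price T w (Suc t) = closest_point \<Omega> q"
    by (simp add: next_price_def q_def N_def h_def X_def)
  \<comment> \<open>In the rising half the average moves towards the price by \<open>1 / N\<close>
    of the gap, lowering the factor to \<open>N - 1\<close>; in the falling half the extra push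
    raises it to \<open>N + 1\<close>. Both equal the old clock.\<close>
  have key: "N * (q $ j - avg T w (Suc t) $ j) = real (clock h t) * (price T w t $ j - avg T w t $ j) + gain * X $ j"
  proof (cases "t < h")
    case True
    hence c: "N = real (Suc t)" "real (clock h t) = N - 1" by (auto simp: N_def clock_rising)
    have "q $ j = price T w t $ j + gain / N * X $ j" using True by (simp add: q_def)
    moreover have "avg T w (Suc t) $ j = avg T w t $ j + 1 / N * (price T w t $ j - avg T w t $ j)"
      using True c(1) by (simp add: next_avg_def h_def[symmetric])
    ultimately show ?thesis using N unfolding c(2) by (simp add: field_simps)
  next
    case False
    hence "real (clock h t) = N + 1" using t by (simp add: N_def clock_falling h_def)
    thus ?thesis using False N by (simp add: q_def next_avg_def h_def[symmetric] field_simps)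
  qed
  have eq: "X $ j + N / gain * (price T w (Suc t) $ j - q $ j) = control T w (Suc t) $ j - control T w t $ j"
  proof -
    have "gain * (X $ j + N / gain * (price T w (Suc t) $ j - q $ j))
       = N * (price T w (Suc t) $ j - avg T w (Suc t) $ j) - real (clock h t) * (price T w t $ j - avg T w t $ j)"
    proof -
      have "gain * (X $ j + N / gain * (price T w (Suc t) $ j - q $ j)) = gain * X $ j + N * (price T w (Suc t) $ j - q $ j)"
        using constants_pos by (simp add: distrib_left)
      thus ?thesis using key by (simp add: right_diff_distrib)
    qed
    also have "\<dots> = gain * (control T w (Suc t) $ j - control T w t $ j)"
      using constants_pos by (simp add: control_def h_def[symmetric] N_def[symmetric] right_diff_distrib)
    finally show ?thesis using constants_pos by simp
  qed
  have Xj: "X $ j = net_use (price T w t) (w t) $ j + target_step scale T t" by (simp add: X_def)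
  have slack': "(\<Sum>j\<in>UNIV. closest_point \<Omega> q $ j) < rb / bl" using slack unfolding p' .
  note cp = closest_point_Omega_p_slack[OF less_imp_le[OF R_pos] slack', of j, folded p']
  have "0 \<le> N / gain * (price T w (Suc t) $ j - q $ j)" using cp(1) N constants_pos by simp
  thus "net_use (price T w t) (w t) $ j + target_step scale T t \<le> control T w (Suc t) $ j - control T w t $ j"
    using eq Xj by linarith
  show "net_use (price T w t) (w t) $ j + target_step scale T t = control T w (Suc t) $ j - control T w t $ j"
    if "0 < price T w (Suc t) $ j"
    using eq Xj cp(2)[OF that] by simp
qed

lemma good_err:
  assumes g: "good T w" and c: "rate + 1 \<le> clock (T div 2) t"
  shows "real (clock (T div 2) t) * err T w t \<le> radius2 * ln T"
proof (cases "t \<le> T div 2")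
  case True
  have "real t * err T w t \<le> real (Suc t) * err T w t" by (intro mult_right_mono) auto
  also have "\<dots> \<le> radius2 * ln T" using g True by (simp add: good_def)
  finally show ?thesis using True by (simp add: clock_rising)
next
  case False
  thus ?thesis using g c by (auto simp: good_def clock_falling)
qed

lemma good_avg:
  assumes T: "1 \<le> T" and g: "good T w" and t: "t \<le> T div 2"
  shows "real t * norm (avg T w t - ps) \<le> 2 * sqrt (radius2 * ln T) * sqrt t"
proof -
  have "real t * norm (avg T w t - ps) \<le> (\<Sum>k<t. norm (price T w k - ps))" by (rule avg_err[OF t])
  also have "\<dots> \<le> (\<Sum>k<t. sqrt (radius2 * ln T) * (1 / sqrt (real (Suc k))))"
  proof (rule sum_mono)
    fix k assume "k \<in> {..<t}"
    hence "real (Suc k) * err T w k \<le> radius2 * ln T" using g t by (auto simp: good_def)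
    moreover have "sqrt (real (Suc k) * err T w k) = sqrt (real (Suc k)) * norm (price T w k - ps)"
      by (subst real_sqrt_mult) simp
    ultimately have "sqrt (real (Suc k)) * norm (price T w k - ps) \<le> sqrt (radius2 * ln T)"
      by (metis real_sqrt_le_mono)
    thus "norm (price T w k - ps) \<le> sqrt (radius2 * ln T) * (1 / sqrt (real (Suc k)))"
      by (simp add: pos_le_divide_eq mult.commute)
  qed
  also have "\<dots> = sqrt (radius2 * ln T) * (\<Sum>k<t. 1 / sqrt (real (Suc k)))" by (simp only: sum_distrib_left)
  also have "\<dots> \<le> sqrt (radius2 * ln T) * (2 * sqrt t)"
    using T radius2_pos by (intro mult_left_mono sum_inverse_sqrt_le) auto
  finally show ?thesis by simp
qed

text \<open>The deviation never exceeds the target. The price contributes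
  \<open>sqrt (radius2 * ln T)\<close> and the base value at most twice that, which gives the 3 in
  \<open>radius2_small\<close>.\<close>

lemma good_control:
  assumes T: "1 \<le> T" and g: "good T w" and c: "rate + 1 \<le> clock (T div 2) t"
  shows "\<bar>control T w t $ j\<bar> \<le> 2 * scale * sqrt (ln T) * sqrt (clock (T div 2) t)"
proof -
  define n where "n = real (clock (T div 2) t)"
  define A where "A = sqrt (radius2 * ln T)"
  have n: "0 < n" using c constants_pos by (simp add: n_def)
  have A: "0 \<le> A" using T radius2_pos by (simp add: A_def)
  have 1: "n * norm (price T w t - ps) \<le> A * sqrt n"
  proof -
    have "sqrt (n * err T w t) \<le> A" unfolding A_def n_def by (intro real_sqrt_le_mono good_err[OF g c])
    hence "sqrt n * (sqrt n * norm (price T w t - ps)) \<le> sqrt n * A"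
      by (intro mult_left_mono) (auto simp: real_sqrt_mult n_def)
    thus ?thesis using n by (simp add: sqrt_sqrt_mult mult.commute)
  qed
  have 2: "n * norm (avg T w t - ps) \<le> 2 * A * sqrt n"
  proof (cases "t \<le> T div 2")
    case True
    thus ?thesis using good_avg[OF T g True] by (simp add: n_def clock_rising A_def)
  next
    case False
    define h where "h = T div 2"
    define y where "y = norm (avg T w h - ps)"
    have nh: "n \<le> real h" using False by (auto simp: n_def clock_def h_def)
    have "real h * y \<le> 2 * A * sqrt h" unfolding y_def using good_avg[OF T g, of h] by (simp add: h_def A_def)
    hence "sqrt h * (sqrt h * y) \<le> sqrt h * (2 * A)" by (subst sqrt_sqrt_mult) (simp_all add: mult_ac)
    hence "sqrt h * y \<le> 2 * A" using n nh by simp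
    moreover have "sqrt n * y \<le> sqrt h * y" using nh by (intro mult_right_mono) (auto simp: y_def)
    ultimately have "sqrt n * (sqrt n * y) \<le> sqrt n * (2 * A)" using n by (intro mult_left_mono) auto
    hence "n * y \<le> 2 * A * sqrt n" using n by (simp add: sqrt_sqrt_mult mult_ac)
    thus ?thesis using avg_frozen[of T t w] False by (simp add: y_def h_def)
  qed
  have "\<bar>control T w t $ j\<bar> \<le> norm (control T w t)" by (rule component_le_norm_cart)
  also have "\<dots> = n * norm (price T w t - avg T w t) / gain"
    using constants_pos n by (simp add: control_def n_def)
  also have "\<dots> \<le> (3 * A * sqrt n) / gain"
  proof (rule divide_right_mono)
    have "norm (price T w t - avg T w t) \<le> norm (price T w t - ps) + norm (avg T w t - ps)"
      using norm_triangle_ineq4[of "price T w t - ps" "avg T w t - ps"] by simp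
    hence "n * norm (price T w t - avg T w t) \<le> n * (norm (price T w t - ps) + norm (avg T w t - ps))"
      using n by (intro mult_left_mono) auto
    thus "n * norm (price T w t - avg T w t) \<le> 3 * A * sqrt n" using 1 2 by (simp only: distrib_left)
  qed (use constants_pos in auto)
  also have "\<dots> = (3 * sqrt radius2 / gain) * (sqrt (ln T) * sqrt n)"
    by (simp add: A_def real_sqrt_mult)
  also have "\<dots> \<le> (2 * scale) * (sqrt (ln T) * sqrt n)"
    using radius2_small T n by (intro mult_right_mono) auto
  finally show ?thesis by (simp add: n_def mult_ac)
qed

lemma warmup_clock:
  assumes "large \<rho> T" "warmup T \<le> t" "t \<le> 2 * (T div 2) - warmup T"
  shows "warmup T \<le> clock (T div 2) t" "rate + 1 \<le> clock (T div 2) t"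
  using assms by (auto simp: large_def clock_def)

lemma large_T: "large \<rho> T \<Longrightarrow> 2 \<le> T"
  by (auto simp: large_def)

lemma good_close:
  assumes l: "large \<rho> T" and g: "good T w" and \<rho>: "0 < \<rho>" and t: "warmup T \<le> t" "t \<le> 2 * (T div 2) - warmup T"
  shows "norm (price T w t - ps) < \<rho>"
proof -
  have "warmup T * err T w t \<le> real (clock (T div 2) t) * err T w t"
    using warmup_clock(1)[OF l t] by (intro mult_right_mono) auto
  also have "\<dots> \<le> radius2 * ln T" by (rule good_err[OF g warmup_clock(2)[OF l t]])
  also have "\<dots> < warmup T * \<rho>\<^sup>2" using l by (simp add: large_def mult.commute)
  finally have "err T w t < \<rho>\<^sup>2" by (rule mult_left_less_imp_less) simp
  thus ?thesis using \<rho> by (simp add: power_less_imp_less_base)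
qed

lemma sum_target_step:
  assumes "s \<le> t"
  shows "(\<Sum>k=s..<t. target_step scale T k)
    = 2 * scale * sqrt (ln T) * (sqrt (clock (T div 2) t) - sqrt (clock (T div 2) s))"
  using assms by (induction t rule: dec_induct) (auto simp: target_step_def algebra_simps)

text \<open>Net use telescopes to the change of \<open>control\<close> minus the change of the
  target \<open>B\<close>. Since \<open>control\<close> is at most \<open>B\<close>, the terms at
  time \<open>t\<close> cancel in the upper bound, and twice the target at the start remains. The
  lower bound needs equality in \<open>control_step\<close>, hence a scarce resource, and the end of
  the window, where the target is back at its initial value.\<close>

lemma net_use_sum:
  assumes sr: "slack_radius \<rho>" and l: "large \<rho> T" and g: "good T w"
    and t: "warmup T \<le> t" "t \<le> 2 * (T div 2) - warmup T"
  shows "(\<Sum>k=warmup T..<t. net_use (price T w k) (w k) $ j) \<le> 4 * scale * sqrt (ln T) * sqrt (warmup T)"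
    and "0 < ps $ j \<Longrightarrow> t = 2 * (T div 2) - warmup T \<Longrightarrow>
      - (4 * scale * sqrt (ln T) * sqrt (warmup T)) \<le> (\<Sum>k=warmup T..<t. net_use (price T w k) (w k) $ j)"
proof -
  define s where "s = warmup T"
  define B where "B = (\<lambda>t. 2 * scale * sqrt (ln T) * sqrt (clock (T div 2) t))"
  have T: "1 \<le> T" using large_T[OF l] by simp
  have s0: "0 < s" "s < T div 2" using l rate_ge by (auto simp: large_def s_def)
  have cs: "clock (T div 2) s = s" using s0 by (simp add: clock_rising)
  have \<rho>: "0 < \<rho>" using sr by (simp add: slack_radius_def)
  have near: "(\<Sum>j\<in>UNIV. p $ j) < rb / bl" "0 < ps $ j \<Longrightarrow> 0 < p $ j" if "norm (p - ps) < \<rho>" for p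
    using sr that unfolding slack_radius_def by blast+
  have next_close: "norm (price T w (Suc k) - ps) < \<rho>" if "k \<in> {s..<t}" for k
    by (rule good_close[OF l g \<rho>]) (use that t in \<open>auto simp: s_def\<close>)
  have sk: "Suc k < 2 * (T div 2)" if "k \<in> {s..<t}" for k
    using that t s0 by (auto simp: s_def)
  have sk': "(\<Sum>j\<in>UNIV. price T w (Suc k) $ j) < rb / bl"
    "0 < ps $ j \<Longrightarrow> 0 < price T w (Suc k) $ j" if "k \<in> {s..<t}" for k
    by (rule near[OF next_close[OF that]]; assumption)+
  have tele: "(\<Sum>k=s..<t. control T w (Suc k) $ j - control T w k $ j) = control T w t $ j - control T w s $ j"
    by (rule sum_Suc_diff') (use t in \<open>simp add: s_def\<close>)
  have ctl: "\<bar>control T w k $ j\<bar> \<le> B k" if "s \<le> k" "k \<le> 2 * (T div 2) - s" for k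
    unfolding B_def using that by (intro good_control[OF T g] warmup_clock(2)[OF l]) (auto simp: s_def)
  have targ: "(\<Sum>k=s..<t. target_step scale T k) = B t - B s"
    using t by (subst sum_target_step) (auto simp: s_def B_def algebra_simps)
  have "(\<Sum>k=s..<t. net_use (price T w k) (w k) $ j + target_step scale T k)
     \<le> (\<Sum>k=s..<t. control T w (Suc k) $ j - control T w k $ j)"
    by (intro sum_mono control_step(1) sk sk')
  hence "(\<Sum>k=s..<t. net_use (price T w k) (w k) $ j) + (B t - B s) \<le> control T w t $ j - control T w s $ j"
    by (simp add: sum.distrib targ tele)
  hence "(\<Sum>k=s..<t. net_use (price T w k) (w k) $ j) \<le> 2 * B s"
    using ctl[of t] ctl[of s] t s0 by (simp add: s_def abs_le_iff)
  thus "(\<Sum>k=warmup T..<t. net_use (price T w k) (w k) $ j) \<le> 4 * scale * sqrt (ln T) * sqrt (warmup T)"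
    using cs by (simp add: B_def s_def)
  assume p: "0 < ps $ j" and tt: "t = 2 * (T div 2) - warmup T"
  have "(\<Sum>k=s..<t. net_use (price T w k) (w k) $ j + target_step scale T k)
     = (\<Sum>k=s..<t. control T w (Suc k) $ j - control T w k $ j)"
    using p by (intro sum.cong refl control_step(2) sk sk')
  hence "(\<Sum>k=s..<t. net_use (price T w k) (w k) $ j) + (B t - B s) = control T w t $ j - control T w s $ j"
    by (simp add: sum.distrib targ tele)
  moreover have "clock (T div 2) t = s" using tt s0 by (auto simp: clock_def s_def)
  hence "B t = B s" using cs by (simp add: B_def)
  ultimately have "- (2 * B s) \<le> (\<Sum>k=s..<t. net_use (price T w k) (w k) $ j)"
    using ctl[of t] ctl[of s] t s0 by (simp add: s_def abs_le_iff)
  thus "- (4 * scale * sqrt (ln T) * sqrt (warmup T)) \<le> (\<Sum>k=warmup T..<t. net_use (price T w k) (w k) $ j)"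
    using cs by (simp add: B_def s_def)
qed

section \<open>Decisions, final inventory and regret along a good path\<close>

definition typical :: "nat \<Rightarrow> (nat \<Rightarrow> 'm obs) \<Rightarrow> bool" where
  "typical T w \<longleftrightarrow> (\<forall>t<T. \<bar>fst (w t)\<bar> < rb \<and> norm (fst (snd (w t))) < ab \<and>
     (\<forall>j. 0 \<le> snd (snd (w t)) $ j \<and> snd (snd (w t)) $ j < bb))"

abbreviation decide :: "nat \<Rightarrow> (nat \<Rightarrow> 'm obs) \<Rightarrow> nat \<Rightarrow> bool" where
  "decide T w \<equiv> dec (policy rb bl gain scale) T w (\<lambda>_. 0)"

text \<open>Stock never binds in the accepting window: by induction it equals the warm-up
  replenishment minus the threshold rule's net use, and the buffer keeps this at least
  \<open>ab\<close>, enough for any order.\<close>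

lemma good_decide:
  assumes sr: "slack_radius \<rho>" and l: "large \<rho> T" and g: "good T w" and ty: "typical T w" and t: "t < T"
  shows "decide T w t \<longleftrightarrow> warmup T \<le> t \<and> t < 2 * (T div 2) - warmup T \<and> fst (snd (w t)) \<bullet> price T w t < fst (w t)"
  using t
proof (induction t rule: less_induct)
  case (less t)
  define s where "s = warmup T"
  show ?case
  proof (cases "s \<le> t \<and> t < 2 * (T div 2) - s")
    case False
    thus ?thesis by (subst dec_policy) (auto simp: s_def)
  next
    case True
    have "fst (snd (w t)) $ j \<le> snd (snd (w t)) $ j +
        (\<Sum>k<t. snd (snd (w k)) $ j - fst (snd (w k)) $ j * of_bool (decide T w k))" for j
    proof -
      have "(\<Sum>k<t. snd (snd (w k)) $ j - fst (snd (w k)) $ j * of_bool (decide T w k))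
         = (\<Sum>k<s. snd (snd (w k)) $ j) + (\<Sum>k=s..<t. - net_use (price T w k) (w k) $ j)"
      proof (subst split_sum[of s], goal_cases)
        case 2
        have "(\<Sum>k<s. snd (snd (w k)) $ j - fst (snd (w k)) $ j * of_bool (decide T w k)) = (\<Sum>k<s. snd (snd (w k)) $ j)"
          using True less.prems by (intro sum.cong refl) (auto simp: less.IH s_def)
        moreover have "(\<Sum>k=s..<t. snd (snd (w k)) $ j - fst (snd (w k)) $ j * of_bool (decide T w k))
            = (\<Sum>k=s..<t. - net_use (price T w k) (w k) $ j)"
        proof (intro sum.cong refl)
          fix k assume "k \<in> {s..<t}"
          hence "decide T w k \<longleftrightarrow> fst (snd (w k)) \<bullet> price T w k < fst (w k)"
            using True less.prems less.IH[of k] by (auto simp: s_def)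
          thus "snd (snd (w k)) $ j - fst (snd (w k)) $ j * of_bool (decide T w k) = - net_use (price T w k) (w k) $ j"
            by (simp add: net_use_def)
        qed
        ultimately show ?case by simp
      qed (use True in simp)
      also have "\<dots> \<ge> buffer T - 4 * scale * sqrt (ln T) * sqrt (warmup T)"
      proof -
        have "buffer T \<le> (\<Sum>k<s. snd (snd (w k)) $ j)" using g by (simp add: good_def s_def)
        moreover have "(\<Sum>k=s..<t. net_use (price T w k) (w k) $ j) \<le> 4 * scale * sqrt (ln T) * sqrt (warmup T)"
          using net_use_sum(1)[OF sr l g, of t j] True by (simp add: s_def)
        ultimately show ?thesis by (simp add: sum_negf)
      qed
      also have "buffer T - 4 * scale * sqrt (ln T) * sqrt (warmup T) = ab" by (simp add: buffer_def)
      finally have "ab \<le> (\<Sum>k<t. snd (snd (w k)) $ j - fst (snd (w k)) $ j * of_bool (decide T w k))" .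
      moreover have "fst (snd (w t)) $ j \<le> ab" "0 \<le> snd (snd (w t)) $ j"
        using ty less.prems component_le_norm_cart[of "fst (snd (w t))" j]
        by (auto simp: typical_def abs_le_iff dest!: spec[of _ t])
      ultimately show ?thesis by linarith
    qed
    thus ?thesis using True by (subst dec_policy) (auto simp: s_def)
  qed
qed

text \<open>Rejecting periods add at most \<open>bb\<close> each; there are up to
  \<open>2 * warmup T + 1\<close> of them, the last one for odd \<open>T\<close>. Inside the window
  \<open>net_use_sum\<close> controls the drift for scarce resources; stock of the others has price
  0.\<close>

lemma final_inventory:
  assumes sr: "slack_radius \<rho>" and l: "large \<rho> T" and g: "good T w" and ty: "typical T w" and j: "0 < ps $ j"
  shows "(\<Sum>k<T. snd (snd (w k)) $ j - fst (snd (w k)) $ j * of_bool (decide T w k))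
    \<le> bb * (2 * warmup T + 1) + 4 * scale * sqrt (ln T) * sqrt (warmup T)"
proof -
  define s where "s = warmup T"
  define e where "e = 2 * (T div 2) - s"
  let ?f = "\<lambda>k. snd (snd (w k)) $ j - fst (snd (w k)) $ j * of_bool (decide T w k)"
  have se: "s \<le> e" "e \<le> T" "T \<le> e + s + 1" using l by (auto simp: large_def e_def s_def)
  have bk: "snd (snd (w k)) $ j \<le> bb" if "k < T" for k using ty that by (auto simp: typical_def less_imp_le)
  have "(\<Sum>k<T. ?f k) = (\<Sum>k<s. ?f k) + (\<Sum>k=s..<e. ?f k) + (\<Sum>k=e..<T. ?f k)"
    using se by (simp add: split_sum[of e T] split_sum[of s e])
  also have "(\<Sum>k<s. ?f k) \<le> (\<Sum>k<s. bb)"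
    using se bk by (intro sum_mono) (auto simp: good_decide[OF sr l g ty] s_def)
  also have "(\<Sum>k=e..<T. ?f k) \<le> (\<Sum>k=e..<T. bb)"
    using se bk by (intro sum_mono) (auto simp: good_decide[OF sr l g ty] s_def e_def)
  also have "(\<Sum>k=s..<e. ?f k) = - (\<Sum>k=s..<e. net_use (price T w k) (w k) $ j)"
    unfolding sum_negf[symmetric]
  proof (intro sum.cong refl)
    fix k assume "k \<in> {s..<e}"
    hence "decide T w k \<longleftrightarrow> fst (snd (w k)) \<bullet> price T w k < fst (w k)"
      using se good_decide[OF sr l g ty, of k] by (auto simp: s_def e_def)
    thus "?f k = - net_use (price T w k) (w k) $ j" by (simp add: net_use_def)
  qed
  also have "- (\<Sum>k=s..<e. net_use (price T w k) (w k) $ j) \<le> 4 * scale * sqrt (ln T) * sqrt (warmup T)"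
    using net_use_sum(2)[OF sr l g, of e j] se j by (simp add: s_def e_def)
  finally have "(\<Sum>k<T. ?f k) \<le> real s * bb + 4 * scale * sqrt (ln T) * sqrt (warmup T) + real (T - e) * bb" by simp
  also have "real (T - e) * bb \<le> (real s + 1) * bb" using se bb_pos by (intro mult_right_mono) auto
  finally show ?thesis by (simp add: s_def algebra_simps)
qed

text \<open>Weak duality: the prefix constraints are relaxed to the last one, at period
  \<open>T - 1\<close>, which is priced with \<open>ps\<close>.\<close>

lemma opt_reward_dual_bound:
  assumes T: "1 \<le> T" and ty: "typical T w"
  shows "opt_reward T w \<le> (\<Sum>t<T. ps \<bullet> snd (snd (w t)) + max 0 (fst (w t) - fst (snd (w t)) \<bullet> ps))"
    and "opt_reward T w \<le> rb * T" and "0 \<le> opt_reward T w"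
proof -
  define X where "X = {x. prefix_feasible T w x \<and> (\<forall>t\<ge>T. \<not> x t)}"
  define val where "val = (\<lambda>x. \<Sum>t<T. fst (w t) * of_bool (x t :: bool))"
  have opt: "opt_reward T w = Max (val ` X)" by (simp add: opt_reward_def X_def val_def)
  have "X \<subseteq> (\<lambda>S t. t \<in> S) ` Pow {..<T}"
  proof
    fix x assume "x \<in> X"
    hence "t < T" if "x t" for t using that by (cases "t < T") (auto simp: X_def)
    hence "x = (\<lambda>t. t \<in> {t. x t})" "{t. x t} \<subseteq> {..<T}" by auto
    thus "x \<in> (\<lambda>S t. t \<in> S) ` Pow {..<T}" by blast
  qed
  hence fin: "finite X" by (rule finite_subset) auto
  have zero: "(\<lambda>_. False) \<in> X" using ty by (auto simp: X_def prefix_feasible_def typical_def intro!: sum_nonneg)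
  have "val (\<lambda>_. False) \<le> opt_reward T w" unfolding opt using fin zero by (intro Max_ge) auto
  thus "0 \<le> opt_reward T w" by (simp add: val_def)
  have "\<exists>x\<in>X. opt_reward T w = val x"
  proof -
    have "Max (val ` X) \<in> val ` X" using fin zero by (intro Max_in) auto
    thus ?thesis unfolding opt by blast
  qed
  then obtain x where x: "x \<in> X" "opt_reward T w = val x" by blast
  have "val x \<le> (\<Sum>t<T. rb)"
    unfolding val_def using ty rb_pos by (intro sum_mono) (auto simp: typical_def of_bool_def abs_less_iff less_imp_le)
  thus "opt_reward T w \<le> rb * T" using x by (simp add: mult.commute)
  have feas: "(\<Sum>k<T. fst (snd (w k)) $ j * of_bool (x k)) \<le> (\<Sum>k<T. snd (snd (w k)) $ j)" for j
  proof -
    have "{..T - 1} = {..<T}" using T by auto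
    moreover have "(\<Sum>k\<le>t. fst (snd (w k)) $ j * of_bool (x k)) \<le> (\<Sum>k\<le>t. snd (snd (w k)) $ j)" if "t < T" for t
      using x(1) that by (simp add: X_def prefix_feasible_def)
    from this[of "T - 1"] have "(\<Sum>k\<le>T - 1. fst (snd (w k)) $ j * of_bool (x k)) \<le> (\<Sum>k\<le>T - 1. snd (snd (w k)) $ j)"
      using T by simp
    ultimately show ?thesis by (simp only:)
  qed
  have "val x = (\<Sum>t<T. (fst (w t) - fst (snd (w t)) \<bullet> ps) * of_bool (x t)) + (\<Sum>t<T. (fst (snd (w t)) \<bullet> ps) * of_bool (x t))"
    unfolding val_def sum.distrib[symmetric] by (intro sum.cong refl) (simp add: algebra_simps)
  also have "(\<Sum>t<T. (fst (w t) - fst (snd (w t)) \<bullet> ps) * of_bool (x t)) \<le> (\<Sum>t<T. max 0 (fst (w t) - fst (snd (w t)) \<bullet> ps))"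
    by (intro sum_mono) (auto simp: of_bool_def)
  also have "(\<Sum>t<T. (fst (snd (w t)) \<bullet> ps) * of_bool (x t)) = (\<Sum>j\<in>UNIV. ps $ j * (\<Sum>t<T. fst (snd (w t)) $ j * of_bool (x t)))"
    unfolding inner_vec_def sum_distrib_left sum_distrib_right
    by (subst sum.swap) (simp add: mult_ac)
  also have "\<dots> \<le> (\<Sum>j\<in>UNIV. ps $ j * (\<Sum>t<T. snd (snd (w t)) $ j))"
    using ps_in by (intro sum_mono mult_left_mono feas) (auto simp: Omega_p_def nonneg_vec_def)
  also have "\<dots> = (\<Sum>t<T. ps \<bullet> snd (snd (w t)))"
    unfolding inner_vec_def sum_distrib_left by (subst sum.swap) simp
  finally show "opt_reward T w \<le> (\<Sum>t<T. ps \<bullet> snd (snd (w t)) + max 0 (fst (w t) - fst (snd (w t)) \<bullet> ps))"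
    using x by (simp add: sum.distrib)
qed

abbreviation regret :: "nat \<Rightarrow> (nat \<Rightarrow> 'm obs) \<Rightarrow> real" where
  "regret T w \<equiv> opt_reward T w - (\<Sum>t<T. fst (w t) * of_bool (decide T w t))"

lemma regret_crude:
  assumes "1 \<le> T" "typical T w"
  shows "\<bar>regret T w\<bar> \<le> 2 * rb * T"
proof -
  have "\<bar>\<Sum>t<T. fst (w t) * of_bool (decide T w t)\<bar> \<le> (\<Sum>t<T. \<bar>fst (w t) * of_bool (decide T w t)\<bar>)" by (rule sum_abs)
  also have "\<dots> \<le> (\<Sum>t<T. rb)"
    using assms rb_pos by (intro sum_mono) (auto simp: typical_def of_bool_def less_imp_le)
  also have "\<dots> = rb * T" by simp
  finally have "\<bar>\<Sum>t<T. fst (w t) * of_bool (decide T w t)\<bar> \<le> rb * T" .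
  thus ?thesis using opt_reward_dual_bound(2,3)[OF assms] by linarith
qed

definition waste :: "nat \<Rightarrow> real" where
  "waste T = (rb + ab * norm ps) * (2 * warmup T + 1)
     + (\<Sum>j\<in>UNIV. ps $ j) * (bb * (2 * warmup T + 1) + 4 * scale * sqrt (ln T) * sqrt (warmup T))"

text \<open>At the price \<open>ps\<close> the gap to the dual bound consists of the surplus lost in
  each period and the value of the final inventory. In the window the former is at most the
  disagreement; outside, every period costs at most a constant.\<close>

lemma regret_good:
  assumes sr: "slack_radius \<rho>" and l: "large \<rho> T" and g: "good T w" and ty: "typical T w"
  shows "regret T w \<le> (\<Sum>t=warmup T..<2 * (T div 2) - warmup T. disagreement (price T w t) ps (w t)) + waste T"
proof -
  define s where "s = warmup T"
  define e where "e = 2 * (T div 2) - s"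
  have T: "1 \<le> T" using large_T[OF l] by simp
  have se: "s \<le> e" "e \<le> T" "T \<le> e + s + 1" using l by (auto simp: large_def e_def s_def)
  let ?x = "\<lambda>t. of_bool (decide T w t) :: real"
  let ?v = "\<lambda>t. fst (w t) - fst (snd (w t)) \<bullet> ps"
  let ?I = "\<lambda>j. \<Sum>k<T. snd (snd (w k)) $ j - fst (snd (w k)) $ j * ?x k"
  define M where "M = rb + ab * norm ps"
  have inv: "(\<Sum>t<T. ps \<bullet> snd (snd (w t)) - (fst (snd (w t)) \<bullet> ps) * ?x t) = (\<Sum>j\<in>UNIV. ps $ j * ?I j)"
    unfolding inner_vec_def sum_distrib_left sum_distrib_right sum_subtractf[symmetric]
    by (subst sum.swap) (simp add: algebra_simps)
  have inv_le: "(\<Sum>j\<in>UNIV. ps $ j * ?I j)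
     \<le> (\<Sum>j\<in>UNIV. ps $ j) * (bb * (2 * warmup T + 1) + 4 * scale * sqrt (ln T) * sqrt (warmup T))"
    unfolding sum_distrib_right
  proof (rule sum_mono)
    fix j
    have "0 \<le> ps $ j" using ps_in by (auto simp: Omega_p_def nonneg_vec_def)
    thus "ps $ j * ?I j \<le> ps $ j * (bb * (2 * warmup T + 1) + 4 * scale * sqrt (ln T) * sqrt (warmup T))"
      using final_inventory[OF sr l g ty, of j] by (cases "ps $ j = 0") (auto intro!: mult_left_mono)
  qed
  let ?d = "\<lambda>t. max 0 (?v t) - ?v t * ?x t"
  have mid: "(\<Sum>t=s..<e. ?d t) \<le> (\<Sum>t=s..<e. disagreement (price T w t) ps (w t))"
  proof (rule sum_mono)
    fix t assume "t \<in> {s..<e}"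
    hence "decide T w t \<longleftrightarrow> fst (snd (w t)) \<bullet> price T w t < fst (w t)"
      using se good_decide[OF sr l g ty, of t] by (auto simp: s_def e_def)
    thus "?d t \<le> disagreement (price T w t) ps (w t)"
      by (auto simp: disagreement_def inner_diff_right of_bool_def max_def)
  qed
  have M0: "0 \<le> M" using rb_pos ab_pos by (simp add: M_def)
  have bd: "?d t \<le> M" if "t < T" "\<not> (s \<le> t \<and> t < e)" for t
  proof -
    have "\<not> decide T w t" using that good_decide[OF sr l g ty, of t] by (auto simp: s_def e_def)
    moreover have "\<bar>fst (snd (w t)) \<bullet> ps\<bar> \<le> norm (fst (snd (w t))) * norm ps" by (rule Cauchy_Schwarz_ineq2)
    moreover have "norm (fst (snd (w t))) * norm ps \<le> ab * norm ps"
      using ty that by (intro mult_right_mono) (auto simp: typical_def less_imp_le)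
    moreover have "\<bar>fst (w t)\<bar> < rb" using ty that by (auto simp: typical_def)
    ultimately show ?thesis using rb_pos ab_pos by (auto simp: M_def)
  qed
  have left: "(\<Sum>t<s. ?d t) \<le> real s * M"
  proof -
    have "(\<Sum>t<s. ?d t) \<le> (\<Sum>t<s. M)" using se by (intro sum_mono bd) auto
    thus ?thesis by simp
  qed
  have right: "(\<Sum>t=e..<T. ?d t) \<le> (real s + 1) * M"
  proof -
    have "(\<Sum>t=e..<T. ?d t) \<le> (\<Sum>t=e..<T. M)" by (intro sum_mono bd) auto
    also have "\<dots> = real (T - e) * M" by simp
    also have "\<dots> \<le> (real s + 1) * M" using se M0 by (intro mult_right_mono) auto
    finally show ?thesis .
  qed
  have "regret T w \<le> (\<Sum>t<T. ps \<bullet> snd (snd (w t)) + max 0 (?v t)) - (\<Sum>t<T. fst (w t) * ?x t)"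
    using opt_reward_dual_bound(1)[OF T ty] by simp
  \<comment> \<open>Adding and subtracting the value of the consumed resources at \<open>ps\<close>
    separates surplus from inventory.\<close>
  also have "\<dots> = (\<Sum>t<T. ?d t) + (\<Sum>t<T. ps \<bullet> snd (snd (w t)) - (fst (snd (w t)) \<bullet> ps) * ?x t)"
    unfolding sum.distrib[symmetric] sum_subtractf[symmetric]
    by (intro sum.cong refl) (simp add: algebra_simps)
  also have "\<dots> = (\<Sum>t<s. ?d t) + (\<Sum>t=s..<e. ?d t) + (\<Sum>t=e..<T. ?d t) + (\<Sum>j\<in>UNIV. ps $ j * ?I j)"
    using se by (simp only: inv split_sum[of e T] split_sum[of s e])
  also have "\<dots> \<le> real s * M + (\<Sum>t=s..<e. disagreement (price T w t) ps (w t)) + (real s + 1) * M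
     + (\<Sum>j\<in>UNIV. ps $ j) * (bb * (2 * warmup T + 1) + 4 * scale * sqrt (ln T) * sqrt (warmup T))"
    by (intro add_mono left mid right inv_le)
  also have "\<dots> = (\<Sum>t=s..<e. disagreement (price T w t) ps (w t)) + waste T"
    by (simp add: waste_def M_def[symmetric] s_def[symmetric] algebra_simps)
  finally show ?thesis unfolding e_def s_def .
qed

end

section \<open>Probability of the good event\<close>

lemma harmonic_sum_bound: "1 \<le> n \<Longrightarrow> (\<Sum>k=1..n. 1 / real k) \<le> 1 + ln n"
proof -
  assume "1 \<le> n"
  then obtain m where n: "n = Suc m" by (cases n) auto
  have "harm (Suc m) - ln (real (Suc m)) \<le> harm (Suc 0) - ln (real (Suc 0))"
    using decseqD[OF decseq_harm_diff_ln, of 0 m] by simp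
  thus ?thesis unfolding n harm_def by (simp add: inverse_eq_divide)
qed

text \<open>The reciprocal of a minimum is at most the sum of the reciprocals, so two harmonic sums
  suffice. This is the second logarithm of the regret; the first is the level
  \<open>radius2 * ln T\<close>.\<close>

lemma clock_reciprocal_sum:
  assumes "1 \<le> s" "1 \<le> h"
  shows "(\<Sum>t=s..<2 * h - s. 1 / real (clock h t)) \<le> 2 * (1 + ln (2 * h))"
proof -
  let ?H = "\<Sum>k=1..<2 * h. 1 / real k"
  have "(\<Sum>t=s..<2 * h - s. 1 / real (clock h t)) \<le> (\<Sum>t=s..<2 * h - s. 1 / real t + 1 / real (2 * h - t))"
    by (intro sum_mono) (auto simp: clock_def min_def)
  also have "\<dots> \<le> (\<Sum>t=1..<2 * h. 1 / real t + 1 / real (2 * h - t))"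
    using assms by (intro sum_mono2) auto
  also have "\<dots> = ?H + (\<Sum>t=1..<2 * h. 1 / real (2 * h - t))" by (rule sum.distrib)
  also have "(\<Sum>t=1..<2 * h. 1 / real (2 * h - t)) = ?H"
    by (subst sum.atLeastLessThan_rev) simp
  also have "?H \<le> (\<Sum>k=1..2 * h. 1 / real k)" by (intro sum_mono2) auto
  also have "\<dots> \<le> 1 + ln (2 * h)" using assms harmonic_sum_bound[of "2 * h"] by simp
  finally show ?thesis by simp
qed

context regular_orders
begin

lemma typical_AE: "AE w in Q T. typical T w"
proof -
  have "AE w in Q T. \<forall>t\<in>{..<T}. \<bar>fst (w t)\<bar> < rb \<and> norm (fst (snd (w t))) < ab \<and>
     (\<forall>j. 0 \<le> snd (snd (w t)) $ j \<and> snd (snd (w t)) $ j < bb)"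
    by (intro eventually_ball_finite ballI AE_PiM_component prob_space_axioms bounded) auto
  thus ?thesis by (simp add: typical_def lessThan_def)
qed

lemma exponential_tail:
  assumes s: "0 < s" and [measurable]: "f \<in> borel_measurable (Q T)"
    and le: "(\<integral>\<^sup>+w. ennreal (exp (s * f w)) \<partial>Q T) \<le> ennreal (exp (s * a))" and b: "s * a + b \<le> s * c"
  shows "emeasure (Q T) {w\<in>space (Q T). c \<le> f w} \<le> ennreal (exp (- b))"
proof -
  have "emeasure (Q T) {w\<in>space (Q T). c \<le> f w}
     \<le> ennreal (exp (- s * c)) * (\<integral>\<^sup>+w. ennreal (exp (s * f w)) * indicator (space (Q T)) w \<partial>Q T)"
    using s by (intro Chernoff_ineq_nn_integral_ge) auto
  also have "(\<integral>\<^sup>+w. ennreal (exp (s * f w)) * indicator (space (Q T)) w \<partial>Q T) = (\<integral>\<^sup>+w. ennreal (exp (s * f w)) \<partial>Q T)"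
    by (intro nn_integral_cong) simp
  also have "ennreal (exp (- s * c)) * (\<integral>\<^sup>+w. ennreal (exp (s * f w)) \<partial>Q T) \<le> ennreal (exp (- s * c)) * ennreal (exp (s * a))"
    by (intro mult_left_mono le) auto
  also have "\<dots> = ennreal (exp (- s * c + s * a))" by (simp add: ennreal_mult[symmetric] mult_exp_exp)
  also have "\<dots> \<le> ennreal (exp (- b))" using b by (intro ennreal_leI) simp
  finally show ?thesis .
qed

text \<open>Scaled by \<open>bb\<close>, the replenishment lies in [0, 1], where
  \<open>exp (- x) \<le> 1 - x / 2\<close>; the linear bound lets the lower bound on the mean enter
  directly.\<close>

lemma replenishment_mgf: "(\<integral>\<^sup>+\<omega>. ennreal (exp (- (snd (snd \<omega>) $ j / bb))) \<partial>P) \<le> ennreal (exp (- (bl / (2 * bb))))"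
proof -
  have "(\<integral>\<^sup>+\<omega>. ennreal (exp (- (snd (snd \<omega>) $ j / bb))) \<partial>P) \<le> (\<integral>\<^sup>+\<omega>. ennreal (1 - snd (snd \<omega>) $ j / bb / 2) \<partial>P)"
  proof (rule nn_integral_mono_AE)
    show "AE \<omega> in P. ennreal (exp (- (snd (snd \<omega>) $ j / bb))) \<le> ennreal (1 - snd (snd \<omega>) $ j / bb / 2)"
      using bounded by eventually_elim (intro ennreal_leI exp_minus_le; use bb_pos in \<open>auto simp: less_imp_le\<close>)
  qed
  also have "\<dots> = ennreal (\<integral>\<omega>. 1 - snd (snd \<omega>) $ j / bb / 2 \<partial>P)"
  proof (rule nn_integral_eq_integral)
    show "AE \<omega> in P. 0 \<le> 1 - snd (snd \<omega>) $ j / bb / 2"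
      using bounded
    proof eventually_elim
      case (elim \<omega>)
      hence "snd (snd \<omega>) $ j / bb \<le> 1" using bb_pos by (auto simp: less_imp_le)
      moreover have "0 \<le> 1 - x / 2" if "x \<le> 1" for x :: real using that by simp
      ultimately show ?case by blast
    qed
  qed (auto intro!: Bochner_Integration.integrable_diff integrable_divide integrable_b)
  also have "(\<integral>\<omega>. 1 - snd (snd \<omega>) $ j / bb / 2 \<partial>P) = 1 - (\<integral>\<omega>. snd (snd \<omega>) $ j \<partial>P) / bb / 2"
    by (subst Bochner_Integration.integral_diff) (auto intro!: integrable_divide integrable_b simp: prob_space)
  also have "\<dots> \<le> 1 - bl / bb / 2"
    using mean_gt[of j] bb_pos by (intro diff_left_mono divide_right_mono) auto
  also have "\<dots> \<le> exp (- (bl / (2 * bb)))" using exp_ge_add_one_self[of "- (bl / (2 * bb))"] by simp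
  finally show ?thesis by (simp add: ennreal_leI)
qed

lemma buffer_mgf:
  "s \<le> T \<Longrightarrow> (\<integral>\<^sup>+w. ennreal (exp (1 / bb * (- (\<Sum>k<s. snd (snd (w k)) $ j)))) \<partial>Q T) \<le> ennreal (exp (- (real s * (bl / (2 * bb)))))"
proof (induction s)
  case 0
  interpret Q: prob_space "Q T" by (rule prob_space_Q)
  show ?case by (simp add: Q.emeasure_space_1)
next
  case (Suc s)
  have meas: "(\<lambda>w. \<Sum>k<r. snd (snd (w k)) $ j) \<in> borel_measurable (Q T)" if "r \<le> T" for r
  proof (rule borel_measurable_sum)
    fix k assume "k \<in> {..<r}"
    hence [measurable]: "(\<lambda>w. w k) \<in> Q T \<rightarrow>\<^sub>M P" using that by (intro measurable_component_singleton) auto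
    show "(\<lambda>w. snd (snd (w k)) $ j) \<in> borel_measurable (Q T)" by measurable
  qed
  let ?f = "\<lambda>w. ennreal (exp (1 / bb * (- (\<Sum>k<Suc s. snd (snd (w k)) $ j))))"
  let ?g = "\<lambda>w. ennreal (exp (- (bl / (2 * bb)))) * ennreal (exp (1 / bb * (- (\<Sum>k<s. snd (snd (w k)) $ j))))"
  have "(\<integral>\<^sup>+w. ?f w \<partial>Q T) \<le> (\<integral>\<^sup>+w. ?g w \<partial>Q T)"
  proof (rule nn_integral_PiM_coordinate[of s])
    show "s < T" using Suc.prems by simp
    have "(\<lambda>x. ennreal (exp (1 / bb * - x))) \<in> borel_measurable borel" by measurable
    note exp_meas = measurable_compose[OF meas this]
    show "?f \<in> borel_measurable (Q T)" using Suc.prems by (rule exp_meas)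
    show "?g \<in> borel_measurable (Q T)" using Suc.prems by (intro borel_measurable_times_ennreal exp_meas) auto
    show "?g (x(s := y)) = ?g x" for x y by simp
    fix x :: "nat \<Rightarrow> 'm obs"
    let ?S = "\<Sum>k<s. snd (snd (x k)) $ j"
    have "(\<integral>\<^sup>+y. ?f (x(s := y)) \<partial>P) = (\<integral>\<^sup>+y. ennreal (exp (1 / bb * (- ?S))) * ennreal (exp (- (snd (snd y) $ j / bb))) \<partial>P)"
      by (intro nn_integral_cong) (simp add: ennreal_mult[symmetric] exp_add[symmetric] diff_divide_distrib)
    also have "\<dots> = ennreal (exp (1 / bb * (- ?S))) * (\<integral>\<^sup>+y. ennreal (exp (- (snd (snd y) $ j / bb))) \<partial>P)"
      by (rule nn_integral_cmult) measurable
    also have "\<dots> \<le> ennreal (exp (1 / bb * (- ?S))) * ennreal (exp (- (bl / (2 * bb))))"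
      by (intro mult_left_mono replenishment_mgf) auto
    finally show "(\<integral>\<^sup>+y. ?f (x(s := y)) \<partial>P) \<le> ?g x" by (simp only: mult.commute)
  qed
  also have "\<dots> = ennreal (exp (- (bl / (2 * bb)))) * (\<integral>\<^sup>+w. ennreal (exp (1 / bb * (- (\<Sum>k<s. snd (snd (w k)) $ j)))) \<partial>Q T)"
  proof (rule nn_integral_cmult)
    have "(\<lambda>x. ennreal (exp (1 / bb * - x))) \<in> borel_measurable borel" by measurable
    from measurable_compose[OF meas this] show "(\<lambda>w. ennreal (exp (1 / bb * (- (\<Sum>k<s. snd (snd (w k)) $ j))))) \<in> borel_measurable (Q T)"
      using Suc.prems by simp
  qed
  also have "\<dots> \<le> ennreal (exp (- (bl / (2 * bb)))) * ennreal (exp (- (real s * (bl / (2 * bb)))))"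
    using Suc by (intro mult_left_mono) auto
  also have "\<dots> = ennreal (exp (- (real (Suc s) * (bl / (2 * bb)))))"
    by (simp add: ennreal_mult[symmetric] mult_exp_exp distrib_right add_divide_distrib)
  finally show ?case .
qed

lemma exponents_le:
  assumes "1 \<le> ln T"
  shows "temp * rising_exponent T + 2 * ln T \<le> temp * (radius2 * ln T)"
    and "temp * falling_exponent T + 2 * ln T \<le> temp * (radius2 * ln T)"
proof -
  define L where "L = ln (real T)"
  have L: "1 \<le> L" using assms by (simp add: L_def)
  have T1: "1 \<le> T" using assms by (cases T) auto
  \<comment> \<open>Equal to \<open>2 / temp\<close>, and also to the noise part of
    \<open>falling_exponent\<close>; \<open>radius2\<close> contains it twice for these two
    uses.\<close>
  define a where "a = 16 * rate * use_bound\<^sup>2 / \<gamma>\<^sup>2"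
  have a: "0 < a" using constants_pos gamma_pos by (simp add: a_def)
  have ta: "temp * a = 2"
    using constants_pos gamma_pos by (simp add: temp_def a_def gain_def power2_eq_square field_simps)
  have r: "radius2 = 160 * dimn * scale\<^sup>2 / \<gamma>\<^sup>2 + 2 * a + (rate + 1) * diam2"
    by (simp add: radius2_def a_def)
  have fe: "falling_exponent T = 160 * dimn * scale\<^sup>2 / \<gamma>\<^sup>2 * L + a + (rate + 1) * diam2"
    using gamma_pos
    by (simp add: falling_exponent_def rising_exponent_def shift_var_def L_def a_def power_divide field_simps)
  have "falling_exponent T + a * L \<le> radius2 * L"
  proof -
    define d where "d = (rate + 1) * diam2"
    have "a * 1 \<le> a * L" "d * 1 \<le> d * L"
      using L a constants_pos by (intro mult_left_mono; simp add: d_def)+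
    moreover define b where "b = 160 * dimn * scale\<^sup>2 / \<gamma>\<^sup>2"
    ultimately show ?thesis unfolding fe r d_def[symmetric] b_def[symmetric] by (simp add: algebra_simps)
  qed
  hence "temp * (falling_exponent T + a * L) \<le> temp * (radius2 * L)"
    using constants_pos by (intro mult_left_mono) auto
  thus 1: "temp * falling_exponent T + 2 * ln T \<le> temp * (radius2 * ln T)"
    using ta by (simp add: distrib_left mult.assoc[symmetric] L_def)
  have "rising_exponent T \<le> falling_exponent T"
    using shift_var_nonneg[OF T1] constants_pos by (simp add: falling_exponent_def)
  hence "temp * rising_exponent T \<le> temp * falling_exponent T" using constants_pos by (intro mult_left_mono) auto
  thus "temp * rising_exponent T + 2 * ln T \<le> temp * (radius2 * ln T)" using 1 by linarith
qed

definition buffered :: "nat \<Rightarrow> bool" where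
  "buffered T \<longleftrightarrow> buffer T / bb + ln T \<le> warmup T * (bl / (2 * bb))"

text \<open>A union bound: at most \<open>2 * T\<close> price events of probability
  \<open>T^-2\<close> and one replenishment event of probability \<open>1 / T\<close> per resource.
  \<open>B\<close> is a measurable set containing all bad paths, so measurability of
  \<open>good\<close> is never at issue.\<close>

lemma bad_event:
  assumes l: "large \<rho> T" and bf: "buffered T"
  obtains B where "B \<in> sets (Q T)" "emeasure (Q T) B \<le> ennreal ((2 + dimn) / T)"
    "\<And>w. w \<in> space (Q T) \<Longrightarrow> w \<notin> B \<Longrightarrow> good T w"
proof -
  define h where "h = T div 2"
  define L where "L = ln (real T)"
  have T: "2 \<le> T" "1 \<le> T" using large_T[OF l] by auto
  have L: "1 \<le> L" using l by (simp add: large_def L_def)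
  have eL: "exp (- L) = 1 / T" "exp (- (2 * L)) = 1 / T / T"
    using T by (auto simp: L_def exp_minus exp_double power2_eq_square inverse_eq_divide)
  define A where "A = (\<lambda>t. {w\<in>space (Q T). radius2 * L \<le> real (Suc t) * err T w t})"
  define F where "F = {t. h \<le> t \<and> t < 2 * h \<and> rate + 1 \<le> real (2 * h - t)}"
  define D where "D = (\<lambda>t. {w\<in>space (Q T). radius2 * L \<le> real (2 * h - t) * err T w t})"
  define C where "C = (\<lambda>j. {w\<in>space (Q T). - buffer T \<le> - (\<Sum>k<warmup T. snd (snd (w k)) $ j)})"
  have Ft: "t \<le> T" "t < 2 * h" if "t \<in> F" for t using that by (auto simp: F_def h_def)
  have finF: "finite F" by (rule finite_subset[of _ "{..<2 * h}"]) (auto simp: F_def)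
  have cardF: "card F \<le> h"
  proof -
    have "card F \<le> card {h..<2 * h}" by (intro card_mono) (auto simp: F_def)
    thus ?thesis by simp
  qed
  have wT: "warmup T \<le> T" using l by (auto simp: large_def)
  have Cm [measurable]: "(\<lambda>w. \<Sum>k<warmup T. snd (snd (w k)) $ j) \<in> borel_measurable (Q T)" for j
  proof (rule borel_measurable_sum)
    fix k assume "k \<in> {..<warmup T}"
    hence [measurable]: "(\<lambda>w. w k) \<in> Q T \<rightarrow>\<^sub>M P" using wT by (intro measurable_component_singleton) auto
    show "(\<lambda>w. snd (snd (w k)) $ j) \<in> borel_measurable (Q T)" by measurable
  qed
  have A: "A t \<in> sets (Q T)" "emeasure (Q T) (A t) \<le> ennreal (1 / T / T)" if "t \<le> h" for t
  proof -
    have [measurable]: "(\<lambda>w. price T w t) \<in> Q T \<rightarrow>\<^sub>M borel" using that by (intro price_measurable) (auto simp: h_def)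
    show "A t \<in> sets (Q T)" unfolding A_def by measurable
    show "emeasure (Q T) (A t) \<le> ennreal (1 / T / T)"
      unfolding A_def eL(2)[symmetric]
      by (rule exponential_tail[OF constants_pos(7) _ rising_phase[OF T(2)]])
        (use that exponents_le(1)[of T] L in \<open>auto simp: h_def L_def\<close>)
  qed
  have D: "D t \<in> sets (Q T)" "emeasure (Q T) (D t) \<le> ennreal (1 / T / T)" if "t \<in> F" for t
  proof -
    have [measurable]: "(\<lambda>w. price T w t) \<in> Q T \<rightarrow>\<^sub>M borel" using Ft[OF that] by (intro price_measurable)
    show "D t \<in> sets (Q T)" unfolding D_def by measurable
    show "emeasure (Q T) (D t) \<le> ennreal (1 / T / T)"
      unfolding D_def eL(2)[symmetric]
      by (rule exponential_tail[OF constants_pos(7) _ falling_phase[OF T(1), folded h_def]])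
        (use that exponents_le(2)[of T] L in \<open>auto simp: F_def L_def h_def\<close>)
  qed
  have C: "C j \<in> sets (Q T)" "emeasure (Q T) (C j) \<le> ennreal (1 / T)" for j
  proof -
    show "C j \<in> sets (Q T)" unfolding C_def by measurable
    show "emeasure (Q T) (C j) \<le> ennreal (1 / T)"
      unfolding C_def eL(1)[symmetric]
    proof (rule exponential_tail[where s = "1 / bb" and a = "- (real (warmup T) * (bl / 2))"])
      show "(\<integral>\<^sup>+w. ennreal (exp (1 / bb * (- (\<Sum>k<warmup T. snd (snd (w k)) $ j)))) \<partial>Q T)
        \<le> ennreal (exp (1 / bb * - (real (warmup T) * (bl / 2))))"
        using buffer_mgf[OF wT, of j] by (simp add: mult.commute)
      show "1 / bb * - (real (warmup T) * (bl / 2)) + L \<le> 1 / bb * - buffer T"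
        using bf bb_pos by (simp add: buffered_def L_def)
    qed (use bb_pos in auto)
  qed
  define B where "B = (\<Union>t\<in>{..h}. A t) \<union> (\<Union>t\<in>F. D t) \<union> (\<Union>j\<in>UNIV. C j)"
  show ?thesis
  proof (rule that)
    have sU: "(\<Union>t\<in>{..h}. A t) \<in> sets (Q T)" "(\<Union>t\<in>F. D t) \<in> sets (Q T)" "(\<Union>j\<in>UNIV. C j) \<in> sets (Q T)"
      using A D C finF by (auto intro!: sets.finite_UN)
    thus "B \<in> sets (Q T)" unfolding B_def by auto
    have "emeasure (Q T) B \<le> emeasure (Q T) (\<Union>t\<in>{..h}. A t) + emeasure (Q T) (\<Union>t\<in>F. D t) + emeasure (Q T) (\<Union>j\<in>UNIV. C j)"
      unfolding B_def using sU
      by (intro order_trans[OF emeasure_subadditive] add_mono emeasure_subadditive order_refl) auto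
    also have "\<dots> \<le> (\<Sum>t\<in>{..h}. emeasure (Q T) (A t)) + (\<Sum>t\<in>F. emeasure (Q T) (D t)) + (\<Sum>j\<in>UNIV. emeasure (Q T) (C j))"
      using A D C finF by (intro add_mono emeasure_subadditive_finite) auto
    also have "\<dots> \<le> (\<Sum>t\<in>{..h}. ennreal (1 / T / T)) + (\<Sum>t\<in>F. ennreal (1 / T / T)) + (\<Sum>j\<in>(UNIV::'m set). ennreal (1 / T))"
      using A D C by (intro add_mono sum_mono) auto
    also have "\<dots> = ennreal (real (h + 1) * (1 / T / T) + real (card F) * (1 / T / T) + dimn * (1 / T))"
      by (simp add: ennreal_of_nat_eq_real_of_nat ennreal_mult[symmetric] ennreal_plus[symmetric] dimn_def del: ennreal_plus)
    also have "\<dots> \<le> ennreal ((2 + dimn) / T)"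
    proof (rule ennreal_leI)
      have "real (h + 1) + real (card F) \<le> 2 * real T" using cardF T by (simp add: h_def)
      hence "(real (h + 1) + real (card F)) * (1 / T / T) \<le> 2 * real T * (1 / T / T)" by (intro mult_right_mono) auto
      also have "\<dots> = 2 / T" using T by simp
      finally show "real (h + 1) * (1 / T / T) + real (card F) * (1 / T / T) + dimn * (1 / T) \<le> (2 + dimn) / T"
        by (simp add: distrib_right add_divide_distrib)
    qed
    finally show "emeasure (Q T) B \<le> ennreal ((2 + dimn) / T)" .
    fix w assume w: "w \<in> space (Q T)" "w \<notin> B"
    show "good T w"
      unfolding good_def
    proof (intro conjI allI impI)
      fix t assume "t \<le> T div 2"
      hence "w \<notin> A t" using w by (auto simp: B_def h_def)
      thus "real (Suc t) * err T w t \<le> radius2 * ln T" using w by (simp add: A_def L_def)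
    next
      fix t assume "T div 2 \<le> t" "rate + 1 \<le> real (2 * (T div 2) - t)"
      moreover from this have "t < 2 * h" using constants_pos by (cases "t < 2 * h") (auto simp: h_def)
      ultimately have "t \<in> F" by (simp add: F_def h_def)
      hence "w \<notin> D t" using w by (auto simp: B_def)
      thus "real (2 * (T div 2) - t) * err T w t \<le> radius2 * ln T" using w by (simp add: D_def L_def h_def)
    next
      fix j
      have "w \<notin> C j" using w by (auto simp: B_def)
      thus "buffer T \<le> (\<Sum>k<warmup T. snd (snd (w k)) $ j)" using w by (simp add: C_def)
    qed
  qed
qed

section \<open>Measurability\<close>

lemma component_measurable: "t < T \<Longrightarrow> (\<lambda>w. w t) \<in> Q T \<rightarrow>\<^sub>M P"
  by (intro measurable_component_singleton) auto

lemma decide_measurable: "t < T \<Longrightarrow> Measurable.pred (Q T) (\<lambda>w. decide T w t)"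
proof (induction t rule: less_induct)
  case (less t)
  note [measurable] = component_measurable[OF less.prems]
  have inv: "(\<lambda>w. \<Sum>k<t. snd (snd (w k)) $ j - fst (snd (w k)) $ j * of_bool (decide T w k)) \<in> borel_measurable (Q T)" for j
  proof (rule borel_measurable_sum)
    fix k assume k: "k \<in> {..<t}"
    have [measurable]: "(\<lambda>w. w k) \<in> Q T \<rightarrow>\<^sub>M P" using k less.prems by (intro component_measurable) auto
    have [measurable]: "Measurable.pred (Q T) (\<lambda>w. decide T w k)" using k less by auto
    show "(\<lambda>w. snd (snd (w k)) $ j - fst (snd (w k)) $ j * of_bool (decide T w k)) \<in> borel_measurable (Q T)"
      by measurable
  qed
  have "Measurable.pred (Q T) (\<lambda>w. \<forall>j\<in>UNIV. fst (snd (w t)) $ j \<le> snd (snd (w t)) $ j +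
        (\<Sum>k<t. snd (snd (w k)) $ j - fst (snd (w k)) $ j * of_bool (decide T w k)))"
  proof (intro pred_intros_finite)
    fix j
    show "Measurable.pred (Q T) (\<lambda>w. fst (snd (w t)) $ j \<le> snd (snd (w t)) $ j +
        (\<Sum>k<t. snd (snd (w k)) $ j - fst (snd (w k)) $ j * of_bool (decide T w k)))"
      unfolding pred_def by (intro borel_measurable_le borel_measurable_add inv) measurable
  qed simp
  moreover have "Measurable.pred (Q T) (\<lambda>w. fst (snd (w t)) \<bullet> price T w t < fst (w t))"
    unfolding pred_def
  proof (intro borel_measurable_less borel_measurable_inner)
    show "(\<lambda>w. price T w t) \<in> borel_measurable (Q T)" using less.prems by (intro price_measurable) simp
  qed measurable
  ultimately have m: "Measurable.pred (Q T) (\<lambda>w. fst (snd (w t)) \<bullet> price T w t < fst (w t) \<and>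
     (\<forall>j\<in>UNIV. fst (snd (w t)) $ j \<le> snd (snd (w t)) $ j +
        (\<Sum>k<t. snd (snd (w k)) $ j - fst (snd (w k)) $ j * of_bool (decide T w k))))"
    unfolding pred_def by (intro sets.sets_Collect_conj)
  show ?case
  proof (cases "warmup T \<le> t \<and> t < 2 * (T div 2) - warmup T")
    case True
    have "(\<lambda>w. decide T w t) = (\<lambda>w. fst (snd (w t)) \<bullet> price T w t < fst (w t) \<and>
       (\<forall>j\<in>UNIV. fst (snd (w t)) $ j \<le> snd (snd (w t)) $ j +
          (\<Sum>k<t. snd (snd (w k)) $ j - fst (snd (w k)) $ j * of_bool (decide T w k))))"
      by (rule ext, subst dec_policy) (use True in simp)
    thus ?thesis using m by (simp only:)
  next
    case False
    have "(\<lambda>w. decide T w t) = (\<lambda>w. False)" by (rule ext, subst dec_policy) (use False in auto)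
    thus ?thesis by (simp only: measurable_const UNIV_I space_count_space)
  qed
qed

text \<open>The set over which the maximum is taken varies with the path, but always inside one
  finite set. Superlevel sets are therefore finite combinations of feasibility events and events
  about fixed decision sequences.\<close>

lemma opt_reward_measurable: "opt_reward T \<in> borel_measurable (Q T)"
proof -
  define F where "F = {x::nat \<Rightarrow> bool. \<forall>t\<ge>T. \<not> x t}"
  have "F \<subseteq> (\<lambda>S t. t \<in> S) ` Pow {..<T}"
  proof
    fix x assume "x \<in> F"
    hence "t < T" if "x t" for t using that by (cases "t < T") (auto simp: F_def)
    hence "x = (\<lambda>t. t \<in> {t. x t})" "{t. x t} \<subseteq> {..<T}" by auto
    thus "x \<in> (\<lambda>S t. t \<in> S) ` Pow {..<T}" by blast
  qed
  hence fin: "finite F" by (rule finite_subset) auto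
  define val where "val = (\<lambda>(w :: nat \<Rightarrow> 'm obs) x. \<Sum>t<T. fst (w t) * of_bool (x t :: bool))"
  define X where "X = (\<lambda>w :: nat \<Rightarrow> 'm obs. {x. prefix_feasible T w x \<and> (\<forall>t\<ge>T. \<not> x t)})"
  have opt: "opt_reward T w = Max (val w ` X w)" for w by (simp add: opt_reward_def X_def val_def)
  have XF: "X w = {x\<in>F. prefix_feasible T w x}" for w by (auto simp: X_def F_def)
  have finX: "finite (X w)" for w using fin by (simp add: XF)
  have [measurable]: "(\<lambda>w. val w x) \<in> borel_measurable (Q T)" for x
    unfolding val_def
  proof (rule borel_measurable_sum)
    fix t assume "t \<in> {..<T}"
    hence [measurable]: "(\<lambda>w. w t) \<in> Q T \<rightarrow>\<^sub>M P" by (intro component_measurable) auto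
    show "(\<lambda>w. fst (w t) * of_bool (x t)) \<in> borel_measurable (Q T)" by measurable
  qed
  have pf: "Measurable.pred (Q T) (\<lambda>w. prefix_feasible T w x)" for x
  proof -
    have m: "Measurable.pred (Q T) (\<lambda>w. \<forall>t\<in>{..<T}. \<forall>j\<in>UNIV.
        (\<Sum>k\<in>{..t}. fst (snd (w k)) $ j * of_bool (x k)) \<le> (\<Sum>k\<in>{..t}. snd (snd (w k)) $ j))"
    proof (intro pred_intros_finite)
      fix t j assume t: "t \<in> {..<T}"
      have c: "(\<lambda>w. w k) \<in> Q T \<rightarrow>\<^sub>M P" if "k \<in> {..t}" for k using t that by (intro component_measurable) auto
      have "(\<lambda>w. fst (snd (w k)) $ j * of_bool (x k)) \<in> borel_measurable (Q T)"
        "(\<lambda>w. snd (snd (w k)) $ j) \<in> borel_measurable (Q T)" if "k \<in> {..t}" for k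
        using c[OF that] by measurable
      hence "(\<lambda>w. \<Sum>k\<in>{..t}. fst (snd (w k)) $ j * of_bool (x k)) \<in> borel_measurable (Q T)"
        "(\<lambda>w. \<Sum>k\<in>{..t}. snd (snd (w k)) $ j) \<in> borel_measurable (Q T)"
        by (intro borel_measurable_sum; blast)+
      thus "Measurable.pred (Q T) (\<lambda>w. (\<Sum>k\<in>{..t}. fst (snd (w k)) $ j * of_bool (x k)) \<le> (\<Sum>k\<in>{..t}. snd (snd (w k)) $ j))"
        unfolding pred_def by (rule borel_measurable_le)
    qed auto
    have eq: "(\<lambda>w. prefix_feasible T w x) = (\<lambda>w. \<forall>t\<in>{..<T}. \<forall>j\<in>UNIV.
        (\<Sum>k\<in>{..t}. fst (snd (w k)) $ j * of_bool (x k)) \<le> (\<Sum>k\<in>{..t}. snd (snd (w k)) $ j))"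
      unfolding prefix_feasible_def Ball_def lessThan_iff by (simp only: UNIV_I simp_thms)
    show ?thesis unfolding eq by (rule m)
  qed
  show ?thesis
    unfolding borel_measurable_iff_greater
  proof
    fix c :: real
    \<comment> \<open>Off the almost sure set replenishments may be negative and nothing feasible;
      the value is then the constant \<open>Max {}\<close>.\<close>
    have "{w\<in>space (Q T). c < opt_reward T w}
       = {w\<in>space (Q T). (\<exists>x\<in>F. prefix_feasible T w x \<and> c < val w x) \<or> ((\<forall>x\<in>F. \<not> prefix_feasible T w x) \<and> c < Max {})}"
    proof (intro Collect_cong conj_cong refl)
      fix w
      show "c < opt_reward T w \<longleftrightarrow> (\<exists>x\<in>F. prefix_feasible T w x \<and> c < val w x) \<or> ((\<forall>x\<in>F. \<not> prefix_feasible T w x) \<and> c < Max {})"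
      proof (cases "X w = {}")
        case True
        hence "opt_reward T w = Max {}" by (simp add: opt)
        moreover have "\<forall>x\<in>F. \<not> prefix_feasible T w x" using True by (auto simp: XF)
        ultimately show ?thesis by simp
      next
        case False
        hence "c < opt_reward T w \<longleftrightarrow> (\<exists>x\<in>X w. c < val w x)"
          unfolding opt using finX by (subst Max_gr_iff) auto
        thus ?thesis using False by (auto simp: XF)
      qed
    qed
    also have "\<dots> \<in> sets (Q T)"
    proof -
      have "{w\<in>space (Q T). prefix_feasible T w x} \<in> sets (Q T)" "{w\<in>space (Q T). c < val w x} \<in> sets (Q T)" for x
        using pf[of x] by (simp add: pred_def) measurable
      thus ?thesis
        by (intro sets.sets_Collect_disj sets.sets_Collect_conj sets.sets_Collect_neg sets.sets_Collect_const
              sets.sets_Collect_finite_Ex sets.sets_Collect_finite_All fin)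
    qed
    finally show "{w\<in>space (Q T). c < opt_reward T w} \<in> sets (Q T)" .
  qed
qed

lemma regret_measurable: "regret T \<in> borel_measurable (Q T)"
proof (rule borel_measurable_diff[OF opt_reward_measurable borel_measurable_sum])
  fix t assume "t \<in> {..<T}"
  hence [measurable]: "(\<lambda>w. w t) \<in> Q T \<rightarrow>\<^sub>M P" "Measurable.pred (Q T) (\<lambda>w. decide T w t)"
    by (auto intro: component_measurable decide_measurable)
  show "(\<lambda>w. fst (w t) * of_bool (decide T w t)) \<in> borel_measurable (Q T)" by measurable
qed

lemma regret_integrable: "1 \<le> T \<Longrightarrow> integrable (Q T) (regret T)"
proof -
  assume T: "1 \<le> T"
  interpret Q: prob_space "Q T" by (rule prob_space_Q)
  show ?thesis
  proof (rule Q.integrable_const_bound[where B = "2 * rb * T"])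
    show "AE w in Q T. norm (regret T w) \<le> 2 * rb * T"
      using typical_AE[of T] by eventually_elim (use regret_crude[OF T] in simp)
  qed (rule regret_measurable)
qed

lemma regret_crude_expectation: "1 \<le> T \<Longrightarrow> (\<integral>w. regret T w \<partial>Q T) \<le> 2 * rb * T"
proof -
  assume T: "1 \<le> T"
  interpret Q: prob_space "Q T" by (rule prob_space_Q)
  show ?thesis
  proof (rule Q.integral_le_const[OF regret_integrable[OF T]])
    show "AE w in Q T. regret T w \<le> 2 * rb * T"
      using typical_AE[of T] by eventually_elim (use regret_crude[OF T] in \<open>auto simp: abs_le_iff\<close>)
  qed
qed

end

section \<open>Expected regret\<close>

context regular_orders
begin

lemma disagreement_measurable: "t < T \<Longrightarrow> (\<lambda>w. disagreement (price T w t) ps (w t)) \<in> borel_measurable (Q T)"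
proof -
  assume t: "t < T"
  note [measurable] = component_measurable[OF t]
  have [measurable]: "(\<lambda>w. price T w t) \<in> Q T \<rightarrow>\<^sub>M borel" using t by (intro price_measurable) simp
  have [measurable]: "(\<lambda>w. fst (w t)) \<in> borel_measurable (Q T)" "(\<lambda>w. fst (snd (w t))) \<in> borel_measurable (Q T)"
    by measurable
  show ?thesis unfolding disagreement_def by measurable
qed

text \<open>The price is determined by earlier orders, so \<open>smooth\<close> applies when the
  current order alone is integrated out.\<close>

lemma expected_disagreement:
  assumes t: "t < T"
  shows "(\<integral>\<^sup>+w. ennreal (disagreement (price T w t) ps (w t)) \<partial>Q T) \<le> (\<integral>\<^sup>+w. ennreal (\<mu> * err T w t) \<partial>Q T)"
proof (rule nn_integral_PiM_coordinate[OF t])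
  show "(\<lambda>w. ennreal (disagreement (price T w t) ps (w t))) \<in> borel_measurable (Q T)"
    using disagreement_measurable[OF t] by measurable
  have [measurable]: "(\<lambda>w. price T w t) \<in> Q T \<rightarrow>\<^sub>M borel" using t by (intro price_measurable) simp
  show "(\<lambda>w. ennreal (\<mu> * err T w t)) \<in> borel_measurable (Q T)" by measurable
  show "ennreal (\<mu> * err T (x(t := y)) t) = ennreal (\<mu> * err T x t)" for x y by (simp add: state_upd)
  fix x :: "nat \<Rightarrow> 'm obs"
  have "(\<integral>\<^sup>+y. ennreal (disagreement (price T (x(t := y)) t) ps ((x(t := y)) t)) \<partial>P)
     = (\<integral>\<^sup>+y. ennreal (disagreement (price T x t) ps y) \<partial>P)" by (simp add: state_upd)
  also have "\<dots> = ennreal (\<integral>y. disagreement (price T x t) ps y \<partial>P)"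
    by (rule nn_integral_eq_integral[OF disagreement_eq_accept_prob(4)]) (simp add: disagreement_nonneg)
  also have "\<dots> \<le> ennreal (\<mu> * err T x t)" by (intro ennreal_leI smooth state_in)
  finally show "(\<integral>\<^sup>+y. ennreal (disagreement (price T (x(t := y)) t) ps ((x(t := y)) t)) \<partial>P) \<le> ennreal (\<mu> * err T x t)" .
qed

definition regret_const :: real where
  "regret_const = 4 * \<mu> * radius2 + (\<mu> * diam2 + 2 * rb) * (2 + dimn)
     + 5 * (rb + ab * norm ps) + (\<Sum>j\<in>UNIV. ps $ j) * (5 * bb + 8 * scale)"

lemma ps_sum_nonneg: "0 \<le> (\<Sum>j\<in>UNIV. ps $ j)"
  using ps_in by (intro sum_nonneg) (auto simp: Omega_p_def nonneg_vec_def)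

lemma waste_bound:
  assumes L: "1 \<le> ln T"
  shows "waste T \<le> (5 * (rb + ab * norm ps) + (\<Sum>j\<in>UNIV. ps $ j) * (5 * bb + 8 * scale)) * (ln T)\<^sup>2"
    and "0 \<le> waste T"
proof -
  define l where "l = ln (real T)"
  define s where "s = real (warmup T)"
  have l: "1 \<le> l" "1 \<le> l\<^sup>2" using L by (auto simp: l_def one_le_power)
  have s: "0 \<le> s" "s \<le> 2 * l\<^sup>2"
  proof -
    have "s \<le> l\<^sup>2 + 1" unfolding s_def warmup_def l_def using of_int_ceiling_le_add_one[of "(ln (real T))\<^sup>2"] by simp
    thus "s \<le> 2 * l\<^sup>2" using l(2) by linarith
  qed (simp add: s_def)
  have a: "2 * s + 1 \<le> 5 * l\<^sup>2" using s l(2) by linarith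
  \<comment> \<open>The true order is \<open>l\<close> to the power 3/2; the cruder bound matches
    the cost of the rejected periods.\<close>
  have b: "sqrt l * sqrt s \<le> 2 * l\<^sup>2"
  proof -
    have "l * s \<le> l * (2 * l\<^sup>2)" using s l by (intro mult_left_mono) auto
    also have "\<dots> \<le> l\<^sup>2 * (2 * l\<^sup>2)" using l by (intro mult_right_mono) (auto simp: power2_eq_square)
    also have "\<dots> \<le> (2 * l\<^sup>2) * (2 * l\<^sup>2)" by (intro mult_right_mono) auto
    also have "\<dots> = (2 * l\<^sup>2)\<^sup>2" by (rule power2_eq_square[symmetric])
    finally have "sqrt (l * s) \<le> 2 * l\<^sup>2" using l s by (intro real_le_lsqrt) auto
    thus ?thesis by (simp only: real_sqrt_mult)
  qed
  have M: "0 \<le> rb + ab * norm ps" using rb_pos ab_pos by simp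
  have "waste T = (rb + ab * norm ps) * (2 * s + 1) + (\<Sum>j\<in>UNIV. ps $ j) * (bb * (2 * s + 1) + 4 * scale * (sqrt l * sqrt s))"
    by (simp add: waste_def s_def l_def add.commute mult.assoc)
  also have "\<dots> \<le> (rb + ab * norm ps) * (5 * l\<^sup>2) + (\<Sum>j\<in>UNIV. ps $ j) * (bb * (5 * l\<^sup>2) + 4 * scale * (2 * l\<^sup>2))"
    using a b M ps_sum_nonneg bb_pos constants_pos by (intro add_mono mult_left_mono) auto
  also have "\<dots> = (5 * (rb + ab * norm ps) + (\<Sum>j\<in>UNIV. ps $ j) * (5 * bb + 8 * scale)) * l\<^sup>2"
    by (simp add: algebra_simps)
  finally show "waste T \<le> (5 * (rb + ab * norm ps) + (\<Sum>j\<in>UNIV. ps $ j) * (5 * bb + 8 * scale)) * (ln T)\<^sup>2"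
    by (simp only: l_def)
  show "0 \<le> waste T"
    unfolding waste_def using ps_sum_nonneg rb_pos ab_pos bb_pos constants_pos L
    by (intro add_nonneg_nonneg mult_nonneg_nonneg) auto
qed

text \<open>Off the bad set, pricing losses are \<open>\<mu> * radius2 * ln T\<close> times the sum
  of reciprocal clocks. The bad set has probability of order \<open>1 / T\<close> and costs at most
  of order \<open>T\<close>, hence a constant in expectation.\<close>

lemma expected_regret:
  assumes sr: "slack_radius \<rho>" and l: "large \<rho> T" and bf: "buffered T"
  shows "(\<integral>w. regret T w \<partial>Q T) \<le> regret_const * (ln T)\<^sup>2"
proof -
  interpret Q: prob_space "Q T" by (rule prob_space_Q)
  define h where "h = T div 2"
  define L where "L = ln (real T)"
  define s where "s = warmup T"
  define e where "e = 2 * h - s"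
  define \<beta> where "\<beta> = (2 + dimn) / T"
  have T: "2 \<le> T" "1 \<le> T" using large_T[OF l] by auto
  have L1: "1 \<le> L" using l by (simp add: large_def L_def)
  have L: "1 \<le> L" "1 \<le> L\<^sup>2" "L \<le> L\<^sup>2" using L1 by (auto simp: one_le_power self_le_power)
  have \<beta>: "0 \<le> \<beta>" "T * \<beta> = 2 + dimn" using T dimn_ge_1 by (auto simp: \<beta>_def)
  have s0: "1 \<le> s" "s < h" using l rate_ge by (auto simp: large_def s_def h_def)
  have eT: "e \<le> T" by (simp add: e_def h_def)
  obtain B where B: "B \<in> sets (Q T)" "emeasure (Q T) B \<le> ennreal \<beta>"
    "\<And>w. w \<in> space (Q T) \<Longrightarrow> w \<notin> B \<Longrightarrow> good T w"
    using bad_event[OF l bf] unfolding \<beta>_def by blast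
  note [measurable] = B(1)
  have waste0: "0 \<le> waste T" using waste_bound(2)[of T] L by (simp add: L_def)
  let ?dis = "\<lambda>t w. disagreement (price T w t) ps (w t)"
  let ?c = "\<lambda>t. real (clock h t)"
  have clk: "1 \<le> clock h t" if "t \<in> {s..<e}" for t using that s0 by (auto simp: clock_def e_def)
  have dis_le: "(\<integral>\<^sup>+w. ennreal (?dis t w) \<partial>Q T) \<le> ennreal (\<mu> * radius2 * L * (1 / ?c t) + \<mu> * diam2 * \<beta>)" if t: "t \<in> {s..<e}" for t
  proof -
    have tT: "t < T" using t eT by auto
    have c: "rate + 1 \<le> clock (T div 2) t"
      using t by (intro warmup_clock(2)[OF l]) (auto simp: s_def e_def h_def)
    have "(\<integral>\<^sup>+w. ennreal (?dis t w) \<partial>Q T) \<le> (\<integral>\<^sup>+w. ennreal (\<mu> * err T w t) \<partial>Q T)"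
      by (rule expected_disagreement[OF tT])
    \<comment> \<open>On \<open>B\<close> only the diameter bounds the error; with probability of
      order \<open>1 / T\<close> and fewer than \<open>T\<close> periods, the total stays
      bounded.\<close>
    also have "\<dots> \<le> (\<integral>\<^sup>+w. ennreal (\<mu> * radius2 * L * (1 / ?c t)) + ennreal (\<mu> * diam2) * indicator B w \<partial>Q T)"
    proof (rule nn_integral_mono)
      fix w assume w: "w \<in> space (Q T)"
      show "ennreal (\<mu> * err T w t) \<le> ennreal (\<mu> * radius2 * L * (1 / ?c t)) + ennreal (\<mu> * diam2) * indicator B w"
      proof (cases "w \<in> B")
        case True
        have "ennreal (\<mu> * err T w t) \<le> ennreal (\<mu> * diam2)" using mu_pos err_le by (intro ennreal_leI mult_left_mono) auto
        thus ?thesis using True by (simp add: add_increasing)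
      next
        case False
        have "?c t * err T w t \<le> radius2 * L"
          using good_err[OF B(3)[OF w False] c] by (simp add: h_def L_def)
        hence "err T w t \<le> radius2 * L * (1 / ?c t)" using clk[OF t] by (simp add: field_simps)
        hence "\<mu> * err T w t \<le> \<mu> * (radius2 * L * (1 / ?c t))" using mu_pos by (intro mult_left_mono) auto
        thus ?thesis using False by (simp add: ennreal_leI mult.assoc)
      qed
    qed
    also have "\<dots> = ennreal (\<mu> * radius2 * L * (1 / ?c t)) + ennreal (\<mu> * diam2) * emeasure (Q T) B"
      by (subst nn_integral_add) (auto simp: nn_integral_cmult Q.emeasure_space_1)
    also have "\<dots> \<le> ennreal (\<mu> * radius2 * L * (1 / ?c t)) + ennreal (\<mu> * diam2) * ennreal \<beta>"
      by (intro add_mono mult_left_mono B(2)) auto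
    also have "\<dots> = ennreal (\<mu> * radius2 * L * (1 / ?c t) + \<mu> * diam2 * \<beta>)"
      using mu_pos constants_pos \<beta> radius2_pos L by (simp add: ennreal_mult[symmetric] ennreal_plus[symmetric] del: ennreal_plus)
    finally show ?thesis .
  qed
  define total where "total = (\<Sum>t=s..<e. \<mu> * radius2 * L * (1 / ?c t) + \<mu> * diam2 * \<beta>) + waste T + 2 * rb * T * \<beta>"
  have pos: "0 \<le> \<mu> * radius2 * L * (1 / ?c t) + \<mu> * diam2 * \<beta>" for t
    using mu_pos constants_pos \<beta> radius2_pos L by simp
  have total0: "0 \<le> total"
  proof -
    have "0 \<le> (\<Sum>t=s..<e. \<mu> * radius2 * L * (1 / ?c t) + \<mu> * diam2 * \<beta>)" by (intro sum_nonneg pos)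
    moreover have "0 \<le> 2 * rb * T * \<beta>" using rb_pos \<beta>(1) by simp
    ultimately show ?thesis unfolding total_def using waste0 by linarith
  qed
  have "(\<integral>\<^sup>+w. ennreal (regret T w) \<partial>Q T)
     \<le> (\<integral>\<^sup>+w. (\<Sum>t=s..<e. ennreal (?dis t w)) + ennreal (waste T) + ennreal (2 * rb * T) * indicator B w \<partial>Q T)"
  proof (rule nn_integral_mono_AE)
    show "AE w in Q T. ennreal (regret T w)
       \<le> (\<Sum>t=s..<e. ennreal (?dis t w)) + ennreal (waste T) + ennreal (2 * rb * T) * indicator B w"
      using typical_AE[of T] AE_space
    proof eventually_elim
      case (elim w)
      show ?case
      proof (cases "w \<in> B")
        case True
        have "ennreal (regret T w) \<le> ennreal (2 * rb * T)"
          using regret_crude[OF T(2) elim(1)] by (intro ennreal_leI) (simp add: abs_le_iff)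
        thus ?thesis using True by (simp add: add_increasing)
      next
        case False
        have "regret T w \<le> (\<Sum>t=s..<e. ?dis t w) + waste T"
          using regret_good[OF sr l B(3)[OF elim(2) False] elim(1)] by (simp add: s_def e_def h_def)
        hence "ennreal (regret T w) \<le> ennreal ((\<Sum>t=s..<e. ?dis t w) + waste T)" by (rule ennreal_leI)
        also have "\<dots> = (\<Sum>t=s..<e. ennreal (?dis t w)) + ennreal (waste T)"
          using waste0 by (subst ennreal_plus) (auto intro!: sum_nonneg disagreement_nonneg simp: sum_ennreal disagreement_nonneg)
        finally show ?thesis using False by simp
      qed
    qed
  qed
  also have "\<dots> = (\<Sum>t=s..<e. (\<integral>\<^sup>+w. ennreal (?dis t w) \<partial>Q T)) + ennreal (waste T) + ennreal (2 * rb * T) * emeasure (Q T) B"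
  proof -
    have m: "(\<lambda>w. ennreal (?dis t w)) \<in> borel_measurable (Q T)" if "t \<in> {s..<e}" for t
    proof -
      have "?dis t \<in> borel_measurable (Q T)" using that eT by (intro disagreement_measurable) auto
      thus ?thesis by measurable
    qed
    have ms: "(\<lambda>w. \<Sum>t=s..<e. ennreal (?dis t w)) \<in> borel_measurable (Q T)" by (intro borel_measurable_sum m)
    have "(\<integral>\<^sup>+w. (\<Sum>t=s..<e. ennreal (?dis t w)) + (ennreal (waste T) + ennreal (2 * rb * T) * indicator B w) \<partial>Q T)
      = (\<integral>\<^sup>+w. (\<Sum>t=s..<e. ennreal (?dis t w)) \<partial>Q T) + (\<integral>\<^sup>+w. ennreal (waste T) + ennreal (2 * rb * T) * indicator B w \<partial>Q T)"
      by (rule nn_integral_add[OF ms]) measurable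
    also have "(\<integral>\<^sup>+w. ennreal (waste T) + ennreal (2 * rb * T) * indicator B w \<partial>Q T) = ennreal (waste T) + ennreal (2 * rb * T) * emeasure (Q T) B"
      by (subst nn_integral_add) (auto simp: nn_integral_cmult Q.emeasure_space_1)
    also have "(\<integral>\<^sup>+w. (\<Sum>t=s..<e. ennreal (?dis t w)) \<partial>Q T) = (\<Sum>t=s..<e. (\<integral>\<^sup>+w. ennreal (?dis t w) \<partial>Q T))"
      by (rule nn_integral_sum[OF m])
    finally show ?thesis by (simp only: add.assoc)
  qed
  also have "\<dots> \<le> (\<Sum>t=s..<e. ennreal (\<mu> * radius2 * L * (1 / ?c t) + \<mu> * diam2 * \<beta>)) + ennreal (waste T) + ennreal (2 * rb * T) * ennreal \<beta>"
    by (intro add_mono sum_mono dis_le mult_left_mono B(2) order_refl) auto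
  also have "\<dots> = ennreal total"
  proof -
    have "(\<Sum>t=s..<e. ennreal (\<mu> * radius2 * L * (1 / ?c t) + \<mu> * diam2 * \<beta>)) = ennreal (\<Sum>t=s..<e. \<mu> * radius2 * L * (1 / ?c t) + \<mu> * diam2 * \<beta>)"
      by (rule sum_ennreal[OF pos])
    moreover have "ennreal (2 * rb * T) * ennreal \<beta> = ennreal (2 * rb * T * \<beta>)"
      using rb_pos \<beta> by (simp add: ennreal_mult)
    ultimately show ?thesis
      unfolding total_def using pos waste0 rb_pos \<beta> by (simp add: ennreal_plus sum_nonneg)
  qed
  finally have "(\<integral>w. regret T w \<partial>Q T) \<le> total" by (rule integral_real_bounded[OF total0])
  also have "total \<le> regret_const * L\<^sup>2"
  proof -
    have "(\<Sum>t=s..<e. \<mu> * radius2 * L * (1 / ?c t) + \<mu> * diam2 * \<beta>)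
      = \<mu> * radius2 * L * (\<Sum>t=s..<e. 1 / ?c t) + real (e - s) * (\<mu> * diam2 * \<beta>)"
      by (simp add: sum.distrib sum_distrib_left)
    also have "\<dots> \<le> \<mu> * radius2 * L * (4 * L) + \<mu> * diam2 * (2 + dimn)"
    proof (rule add_mono)
      have "(\<Sum>t=s..<e. 1 / ?c t) \<le> 2 * (1 + ln (2 * real h))"
        unfolding e_def using s0 by (intro clock_reciprocal_sum) auto
      also have "ln (2 * real h) \<le> L"
        unfolding L_def using s0 by (subst ln_le_cancel_iff) (auto simp: h_def)
      finally have "(\<Sum>t=s..<e. 1 / ?c t) \<le> 4 * L" using L by simp
      thus "\<mu> * radius2 * L * (\<Sum>t=s..<e. 1 / ?c t) \<le> \<mu> * radius2 * L * (4 * L)"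
        using mu_pos radius2_pos L by (intro mult_left_mono) auto
      have "real (e - s) * (\<mu> * diam2 * \<beta>) \<le> real T * (\<mu> * diam2 * \<beta>)"
        using eT mu_pos constants_pos \<beta> by (intro mult_right_mono) auto
      also have "\<dots> = \<mu> * diam2 * (T * \<beta>)" by simp
      finally show "real (e - s) * (\<mu> * diam2 * \<beta>) \<le> \<mu> * diam2 * (2 + dimn)" by (simp only: \<beta>)
    qed
    finally have 1: "(\<Sum>t=s..<e. \<mu> * radius2 * L * (1 / ?c t) + \<mu> * diam2 * \<beta>) \<le> 4 * \<mu> * radius2 * L\<^sup>2 + \<mu> * diam2 * (2 + dimn)"
      by (simp add: power2_eq_square)
    have 2: "2 * rb * T * \<beta> = 2 * rb * (2 + dimn)" using \<beta> by (simp add: mult.assoc)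
    have 3: "\<mu> * diam2 * (2 + dimn) + 2 * rb * (2 + dimn) \<le> (\<mu> * diam2 + 2 * rb) * (2 + dimn) * L\<^sup>2"
    proof -
      have "(\<mu> * diam2 + 2 * rb) * (2 + dimn) * 1 \<le> (\<mu> * diam2 + 2 * rb) * (2 + dimn) * L\<^sup>2"
        using mu_pos constants_pos rb_pos dimn_ge_1 L by (intro mult_left_mono) auto
      thus ?thesis by (simp add: distrib_right)
    qed
    have 4: "waste T \<le> (5 * (rb + ab * norm ps) + (\<Sum>j\<in>UNIV. ps $ j) * (5 * bb + 8 * scale)) * L\<^sup>2"
      using waste_bound(1)[of T] L by (simp add: L_def)
    have "total \<le> 4 * \<mu> * radius2 * L\<^sup>2 + (\<mu> * diam2 + 2 * rb) * (2 + dimn) * L\<^sup>2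
      + (5 * (rb + ab * norm ps) + (\<Sum>j\<in>UNIV. ps $ j) * (5 * bb + 8 * scale)) * L\<^sup>2"
      unfolding total_def 2 using 1 3 4 by linarith
    thus ?thesis by (simp add: regret_const_def distrib_right)
  qed
  finally show ?thesis by (simp add: L_def)
qed

lemma eventually_large:
  assumes "0 < \<rho>"
  shows "eventually (\<lambda>T. large \<rho> T \<and> buffered T) sequentially"
proof -
  have "eventually (\<lambda>T::nat. 1 \<le> ln T) sequentially" by real_asymp
  moreover have "eventually (\<lambda>T::nat. (ln T)\<^sup>2 + 1 < T / 2 - 1) sequentially" by real_asymp
  moreover have "eventually (\<lambda>T::nat. rate + 1 \<le> (ln T)\<^sup>2) sequentially" by real_asymp
  moreover have "eventually (\<lambda>T::nat. radius2 * ln T < \<rho>\<^sup>2 * (ln T)\<^sup>2) sequentially"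
    using assms by real_asymp
  \<comment> \<open>Why the warm-up length is a squared logarithm: the buffer needs the power 3/2
    and the tail bound one logarithm.\<close>
  moreover have "eventually (\<lambda>T::nat. (ab + 4 * scale * sqrt (ln T) * sqrt ((ln T)\<^sup>2 + 1)) / bb + ln T \<le> (ln T)\<^sup>2 * (bl / (2 * bb))) sequentially"
    using bl_pos bb_pos constants_pos(5) by real_asymp
  ultimately show ?thesis
  proof eventually_elim
    case (elim T)
    define s where "s = real (warmup T)"
    have s: "(ln T)\<^sup>2 \<le> s" "s \<le> (ln T)\<^sup>2 + 1"
      unfolding s_def warmup_def using of_int_ceiling_le_add_one[of "(ln (real T))\<^sup>2"] by (simp_all add: real_nat_ceiling_ge)
    have "T \<le> 2 * (T div 2) + 1" by simp
    hence "real T / 2 - 1 < real (T div 2)" by linarith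
    hence "warmup T < T div 2" using elim(2) s by (simp add: s_def)
    moreover have "radius2 * ln T < \<rho>\<^sup>2 * s"
      using elim(4) s assms by (meson less_le_trans mult_left_mono zero_le_power2)
    moreover have "rate + 1 \<le> s" using elim(3) s by linarith
    ultimately have "large \<rho> T" using elim(1) by (simp add: large_def s_def)
    moreover have "buffered T"
    proof -
      have "buffer T / bb + ln T \<le> (ab + 4 * scale * sqrt (ln T) * sqrt ((ln T)\<^sup>2 + 1)) / bb + ln T"
        unfolding buffer_def using s bb_pos constants_pos elim(1)
        by (intro add_mono divide_right_mono mult_left_mono order_refl) (auto simp: s_def)
      also have "\<dots> \<le> (ln T)\<^sup>2 * (bl / (2 * bb))" by (rule elim(5))
      also have "\<dots> \<le> s * (bl / (2 * bb))" using s bl_pos bb_pos by (intro mult_right_mono) auto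
      finally show ?thesis by (simp add: buffered_def s_def)
    qed
    ultimately show ?case by simp
  qed
qed

lemma regret_log_squared: "\<exists>C. \<forall>T\<ge>2. (\<integral>w. regret T w \<partial>Q T) \<le> C * (ln (real T))\<^sup>2"
proof -
  obtain \<rho> where sr: "slack_radius \<rho>" using slack_radius_exists ..
  obtain T0 where T0: "\<And>T. T0 \<le> T \<Longrightarrow> large \<rho> T \<and> buffered T"
    using eventually_large[of \<rho>] sr by (auto simp: eventually_sequentially slack_radius_def)
  \<comment> \<open>The second entry absorbs the horizons \<open>2 \<le> T < T0\<close>, using
    \<open>ln 2 \<le> ln T\<close> and the crude linear bound.\<close>
  define C where "C = max regret_const (2 * rb * T0 / (ln 2)\<^sup>2)"
  show ?thesis
  proof (intro exI[of _ C] allI impI)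
    fix T :: nat assume T: "2 \<le> T"
    show "(\<integral>w. regret T w \<partial>Q T) \<le> C * (ln (real T))\<^sup>2"
    proof (cases "T0 \<le> T")
      case True
      hence "(\<integral>w. regret T w \<partial>Q T) \<le> regret_const * (ln T)\<^sup>2" using T0 by (intro expected_regret[OF sr]) auto
      also have "\<dots> \<le> C * (ln T)\<^sup>2" by (intro mult_right_mono) (auto simp: C_def)
      finally show ?thesis .
    next
      case False
      have "(\<integral>w. regret T w \<partial>Q T) \<le> 2 * rb * T" using T by (intro regret_crude_expectation) simp
      also have "\<dots> \<le> 2 * rb * T0" using False rb_pos by simp
      also have "\<dots> = 2 * rb * T0 / (ln 2)\<^sup>2 * (ln 2)\<^sup>2" by simp
      also have "\<dots> \<le> C * (ln T)\<^sup>2"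
        using T rb_pos by (intro mult_mono power_mono) (auto simp: C_def le_max_iff_disj)
      finally show ?thesis .
    qed
  qed
qed

lemma regret_fun_eq: "regret_fun (policy rb bl gain scale) T wu = regret T (fst wu)"
  unfolding regret_fun_def by (subst dec_policy_indep[of rb bl gain scale T _ _ _ "\<lambda>_. 0"]) simp

lemma sample_space_regret:
  assumes "1 \<le> T"
  shows "integrable (sample_space P T) (regret_fun (policy rb bl gain scale) T)"
    and "Regret P (policy rb bl gain scale) T = (\<integral>w. regret T w \<partial>Q T)"
proof -
  interpret U: prob_space "PiM {..<T} (\<lambda>_. uniform_measure lborel {0..1::real})"
    by (intro prob_space_PiM prob_space_uniform_measure) auto
  have d: "distr (sample_space P T) (Q T) fst = Q T"
    unfolding sample_space_def by (rule U.distr_pair_fst)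
  have m: "fst \<in> sample_space P T \<rightarrow>\<^sub>M Q T" unfolding sample_space_def by measurable
  have f: "regret_fun (policy rb bl gain scale) T = (\<lambda>wu. regret T (fst wu))" by (rule ext) (rule regret_fun_eq)
  have "integrable (distr (sample_space P T) (Q T) fst) (regret T)" unfolding d by (rule regret_integrable[OF assms])
  thus "integrable (sample_space P T) (regret_fun (policy rb bl gain scale) T)"
    unfolding f by (subst (asm) integrable_distr_eq[OF m regret_measurable])
  show "Regret P (policy rb bl gain scale) T = (\<integral>w. regret T w \<partial>Q T)"
    unfolding Regret_def f by (subst d[symmetric], subst integral_distr[OF m regret_measurable]) simp
qed

end

theorem theorem4:
  "\<exists>pol :: real \<Rightarrow> real \<Rightarrow> real \<Rightarrow> real \<Rightarrow> real \<Rightarrow> real \<Rightarrow> real \<Rightarrow> real \<Rightarrow> ('m::finite) decision_rule.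
     \<forall>(P :: 'm obs measure) rb ab bb bl lmin lam mu dB.
       nondegenerate P rb ab bb bl lmin lam mu \<and> valid_deltaB P bl bb dB \<longrightarrow>
         policy_feasible (pol rb ab bb bl lmin lam mu dB) \<and>
         (\<exists>C. \<forall>T\<ge>2.
            integrable (sample_space P T) (regret_fun (pol rb ab bb bl lmin lam mu dB) T) \<and>
            Regret P (pol rb ab bb bl lmin lam mu dB) T \<le> C * (ln (real T))\<^sup>2)"
proof (intro exI[of _ "\<lambda>rb ab bb bl lmin lam mu dB. policy rb bl
    (regular_orders.gain TYPE('m) (lam * lmin)) (regular_orders.scale TYPE('m) rb ab bb bl (lam * lmin))"]
    allI impI conjI)
  \<comment> \<open>The witness is independent of the distribution: \<open>gain\<close> and
    \<open>scale\<close> involve only the boundedness constants, \<open>lam * lmin\<close> and the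
    number of resources, so outside the locale they are functions of the admissible inputs.\<close>
  fix P :: "'m obs measure" and rb ab bb bl lmin lam mu dB
  assume nd: "nondegenerate P rb ab bb bl lmin lam mu \<and> valid_deltaB P bl bb dB"
  show "policy_feasible (policy rb bl (regular_orders.gain TYPE('m) (lam * lmin))
      (regular_orders.scale TYPE('m) rb ab bb bl (lam * lmin)) :: 'm decision_rule)"
    by (rule policy_feasible)
  obtain ps where "regular_orders P rb ab bb bl (lam * lmin) (mu * ab\<^sup>2) ps"
    using nd nondegenerate_regular by blast
  then interpret regular_orders P rb ab bb bl "lam * lmin" "mu * ab\<^sup>2" ps .
  obtain C where C: "\<And>T. 2 \<le> T \<Longrightarrow> (\<integral>w. regret T w \<partial>Q T) \<le> C * (ln (real T))\<^sup>2"
    using regret_log_squared by blast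
  show "\<exists>C. \<forall>T\<ge>2. integrable (sample_space P T) (regret_fun (policy rb bl gain scale) T) \<and>
      Regret P (policy rb bl gain scale) T \<le> C * (ln (real T))\<^sup>2"
    using C by (intro exI[of _ C] allI impI conjI) (auto intro: sample_space_regret(1) simp: sample_space_regret(2))
qed

end
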